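(* Let $s>0$ with $2s\in\mathbb N$, let $N\in\mathbb N$, $N\ge 1$, and let $0\le\rho_l\le\rho_r<\infty$. Set $n:=2s(N+1)-1$. Let $U_1,\dots,U_n$ be independent random variables uniform on $(0,1)$, let $\Theta_i=\rho_l+(\rho_r-\rho_l)U_i$ for $i=1,\dots,n$, and let $\Theta_{1,n}\le\Theta_{2,n}\le\dots\le\Theta_{n,n}$ be the ascending order statistics of $\Theta_1,\dots,\Theta_n$. Then the invariant probability measure $\mu_{N,\rho_l,\rho_r}$ of the boundary-driven harmonic process with parameter $s$, size $N$ and reservoir densities $\rho_l,\rho_r$ is given, for all $\eta\in\mathbb N_0^N$, by $$\mu_{N,\rho_l,\rho_r}(\eta)=\mathbb E\left[\prod_{i=1}^N\nu_{\Theta_{2si,n}}(\eta_i)\right],$$ where $\nu_\theta$ is the Negative Binomial law with shape parameter $2s$ and mean $2s\theta$. More explicitly, if $\rho_l<\rho_r$, then with the convention $\theta_0=\rho_l$, $\theta_{N+1}=\rho_r$, $$\mu_{N,\rho_l,\rho_r}(\eta)=\frac{\Gamma(2s(N+1))}{\Gamma(2s)^{N+1}}\frac{1}{(\rho_r-\rho_l)^{2s(N+1)-1}}\int_{\rho_l}^{\rho_r}d\theta_1\int_{\theta_1}^{\rho_r}d\theta_2\cdots\int_{\theta_{N-1}}^{\rho_r}d\theta_N\ \prod_{i=1}^{N+1}(\theta_i-\theta_{i-1})^{2s-1}\prod_{i=1}^N\frac{1}{\eta_i!}\frac{\Gamma(2s+\eta_i)}{\Gamma(2s)}\left(\frac{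\theta_i}{1+\theta_i}\right)^{\eta_i}\left(\frac{1}{1+\theta_i}\right)^{2s}.$$
   Context: Negative Binomial law: for $\theta\ge 0$ and $m\in\mathbb N_0$, $\nu_\theta(m)=\frac{1}{m!}\frac{\Gamma(2s+m)}{\Gamma(2s)}\left(\frac{\theta}{1+\theta}\right)^m\left(\frac1{1+\theta}\right)^{2s}$ (with $0^0=1$). Boundary-driven harmonic process: let $s>0$, $N\ge1$, $0\le\rho_l\le\rho_r<\infty$. Let $\Omega_N=\mathbb N_0^N$ and let $\delta^i$ be the configuration with one particle at site $i$ and none elsewhere. For $1\le k\le m$ let $\varphi_s(k,m)=\frac1k\frac{\Gamma(m+1)\Gamma(m-k+2s)}{\Gamma(m-k+1)\Gamma(m+2s)}$. The process is the continuous-time Markov chain on $\Omega_N$ with generator $\mathscr L f=\mathscr L_{\mathrm{left}}f+\sum_{i=1}^{N-1}\mathscr L_{i,i+1}f+\mathscr L_{\mathrm{right}}f$, where $$(\mathscr L_{i,i+1}f)(\eta)=\sum_{k=1}^{\eta_i}\varphi_s(k,\eta_i)[f(\eta-k\delta^i+k\delta^{i+1})-f(\eta)]+\sum_{k=1}^{\eta_{i+1}}\varphi_s(k,\eta_{i+1})[f(\eta+k\delta^i-k\delta^{i+1})-f(\eta)],$$ and $\mathscr L_{\mathrm{left}}$ (acting at site $i=1$ with $\varrho=\rho_l$) and $\mathscr L_{\mathrm{right}}$ (acting at site $i=N$ with $\varrho=\rho_r$) have the form $$f\mapsto\sum_{k=1}^{\eta_i}\varphi_s(k,\eta_i)[f(\eta-k\delta^i)-f(\eta)]+\sum_{k=1}^\infty\frac1k\left(\frac{\varrho}{1+\varrho}\right)^k[f(\eta+k\delta^i)-f(\eta)].$$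 $\mu_{N,\rho_l,\rho_r}$ denotes the invariant probability measure of this process. *)

theory Defs
  imports "HOL-Probability.Probability"
begin

text \<open>A Markov chain is represented by its transition probabilities: \<open>P t x\<close> is the law at time
  \<open>t\<close> of the chain started at \<open>x\<close>. Since the values are of type \<open>pmf\<close>, no mass is lost
  (non-explosion). Values of \<open>P\<close> for negative times or outside \<open>S\<close> are irrelevant.\<close>

definition markov_semigroup :: "'a set \<Rightarrow> (real \<Rightarrow> 'a \<Rightarrow> 'a pmf) \<Rightarrow> bool" where
  "markov_semigroup S P \<longleftrightarrow>
     (\<forall>t\<ge>0. \<forall>x\<in>S. set_pmf (P t x) \<subseteq> S) \<and>
     (\<forall>x\<in>S. P 0 x = return_pmf x) \<and>
     (\<forall>t\<ge>0. \<forall>u\<ge>0. \<forall>x\<in>S. P (t + u) x = bind_pmf (P t x) (P u))"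

text \<open>The jump rates of the harmonic process are unbounded, so the limit defining the generator is
  taken pointwise in the state; for bounded \<open>f\<close> it exists whenever the total jump rate out of
  each state is finite.\<close>

definition has_generator ::
    "'a set \<Rightarrow> (real \<Rightarrow> 'a \<Rightarrow> 'a pmf) \<Rightarrow> (('a \<Rightarrow> real) \<Rightarrow> 'a \<Rightarrow> real) \<Rightarrow> bool" where
  "has_generator S P L \<longleftrightarrow>
     (\<forall>f. bounded (f ` S) \<longrightarrow> (\<forall>x\<in>S.
        ((\<lambda>t. (measure_pmf.expectation (P t x) f - f x) / t) \<longlongrightarrow> L f x) (at_right 0)))"

definition invariant_law :: "'a set \<Rightarrow> (real \<Rightarrow> 'a \<Rightarrow> 'a pmf) \<Rightarrow> 'a pmf \<Rightarrow> bool" where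
  "invariant_law S P \<mu> \<longleftrightarrow> set_pmf \<mu> \<subseteq> S \<and> (\<forall>t\<ge>0. bind_pmf \<mu> (P t) = \<mu>)"

text \<open>Configurations on the sites \<open>1, \<dots>, N\<close>, extended by zero to all of \<open>nat\<close>.\<close>

definition configs :: "nat \<Rightarrow> (nat \<Rightarrow> nat) set" where
  "configs N = {\<eta>. \<forall>i. i \<notin> {1..N} \<longrightarrow> \<eta> i = 0}"

definition \<phi> :: "real \<Rightarrow> nat \<Rightarrow> nat \<Rightarrow> real" where
  "\<phi> s k m = 1 / real k * (Gamma (real m + 1) * Gamma (real m - real k + 2 * s)) /
              (Gamma (real m - real k + 1) * Gamma (real m + 2 * s))"

definition bulk_generator ::
    "real \<Rightarrow> nat \<Rightarrow> ((nat \<Rightarrow> nat) \<Rightarrow> real) \<Rightarrow> (nat \<Rightarrow> nat) \<Rightarrow> real" where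
  "bulk_generator s i f \<eta> =
     (\<Sum>k=1..\<eta> i. \<phi> s k (\<eta> i) *
        (f (\<eta>(i := \<eta> i - k, i + 1 := \<eta> (i + 1) + k)) - f \<eta>)) +
     (\<Sum>k=1..\<eta> (i + 1). \<phi> s k (\<eta> (i + 1)) *
        (f (\<eta>(i := \<eta> i + k, i + 1 := \<eta> (i + 1) - k)) - f \<eta>))"

text \<open>The series over \<open>k \<ge> 1\<close> is indexed by \<open>k = Suc j\<close>.\<close>

definition reservoir_generator ::
    "real \<Rightarrow> real \<Rightarrow> nat \<Rightarrow> ((nat \<Rightarrow> nat) \<Rightarrow> real) \<Rightarrow> (nat \<Rightarrow> nat) \<Rightarrow> real" where
  "reservoir_generator s \<rho> i f \<eta> =
     (\<Sum>k=1..\<eta> i. \<phi> s k (\<eta> i) * (f (\<eta>(i := \<eta> i - k)) - f \<eta>)) +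
     (\<Sum>j. 1 / real (Suc j) * (\<rho> / (1 + \<rho>)) ^ Suc j * (f (\<eta>(i := \<eta> i + Suc j)) - f \<eta>))"

definition harmonic_generator ::
    "real \<Rightarrow> nat \<Rightarrow> real \<Rightarrow> real \<Rightarrow> ((nat \<Rightarrow> nat) \<Rightarrow> real) \<Rightarrow> (nat \<Rightarrow> nat) \<Rightarrow> real" where
  "harmonic_generator s N \<rho>l \<rho>r f \<eta> =
     reservoir_generator s \<rho>l 1 f \<eta> + (\<Sum>i=1..<N. bulk_generator s i f \<eta>) +
     reservoir_generator s \<rho>r N f \<eta>"

definition harmonic_process ::
    "real \<Rightarrow> nat \<Rightarrow> real \<Rightarrow> real \<Rightarrow> (real \<Rightarrow> (nat \<Rightarrow> nat) \<Rightarrow> (nat \<Rightarrow> nat) pmf) \<Rightarrow> bool" where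
  "harmonic_process s N \<rho>l \<rho>r P \<longleftrightarrow>
     markov_semigroup (configs N) P \<and>
     has_generator (configs N) P (harmonic_generator s N \<rho>l \<rho>r)"

definition neg_binomial :: "real \<Rightarrow> real \<Rightarrow> nat \<Rightarrow> real" where
  "neg_binomial s \<theta> m =
     1 / fact m * (Gamma (2 * s + real m) / Gamma (2 * s)) *
     (\<theta> / (1 + \<theta>)) ^ m * (1 / (1 + \<theta>)) powr (2 * s)"

text \<open>\<open>order_stat n x j\<close>, for \<open>j \<in> {1..n}\<close>, is the \<open>j\<close>-th smallest of \<open>x 1, \<dots>, x n\<close>,
  counted with multiplicity.\<close>

definition order_stat :: "nat \<Rightarrow> (nat \<Rightarrow> real) \<Rightarrow> nat \<Rightarrow> real" where
  "order_stat n x j = sort (map x [1..<n + 1]) ! (j - 1)"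

text \<open>The integral of \<open>F [\<theta>\<^sub>1, \<dots>, \<theta>\<^sub>n]\<close>, iterated over
  \<open>a \<le> \<theta>\<^sub>1 \<le> b\<close>, \<open>\<theta>\<^sub>1 \<le> \<theta>\<^sub>2 \<le> b\<close>, \dots, \<open>\<theta>\<^sub>n\<^sub>-\<^sub>1 \<le> \<theta>\<^sub>n \<le> b\<close>.\<close>

primrec nested_integral :: "nat \<Rightarrow> real \<Rightarrow> real \<Rightarrow> (real list \<Rightarrow> real) \<Rightarrow> real" where
  "nested_integral 0 a b F = F []"
| "nested_integral (Suc n) a b F =
     (LBINT x:{a..b}. nested_integral n x b (\<lambda>\<theta>s. F (x # \<theta>s)))"

end

theory Submission
  imports Defs
begin

text \<open>Given neighbouring densities \<open>x \<le> y\<close>, a site whose density \<open>t\<close> is drawn with weight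
  \<open>(t - x)\<^sup>2\<^sup>s\<^sup>-\<^sup>1 (y - t)\<^sup>2\<^sup>s\<^sup>-\<^sup>1\<close> and whose occupation is then negative binomial is
  stationary between reservoirs of densities \<open>x\<close> and \<open>y\<close>: in terms of generating functions this is an
  integral that changes sign under an involution of \<open>[x, y]\<close>. When the bulk generator acts on a product
  of negative binomial laws, a site sees each neighbour as a reservoir with the neighbour's density, up
  to terms that telescope. Hence the mixture over the density \<open>\<Prod>(\<theta>\<^sub>i - \<theta>\<^sub>i\<^sub>-\<^sub>1)\<^sup>2\<^sup>s\<^sup>-\<^sup>1\<close>, which is the
  joint density of every \<open>2s\<close>-th order statistic, satisfies the balance equation site by site. The exit
  rates are integrable under this mixture, so the balance equation implies invariance under the
  semigroup. Uniqueness holds because the empty configuration is accessible from every state.\<close>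

section \<open>Invariant laws of countable Markov semigroups\<close>

text \<open>The jump rates are unbounded and \<open>has_generator\<close> provides only a right
  derivative at time 0, state by state. No forward equation for the law at time t is given, so
  balance does not yield invariance by itself; it is carried through time by estimates on single
  transition probabilities. The special form of \<phi> enters through
  \<open>\<phi>_mult_neg_binomial\<close>: under the law of density t, a site sends out k particles
  as a reservoir of density t sends them in. Put w = 1 - z. The generating function of that law is
  (1 + t w) to the power - 2 s, that of the injection rates at density u is ln (1 + u) - ln (1 + u
  w). The constants ln (1 + u) are total rates and form the telescoping part; each neighbour of
  density u is left with the factor ln (1 + t w) - ln (1 + u w). That 2 s is an integer d makes the
  gap weights volumes of simplices, up to a factorial: d - 1 sample points lie between consecutive
  selected ones. Gains and losses are kept apart as [0, \<infinity>]-valued quantities, so that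
  series and integrals can be interchanged before anything is known to be finite.\<close>

lemma right_derivative_zero_imp_constant:
  fixes g :: "real \<Rightarrow> real"
  assumes cont: "continuous_on {0..} g"
    and deriv: "\<And>t. 0 \<le> t \<Longrightarrow> ((\<lambda>h. (g (t + h) - g t) / h) \<longlongrightarrow> 0) (at_right 0)"
    and T: "0 \<le> T"
  shows "g T = g 0"
proof -
  \<comment> \<open>The mean value theorem would need a two-sided derivative. Instead, for each e
    the linear bound is propagated: the last time up to which it holds cannot lie before T.\<close>
  have bound: "\<bar>g T - g 0\<bar> \<le> e * T" if e: "e > 0" for e
  proof (rule ccontr)
    assume neg: "\<not> \<bar>g T - g 0\<bar> \<le> e * T"
    define B where "B = {t \<in> {0..T}. \<forall>u\<in>{0..t}. \<bar>g u - g 0\<bar> \<le> e * u}"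
    define \<tau> where "\<tau> = Sup B"
    have B0: "0 \<in> B" using T by (auto simp: B_def)
    have bdd: "bdd_above B" by (rule bdd_aboveI[of _ T]) (auto simp: B_def)
    have tau: "0 \<le> \<tau>" "\<tau> \<le> T"
      unfolding \<tau>_def using B0 bdd by (auto intro: cSup_upper) (auto intro!: cSup_least simp: B_def)
    have below: "\<bar>g u - g 0\<bar> \<le> e * u" if "0 \<le> u" "u < \<tau>" for u
    proof -
      obtain t where "t \<in> B" "u < t"
        using \<open>u < \<tau>\<close> B0 less_cSup_iff[of B u] bdd unfolding \<tau>_def by blast
      then show ?thesis using that by (auto simp: B_def)
    qed
    have at_tau: "\<bar>g \<tau> - g 0\<bar> \<le> e * \<tau>"
    proof (cases "\<tau> = 0")
      case False
      then have pos: "\<tau> > 0" using tau by simp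
      have "isCont g \<tau>"
        using cont pos by (auto intro: continuous_on_interior simp: interior_Ici[of "-1"])
      then have "(g \<longlongrightarrow> g \<tau>) (at_left \<tau>)"
        by (auto simp: isCont_def intro: tendsto_mono at_le)
      then have lim: "((\<lambda>u. \<bar>g u - g 0\<bar>) \<longlongrightarrow> \<bar>g \<tau> - g 0\<bar>) (at_left \<tau>)"
        by (intro tendsto_intros)
      have "((\<lambda>u. e * u) \<longlongrightarrow> e * \<tau>) (at_left \<tau>)"
        by (intro tendsto_intros)
      moreover have "\<forall>\<^sub>F u in at_left \<tau>. \<bar>g u - g 0\<bar> \<le> e * u"
        using eventually_at_left_real[OF pos]
        by eventually_elim (use below in auto)
      ultimately show ?thesis
        using lim by (intro tendsto_le[of "at_left \<tau>"]) auto
    qed simp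
    have lt: "\<tau> < T" using neg at_tau tau by (cases "\<tau> = T") auto
    have "\<forall>\<^sub>F h in at_right 0. \<bar>(g (\<tau> + h) - g \<tau>) / h\<bar> < e"
      using order_tendstoD(2)[OF tendsto_rabs[OF deriv[OF tau(1)]], of e] e by simp
    then obtain b where b: "b > 0" "\<And>h. 0 < h \<Longrightarrow> h < b \<Longrightarrow> \<bar>(g (\<tau> + h) - g \<tau>) / h\<bar> < e"
      unfolding eventually_at_right_field by auto
    \<comment> \<open>Within the range where the difference quotient is below e, and not past
      T.\<close>
    define h where "h = min (b / 2) (T - \<tau>)"
    have h: "0 < h" "h < b" "\<tau> + h \<le> T" using b lt by (auto simp: h_def)
    have "\<tau> + h \<in> B"
      unfolding B_def
    proof (intro CollectI conjI ballI)
      fix u assume u: "u \<in> {0..\<tau> + h}"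
      show "\<bar>g u - g 0\<bar> \<le> e * u"
      proof (cases "u \<le> \<tau>")
        case True
        then show ?thesis using below[of u] at_tau u by (cases "u = \<tau>") auto
      next
        case False
        define k where "k = u - \<tau>"
        have k: "0 < k" "k < b" "u = \<tau> + k" using False u h by (auto simp: k_def)
        have "\<bar>g u - g \<tau>\<bar> < e * k"
          using b(2)[OF k(1,2)] k by (simp add: abs_divide field_simps)
        then have "\<bar>g u - g 0\<bar> \<le> e * k + e * \<tau>" using at_tau by linarith
        then show ?thesis using k by (simp add: algebra_simps)
      qed
    qed (use tau h in auto)
    then have "\<tau> + h \<le> \<tau>" unfolding \<tau>_def using bdd by (rule cSup_upper)
    then show False using h by simp
  qed
  have "\<bar>g T - g 0\<bar> \<le> 0"
  proof (rule field_le_epsilon)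
    fix e :: real assume "e > 0"
    \<comment> \<open>Dividing by T + 1 instead of T also covers T = 0.\<close>
    then have "\<bar>g T - g 0\<bar> \<le> e / (T + 1) * T" using T by (intro bound) auto
    also have "\<dots> \<le> e" using \<open>e > 0\<close> T by (simp add: field_simps)
    finally show "\<bar>g T - g 0\<bar> \<le> 0 + e" by simp
  qed
  then show ?thesis by simp
qed

lemma integrable_measure_pmf_unit:
  fixes f :: "'a \<Rightarrow> real"
  assumes "\<And>x. 0 \<le> f x" "\<And>x. f x \<le> 1"
  shows "integrable (measure_pmf p) f"
  using assms by (intro measure_pmf.integrable_const_bound[of _ 1]) auto

section \<open>Transition probabilities as functions of time\<close>

context
  fixes S :: "'a set" and P :: "real \<Rightarrow> 'a \<Rightarrow> 'a pmf" and L :: "('a \<Rightarrow> real) \<Rightarrow> 'a \<Rightarrow> real"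
  assumes semigroup: "markov_semigroup S P" and generator: "has_generator S P L"
begin

lemma pmf_semigroup:
  assumes "0 \<le> t" "0 \<le> u" "x \<in> S"
  shows "pmf (P (t + u) x) y = measure_pmf.expectation (P t x) (\<lambda>z. pmf (P u z) y)"
  using semigroup assms by (simp add: markov_semigroup_def pmf_bind)

lemma generator_tendsto:
  assumes "x \<in> S" "\<And>z. 0 \<le> f z" "\<And>z. f z \<le> 1"
  shows "((\<lambda>t. (measure_pmf.expectation (P t x) f - f x) / t) \<longlongrightarrow> L f x) (at_right 0)"
proof -
  have "bounded (f ` S)" using assms by (intro boundedI[of _ 1]) auto
  then show ?thesis using generator assms by (simp add: has_generator_def)
qed

lemma semigroup_zero: "x \<in> S \<Longrightarrow> P 0 x = return_pmf x"
  using semigroup by (simp add: markov_semigroup_def)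

lemma pmf_semigroup_ge:
  assumes "0 \<le> t" "0 \<le> u" "x \<in> S"
  shows "pmf (P (t + u) x) y \<ge> pmf (P t x) z * pmf (P u z) y"
proof -
  have "pmf (P t x) z * pmf (P u z) y
      = measure_pmf.expectation (P t x) (\<lambda>w. pmf (P u z) y * indicator {z} w)"
    by (simp add: measure_pmf_single)
  also have "\<dots> \<le> measure_pmf.expectation (P t x) (\<lambda>w. pmf (P u w) y)"
    by (intro integral_mono integrable_measure_pmf_unit)
       (auto simp: pmf_le_1 indicator_def)
  finally show ?thesis using assms by (simp add: pmf_semigroup)
qed

lemma generator_indicator_tendsto:
  assumes "x \<in> S"
  shows "((\<lambda>t. (pmf (P t x) y - indicator {y} x) / t) \<longlongrightarrow> L (indicator {y}) x) (at_right 0)"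
  using generator_tendsto[OF assms, of "indicator {y}"]
  by (simp add: measure_pmf_single)

lemma pmf_diag_power:
  assumes x: "x \<in> S" and t: "0 \<le> t"
  shows "pmf (P (real n * t) x) x \<ge> pmf (P t x) x ^ n"
proof (induction n)
  case (Suc n)
  have "pmf (P t x) x ^ Suc n \<le> pmf (P t x) x * pmf (P (real n * t) x) x"
    using Suc by (simp add: mult_left_mono)
  also have "\<dots> \<le> pmf (P (t + real n * t) x) x"
    using x t by (intro pmf_semigroup_ge) auto
  finally show ?case by (simp add: algebra_simps)
qed (use x in \<open>simp add: semigroup_zero\<close>)

text \<open>Diagonal probabilities are supermultiplicative in time, so Bernoulli's inequality bounds
  1 - p(t) by n (1 - p(t/n)). Letting n grow turns the derivative at 0 into a bound at every
  time.\<close>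

lemma pmf_diag_lower:
  assumes x: "x \<in> S" and t: "0 \<le> t"
  shows "1 - pmf (P t x) x \<le> - L (indicator {x}) x * t"
proof (cases "t = 0")
  case True then show ?thesis using x by (simp add: semigroup_zero)
next
  case False
  then have t: "t > 0" using t by simp
  have lim: "((\<lambda>n. (pmf (P (t / real (Suc n)) x) x - 1) / (t / real (Suc n))) \<longlongrightarrow> L (indicator {x}) x) sequentially"
  proof (rule filterlim_compose[of "\<lambda>h. (pmf (P h x) x - 1) / h"])
    show "((\<lambda>h. (pmf (P h x) x - 1) / h) \<longlongrightarrow> L (indicator {x}) x) (at_right 0)"
      using generator_indicator_tendsto[OF x, of x] by simp
    show "filterlim (\<lambda>n. t / real (Suc n)) (at_right 0) sequentially"
      unfolding filterlim_at
      using t LIMSEQ_Suc[OF lim_const_over_n[of t]] by (auto simp del: of_nat_Suc)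
  qed
  have "1 - pmf (P t x) x \<le> - ((pmf (P (t / real (Suc n)) x) x - 1) / (t / real (Suc n))) * t" for n
  proof -
    let ?v = "pmf (P (t / real (Suc n)) x) x"
    have "1 + real (Suc n) * (?v - 1) \<le> (1 + (?v - 1)) ^ Suc n"
      by (rule Bernoulli_inequality) simp
    also have "\<dots> \<le> pmf (P (real (Suc n) * (t / real (Suc n))) x) x"
      using pmf_diag_power[OF x, of "t / real (Suc n)" "Suc n"] t by simp
    also have "real (Suc n) * (t / real (Suc n)) = t" by simp
    finally have "1 - pmf (P t x) x \<le> real (Suc n) * (1 - ?v)" by (simp add: algebra_simps)
    also have "\<dots> = - ((?v - 1) / (t / real (Suc n))) * t" using t by (simp add: field_simps)
    finally show ?thesis .
  qed
  then show ?thesis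
    by (intro tendsto_le[OF _ tendsto_mult[OF tendsto_minus[OF lim] tendsto_const] tendsto_const])
       auto
qed

text \<open>The increment h is taken as the first step. A function with values in [0,1] can then
  change only if the chain has left x during that step, so the bound depends on neither t nor
  y.\<close>

lemma pmf_semigroup_lipschitz:
  assumes x: "x \<in> S" and t: "0 \<le> t" and h: "0 \<le> h"
  shows "\<bar>pmf (P (t + h) x) y - pmf (P t x) y\<bar> \<le> - L (indicator {x}) x * h"
proof -
  let ?f = "\<lambda>z. pmf (P t z) y"
  have [simp]: "integrable (measure_pmf (P h x)) ?f"
    by (rule integrable_measure_pmf_unit) (auto simp: pmf_le_1)
  have ind: "measure_pmf.expectation (P h x) (\<lambda>z. 1 - indicator {x} z) = 1 - pmf (P h x) x"
    by (subst Bochner_Integration.integral_diff)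
       (auto simp: measure_pmf_single intro!: integrable_measure_pmf_unit)
  have "pmf (P (t + h) x) y - ?f x = measure_pmf.expectation (P h x) (\<lambda>z. ?f z - ?f x)"
    using pmf_semigroup[OF h t x, of y] by (simp add: add.commute)
  also have "\<bar>\<dots>\<bar> \<le> measure_pmf.expectation (P h x) (\<lambda>z. \<bar>?f z - ?f x\<bar>)"
    by (rule integral_abs_bound)
  also have "\<dots> \<le> measure_pmf.expectation (P h x) (\<lambda>z. 1 - indicator {x} z)"
  proof (intro integral_mono)
    fix z show "\<bar>?f z - ?f x\<bar> \<le> 1 - indicator {x} z"
      using pmf_le_1[of "P t z" y] pmf_le_1[of "P t x" y] pmf_nonneg[of "P t z" y] pmf_nonneg[of "P t x" y]
      by (auto simp: indicator_def simp del: pmf_nonneg)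
  qed (auto intro!: integrable_measure_pmf_unit simp: indicator_def)
  also have "\<dots> \<le> - L (indicator {x}) x * h"
    using pmf_diag_lower[OF x h] ind by simp
  finally show ?thesis .
qed

text \<open>Integrability of the exit rates under \<open>\<mu>\<close> is what replaces non-explosion: it makes
  \<open>t \<mapsto> (\<mu> P\<^sub>t)(y)\<close> Lipschitz and lets the generator be applied under the sum over states.\<close>

lemma invariant_lawI:
  assumes \<mu>: "set_pmf \<mu> \<subseteq> S"
    and int: "integrable (measure_pmf \<mu>) (\<lambda>x. - L (indicator {x}) x)"
    and stat: "\<And>f. (\<And>z. 0 \<le> f z) \<Longrightarrow> (\<And>z. f z \<le> 1) \<Longrightarrow> measure_pmf.expectation \<mu> (L f) = 0"
  shows "invariant_law S P \<mu>"
  unfolding invariant_law_def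
proof (intro conjI allI impI \<mu>)
  fix T :: real assume T: "0 \<le> T"
  show "bind_pmf \<mu> (P T) = \<mu>"
  proof (rule pmf_eqI)
    fix y
    let ?q = "\<lambda>x. - L (indicator {x}) x"
    define g where "g t = measure_pmf.expectation \<mu> (\<lambda>x. pmf (P t x) y)" for t
    have AE: "AE x in measure_pmf \<mu>. x \<in> S" using \<mu> by (auto simp: AE_measure_pmf_iff)
    have intg [simp]: "integrable (measure_pmf \<mu>) (\<lambda>x. pmf (P t x) y)" for t
      by (rule integrable_measure_pmf_unit) (auto simp: pmf_le_1)
    have lip: "\<bar>g (t + h) - g t\<bar> \<le> measure_pmf.expectation \<mu> ?q * h" if "0 \<le> t" "0 \<le> h" for t h
    proof -
      have "g (t + h) - g t = measure_pmf.expectation \<mu> (\<lambda>x. pmf (P (t + h) x) y - pmf (P t x) y)"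
        by (simp add: g_def)
      also have "\<bar>\<dots>\<bar> \<le> measure_pmf.expectation \<mu> (\<lambda>x. \<bar>pmf (P (t + h) x) y - pmf (P t x) y\<bar>)"
        by (rule integral_abs_bound)
      also have "\<dots> \<le> measure_pmf.expectation \<mu> (\<lambda>x. ?q x * h)"
      proof (rule integral_mono_AE)
        show "AE x in measure_pmf \<mu>. \<bar>pmf (P (t + h) x) y - pmf (P t x) y\<bar> \<le> ?q x * h"
          using AE by eventually_elim (use that in \<open>auto intro: order_trans[OF pmf_semigroup_lipschitz]\<close>)
      qed (use int in auto)
      finally show ?thesis by simp
    qed
    have "g T = g 0"
    proof (rule right_derivative_zero_imp_constant[OF _ _ T])
      let ?K = "measure_pmf.expectation \<mu> ?q"
      have sym: "\<bar>g t - g u\<bar> \<le> ?K * \<bar>t - u\<bar>" if "0 \<le> t" "0 \<le> u" for t u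
        using lip[of t "u - t"] lip[of u "t - u"] that
        by (cases "t \<le> u") (simp_all add: abs_minus_commute)
      have "0 \<le> ?K" using sym[of 1 0] by simp
      then have "?K-lipschitz_on {0..} g"
        using sym by (auto simp: lipschitz_on_def dist_real_def)
      then show "continuous_on {0..} g" by (rule lipschitz_on_continuous_on)
    next
      fix t :: real assume t: "0 \<le> t"
      \<comment> \<open>With the increment placed first, the generator acts on this bounded function
        of the state, and the hypothesis on \<mu> applies to it directly.\<close>
      let ?f = "\<lambda>z. pmf (P t z) y"
      have unit: "0 \<le> ?f z" "?f z \<le> 1" for z by (auto simp: pmf_le_1)
      show "((\<lambda>h. (g (t + h) - g t) / h) \<longlongrightarrow> 0) (at_right 0)"
        unfolding tendsto_at_iff_sequentially
      proof (intro allI impI)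
        fix h :: "nat \<Rightarrow> real"
        assume h: "\<forall>i. h i \<in> {0<..} - {0}" and h0: "h \<longlonglongrightarrow> 0"
        then have hpos: "h i > 0" for i by auto
        have hr: "filterlim h (at_right 0) sequentially"
          using h0 hpos by (auto simp: filterlim_at less_imp_neq[THEN not_sym])
        \<comment> \<open>The exit rates dominate the difference quotients because the Lipschitz
          constant is the same for all t and y.\<close>
        have "(\<lambda>i. measure_pmf.expectation \<mu> (\<lambda>x. (pmf (P (t + h i) x) y - ?f x) / h i))
            \<longlonglongrightarrow> measure_pmf.expectation \<mu> (L ?f)"
        proof (rule integral_dominated_convergence[where w = ?q])
          show "AE x in measure_pmf \<mu>. (\<lambda>i. (pmf (P (t + h i) x) y - ?f x) / h i) \<longlonglongrightarrow> L ?f x"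
            using AE
          proof eventually_elim
            case (elim x)
            have "(\<lambda>i. (measure_pmf.expectation (P (h i) x) ?f - ?f x) / h i) \<longlonglongrightarrow> L ?f x"
              by (rule filterlim_compose[OF generator_tendsto[OF elim unit] hr])
            moreover have "measure_pmf.expectation (P (h i) x) ?f = pmf (P (t + h i) x) y" for i
              using pmf_semigroup[of "h i" t x y] hpos[of i] t elim by (simp add: add.commute)
            ultimately show ?case by simp
          qed
          show "AE x in measure_pmf \<mu>. norm ((pmf (P (t + h i) x) y - ?f x) / h i) \<le> ?q x" for i
            using AE
          proof eventually_elim
            case (elim x)
            then show ?case using pmf_semigroup_lipschitz[of x t "h i" y] hpos[of i] t
              by (simp add: abs_divide field_simps)
          qed
        qed (use int in auto)
        moreover have "measure_pmf.expectation \<mu> (\<lambda>x. (pmf (P (t + h i) x) y - ?f x) / h i)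
            = (g (t + h i) - g t) / h i" for i
          by (simp add: g_def del: divide_cancel_right)
        moreover have "measure_pmf.expectation \<mu> (L ?f) = 0" by (rule stat) (rule unit)+
        ultimately show "((\<lambda>h. (g (t + h) - g t) / h) \<circ> h) \<longlonglongrightarrow> 0"
          by (simp only: comp_def)
      qed
    qed
    moreover have "g 0 = pmf \<mu> y"
    proof -
      have "g 0 = measure_pmf.expectation \<mu> (indicator {y})"
        unfolding g_def
      proof (rule integral_cong_AE)
        show "AE x in measure_pmf \<mu>. pmf (P 0 x) y = indicator {y} x"
          using AE by eventually_elim (auto simp: semigroup_zero indicator_def)
      qed auto
      then show ?thesis by (simp add: measure_pmf_single)
    qed
    ultimately show "pmf (bind_pmf \<mu> (P T)) y = pmf \<mu> y" by (simp add: pmf_bind g_def)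
  qed
qed

text \<open>Over a time t / n with n above q t the linear lower bound is positive; its n-th power
  bounds the return probability at time t.\<close>

lemma pmf_diag_pos:
  assumes x: "x \<in> S" and t: "0 \<le> t"
  shows "pmf (P t x) x > 0"
proof -
  let ?q = "- L (indicator {x}) x"
  obtain n :: nat where n: "?q * t < real n" "n > 0"
    using reals_Archimedean2[of "max 1 (?q * t)"] by (auto simp: max_def split: if_splits)
  have "1 - pmf (P (t / n) x) x \<le> ?q * (t / n)" using t by (intro pmf_diag_lower x) auto
  also have "\<dots> < 1" using n by (simp add: field_simps)
  finally have "0 < pmf (P (t / n) x) x ^ n" by simp
  also have "\<dots> \<le> pmf (P t x) x" using pmf_diag_power[OF x, of "t / n" n] t n by simp
  finally show ?thesis .
qed

text \<open>The rate gives positivity only at some small time h. Staying at x during the remaining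
  time t - h, which has positive probability, extends it to t.\<close>

lemma pmf_pos_of_rate:
  assumes x: "x \<in> S" and y: "y \<noteq> x" and rate: "L (indicator {y}) x > 0" and t: "t > 0"
  shows "pmf (P t x) y > 0"
proof -
  have "\<forall>\<^sub>F h in at_right 0. (pmf (P h x) y - indicator {y} x) / h > 0"
    using order_tendstoD(1)[OF generator_indicator_tendsto[OF x] rate] .
  then have "\<forall>\<^sub>F h in at_right 0. pmf (P h x) y > 0 \<and> h < t"
    using eventually_at_right_less[of 0] eventually_at_right_real[OF t]
    by eventually_elim (use y in \<open>auto simp: zero_less_divide_iff\<close>)
  then obtain h where h: "0 < h" "h < t" "pmf (P h x) y > 0"
    using eventually_happens'[OF trivial_limit_at_right_real eventually_conj[OF _ eventually_at_right_less]]
    by auto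
  have "0 < pmf (P (t - h) x) x * pmf (P h x) y"
    using pmf_diag_pos[OF x, of "t - h"] h by simp
  also have "\<dots> \<le> pmf (P t x) y" using pmf_semigroup_ge[of "t - h" h x x y] x h by simp
  finally show ?thesis .
qed

lemma pmf_pos_step:
  assumes x: "x \<in> S" and y: "y \<noteq> x" and rate: "L (indicator {y}) x > 0"
    and reach: "\<And>t. t > 0 \<Longrightarrow> pmf (P t y) z > 0" and t: "t > 0"
  shows "pmf (P t x) z > 0"
proof -
  have "0 < pmf (P (t / 2) x) y * pmf (P (t / 2) y) z"
    using pmf_pos_of_rate[OF x y rate, of "t / 2"] reach[of "t / 2"] t by simp
  also have "\<dots> \<le> pmf (P t x) z" using pmf_semigroup_ge[of "t / 2" "t / 2" x y z] x t by simp
  finally show ?thesis .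
qed

end

section \<open>Uniqueness through an accessible state\<close>

lemma pmf_neq_imp_less:
  assumes "p \<noteq> q"
  shows "\<exists>x. pmf q x < pmf p x"
proof (rule ccontr)
  assume "\<nexists>x. pmf q x < pmf p x"
  then have le: "pmf p x \<le> pmf q x" for x by (simp add: not_less)
  obtain x where x: "pmf p x \<noteq> pmf q x" using assms pmf_eqI[of p q] by auto
  \<comment> \<open>Total masses are equal, which excludes domination with a strict inequality
    somewhere.\<close>
  have "1 = (\<integral>\<^sup>+y. pmf p y \<partial>count_space UNIV)" by (simp add: nn_integral_pmf)
  also have "\<dots> < (\<integral>\<^sup>+y. pmf q y \<partial>count_space UNIV)"
  proof (rule nn_integral_less)
    have "\<not> ennreal (pmf q x) \<le> ennreal (pmf p x)" using x le[of x] by simp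
    then show "\<not> (AE y in count_space UNIV. ennreal (pmf q y) \<le> ennreal (pmf p y))"
      unfolding AE_count_space by blast
    show "AE y in count_space UNIV. ennreal (pmf p y) \<le> ennreal (pmf q y)"
      by (intro AE_I2 ennreal_leI le)
  qed (simp_all add: nn_integral_pmf)
  finally show False by (simp add: nn_integral_pmf)
qed

text \<open>If \<open>\<mu>\<close> and \<open>\<nu>\<close> differed, the kernel would strictly lower the mass of \<open>min \<mu> \<nu>\<close> at the
  common accessible state.\<close>

lemma invariant_law_unique:
  assumes reach: "\<And>x. x \<in> S \<Longrightarrow> pmf (P 1 x) z\<^sub>0 > 0"
    and \<mu>: "invariant_law S P \<mu>" and \<nu>: "invariant_law S P \<nu>"
  shows "\<mu> = \<nu>"
proof (rule ccontr)
  assume neq: "\<mu> \<noteq> \<nu>"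
  define m where "m x = ennreal (min (pmf \<mu> x) (pmf \<nu> x))" for x
  define p where "p x y = ennreal (pmf (P 1 x) y)" for x y
  \<comment> \<open>One argument for both laws: \<kappa> is either of them, \<open>\<kappa>'\<close>
    the other.\<close>
  have strict: "(\<integral>\<^sup>+x. m x * p x z\<^sub>0 \<partial>count_space UNIV) < ennreal (pmf \<kappa> z\<^sub>0)"
    and weak: "\<And>y. (\<integral>\<^sup>+x. m x * p x y \<partial>count_space UNIV) \<le> ennreal (pmf \<kappa> y)"
    if \<kappa>: "\<kappa> = \<mu> \<and> \<kappa>' = \<nu> \<or> \<kappa> = \<nu> \<and> \<kappa>' = \<mu>" for \<kappa> \<kappa>'
  proof -
    have inv: "bind_pmf \<kappa> (P 1) = \<kappa>" "set_pmf \<kappa> \<subseteq> S" using \<kappa> \<mu> \<nu> by (auto simp: invariant_law_def)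
    have eq: "ennreal (pmf \<kappa> y) = (\<integral>\<^sup>+x. ennreal (pmf \<kappa> x) * p x y \<partial>count_space UNIV)" for y
      using ennreal_pmf_bind[of \<kappa> "P 1" y] inv(1) by (simp add: nn_integral_measure_pmf p_def)
    have mle: "m x \<le> ennreal (pmf \<kappa> x)" for x using \<kappa> by (auto simp: m_def intro!: ennreal_leI)
    show weak': "(\<integral>\<^sup>+x. m x * p x y \<partial>count_space UNIV) \<le> ennreal (pmf \<kappa> y)" for y
      by (subst eq[of y], intro nn_integral_mono mult_right_mono mle) auto
    \<comment> \<open>At this point \<open>m\<close> is strictly below \<kappa>; since
      \<open>z\<^sub>0\<close> is accessible from it, the deficit shows up at
      \<open>z\<^sub>0\<close> after one step.\<close>
    obtain x where x: "pmf \<kappa>' x < pmf \<kappa> x"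
      using neq \<kappa> pmf_neq_imp_less[of \<kappa> \<kappa>'] by auto
    then have mx: "m x < ennreal (pmf \<kappa> x)"
      using \<kappa> by (auto simp: m_def ennreal_less_iff)
    have "x \<in> S" using x inv by (metis not_le pmf_nonneg set_pmf_iff subsetD)
    then have "m x * p x z\<^sub>0 < ennreal (pmf \<kappa> x) * p x z\<^sub>0"
      using mx reach[of x] by (intro ennreal_mult_strict_right_mono) (auto simp: p_def)
    then show "(\<integral>\<^sup>+x. m x * p x z\<^sub>0 \<partial>count_space UNIV) < ennreal (pmf \<kappa> z\<^sub>0)"
      unfolding eq[of z\<^sub>0] using weak'[of z\<^sub>0]
      by (intro nn_integral_less)
         (auto simp: AE_count_space not_le top_unique intro!: mult_right_mono mle exI[of _ x])
  qed
  have m_o: "(\<integral>\<^sup>+x. m x * p x z\<^sub>0 \<partial>count_space UNIV) < m z\<^sub>0"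
    using strict[of \<mu> \<nu>] strict[of \<nu> \<mu>] by (auto simp: m_def min_def)
  have m_y: "(\<integral>\<^sup>+x. m x * p x y \<partial>count_space UNIV) \<le> m y" for y
    using weak[of \<mu> \<nu> y] weak[of \<nu> \<mu> y] by (auto simp: m_def min_def)
  have "(\<integral>\<^sup>+y. \<integral>\<^sup>+x. m x * p x y \<partial>count_space UNIV \<partial>count_space UNIV)
      = (\<integral>\<^sup>+x. \<integral>\<^sup>+y. m x * p x y \<partial>count_space UNIV \<partial>count_space UNIV)"
    using nn_integral_fst_count_space[of "\<lambda>(x, y). m x * p x y"]
      nn_integral_snd_count_space[of "\<lambda>(x, y). m x * p x y"] by simp
  also have "\<dots> = (\<integral>\<^sup>+x. m x \<partial>count_space UNIV)"
    by (simp add: nn_integral_cmult p_def nn_integral_pmf)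
  \<comment> \<open>The rows of the kernel sum to 1, so the total mass of \<open>m\<close> is
    preserved; a strict loss at \<open>z\<^sub>0\<close> with no gain elsewhere is
    impossible.\<close>
  finally have swap: "(\<integral>\<^sup>+y. \<integral>\<^sup>+x. m x * p x y \<partial>count_space UNIV \<partial>count_space UNIV)
      = (\<integral>\<^sup>+x. m x \<partial>count_space UNIV)" .
  have "(\<integral>\<^sup>+x. m x \<partial>count_space UNIV) \<le> (\<integral>\<^sup>+x. pmf \<mu> x \<partial>count_space UNIV)"
    by (intro nn_integral_mono) (auto simp: m_def intro!: ennreal_leI)
  then have fin: "(\<integral>\<^sup>+x. m x \<partial>count_space UNIV) < \<infinity>"
    by (simp add: nn_integral_pmf le_less_trans)
  have "(\<integral>\<^sup>+y. \<integral>\<^sup>+x. m x * p x y \<partial>count_space UNIV \<partial>count_space UNIV) < (\<integral>\<^sup>+x. m x \<partial>count_space UNIV)"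
    using m_o m_y fin swap
    by (intro nn_integral_less) (auto simp: AE_count_space not_le intro!: exI[of _ z\<^sub>0])
  then show False using swap by simp
qed

section \<open>The single-site identity\<close>

definition succ_prob :: "real \<Rightarrow> real" where
  "succ_prob \<theta> = \<theta> / (1 + \<theta>)"

text \<open>Convolution of the injection rates at density u with the law of density t. The term k =
  0 is 0 because x / 0 = 0; keeping it gives the sum the shape of a Cauchy product.\<close>

definition nb_conv :: "real \<Rightarrow> real \<Rightarrow> real \<Rightarrow> nat \<Rightarrow> real" where
  "nb_conv s u t m = (\<Sum>k\<le>m. succ_prob u ^ k / real k * neg_binomial s t (m - k))"

text \<open>The adjoint of the reservoir generator with density \<open>u\<close>, applied to the law with density
  \<open>t\<close>; the rates of leaving particles enter through \<open>nb_conv s t t\<close>.\<close>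

definition reservoir_defect :: "real \<Rightarrow> real \<Rightarrow> real \<Rightarrow> nat \<Rightarrow> real" where
  "reservoir_defect s u t m =
     nb_conv s u t m - nb_conv s t t m + (ln (1 + t) - ln (1 + u)) * neg_binomial s t m"

lemma succ_prob_nonneg [simp]: "0 \<le> t \<Longrightarrow> 0 \<le> succ_prob t"
  and succ_prob_less_1: "0 \<le> t \<Longrightarrow> succ_prob t < 1"
  by (auto simp: succ_prob_def field_simps)

lemma abs_succ_prob_mult_less_1:
  assumes "0 \<le> t" "\<bar>z\<bar> \<le> 1"
  shows "\<bar>succ_prob t * z\<bar> < 1"
proof -
  have "\<bar>succ_prob t * z\<bar> \<le> succ_prob t * 1"
    using assms mult_left_mono[OF assms(2), of "succ_prob t"] by (simp add: abs_mult)
  then show ?thesis using succ_prob_less_1[OF assms(1)] by linarith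
qed

lemma one_plus_mult_pos:
  fixes t z :: real
  assumes "0 \<le> t" "\<bar>z\<bar> \<le> 1"
  shows "0 < 1 + t * (1 - z)"
  using assms by (intro add_pos_nonneg mult_nonneg_nonneg) auto

lemma one_minus_succ_prob_mult:
  assumes "0 \<le> t"
  shows "1 - succ_prob t * z = (1 + t * (1 - z)) / (1 + t)"
  using assms by (simp add: succ_prob_def field_simps)

text \<open>Binomial series with exponent - 2 s. The normalising power of 1 + t combines with 1 - q
  z = (1 + t (1 - z)) / (1 + t), where q = \<open>succ_prob t\<close>.\<close>

lemma neg_binomial_sums:
  assumes s: "0 < s" and t: "0 \<le> t" and z: "\<bar>z\<bar> \<le> 1"
  shows "(\<lambda>m. neg_binomial s t m * z ^ m) sums ((1 + t * (1 - z)) powr (- (2 * s)))"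
proof -
  let ?q = "succ_prob t * z"
  have "(\<lambda>n. (- (2 * s) gchoose n) * (- ?q) ^ n) sums (1 + - ?q) powr (- (2 * s))"
    by (rule gen_binomial_real) (use abs_succ_prob_mult_less_1[OF t z] in simp)
  then have "(\<lambda>n. (- (2 * s) gchoose n) * (- ?q) ^ n * (1 / (1 + t)) powr (2 * s)) sums
      ((1 - ?q) powr (- (2 * s)) * (1 / (1 + t)) powr (2 * s))"
    by (intro sums_mult2) simp
  moreover have "(- (2 * s) gchoose n) * (- ?q) ^ n * (1 / (1 + t)) powr (2 * s)
      = neg_binomial s t n * z ^ n" for n
  proof -
    \<comment> \<open>2 s is not a pole of Gamma, so the Pochhammer symbol is a quotient of Gamma
      values. The two signs, named e below, cancel.\<close>
    have "2 * s \<notin> \<int>\<^sub>\<le>\<^sub>0" using s by (auto elim!: nonpos_Ints_cases)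
    then have "(- (2 * s) gchoose n) = (- 1) ^ n * (Gamma (2 * s + real n) / Gamma (2 * s)) / fact n"
      by (simp add: gbinomial_pochhammer pochhammer_Gamma)
    moreover have "(- ?q) ^ n = (- 1) ^ n * (succ_prob t ^ n * z ^ n)"
      by (metis mult_minus1 power_mult_distrib)
    moreover define e :: real where "e = (- 1) ^ n"
    moreover have "e * e = 1"
      by (simp add: e_def flip: power_mult_distrib)
    ultimately show ?thesis
      unfolding neg_binomial_def succ_prob_def[symmetric]
      by (simp del: power_minus_mult) (simp add: algebra_simps flip: mult.assoc[of e e])
  qed
  moreover have "(1 - ?q) powr (- (2 * s)) * (1 / (1 + t)) powr (2 * s) = (1 + t * (1 - z)) powr (- (2 * s))"
    using t one_plus_mult_pos[OF t z]
    by (simp add: one_minus_succ_prob_mult powr_divide powr_minus_divide)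
  ultimately show ?thesis by simp
qed

lemma ln_succ_prob_sums:
  assumes t: "0 \<le> t" and z: "\<bar>z\<bar> \<le> 1"
  shows "(\<lambda>k. succ_prob t ^ k / real k * z ^ k) sums (ln (1 + t) - ln (1 + t * (1 - z)))"
proof -
  have "(\<lambda>n. - ((- (- (succ_prob t * z))) ^ n) / of_nat n) sums ln (1 + - (succ_prob t * z))"
    by (rule ln_series') (use abs_succ_prob_mult_less_1[OF t z] in simp)
  from sums_minus[OF this]
  have "(\<lambda>n. (succ_prob t * z) ^ n / real n) sums (- ln (1 - succ_prob t * z))" by simp
  moreover have "- ln (1 - succ_prob t * z) = ln (1 + t) - ln (1 + t * (1 - z))"
    using t one_plus_mult_pos[OF t z] by (simp add: one_minus_succ_prob_mult ln_div)
  ultimately show ?thesis by (simp add: power_mult_distrib)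
qed

lemma neg_binomial_nonneg: "0 < s \<Longrightarrow> 0 \<le> t \<Longrightarrow> 0 \<le> neg_binomial s t m"
  by (auto simp: neg_binomial_def intro!: mult_nonneg_nonneg divide_nonneg_nonneg Gamma_real_nonneg)

lemma neg_binomial_le_1:
  assumes "0 < s" "0 \<le> t"
  shows "neg_binomial s t m \<le> 1"
proof -
  have "(\<lambda>m. neg_binomial s t m) sums 1" using neg_binomial_sums[OF assms, of 1] by simp
  then show ?thesis
    using sum_le_suminf[of "neg_binomial s t" "{m}"] assms
    by (simp add: sums_iff neg_binomial_nonneg)
qed

lemma nb_conv_nonneg: "0 < s \<Longrightarrow> 0 \<le> u \<Longrightarrow> 0 \<le> t \<Longrightarrow> 0 \<le> nb_conv s u t m"
  by (auto simp: nb_conv_def neg_binomial_nonneg intro!: sum_nonneg mult_nonneg_nonneg)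

lemma nb_conv_sums:
  assumes s: "0 < s" and u: "0 \<le> u" and t: "0 \<le> t" and z: "\<bar>z\<bar> \<le> 1"
  shows "(\<lambda>m. nb_conv s u t m * z ^ m) sums
     ((ln (1 + u) - ln (1 + u * (1 - z))) * (1 + t * (1 - z)) powr (- (2 * s)))"
proof -
  let ?a = "\<lambda>k. succ_prob u ^ k / real k * z ^ k" and ?b = "\<lambda>m. neg_binomial s t m * z ^ m"
  have "summable (\<lambda>k. norm (?a k))"
    using ln_succ_prob_sums[OF u, of "\<bar>z\<bar>"] u z
    by (auto simp: sums_iff abs_mult power_abs)
  moreover have "summable (\<lambda>k. norm (?b k))"
    using neg_binomial_sums[OF s t, of "\<bar>z\<bar>"] s t z
    by (auto simp: sums_iff abs_mult power_abs neg_binomial_nonneg)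
  ultimately have "(\<lambda>m. \<Sum>k\<le>m. ?a k * ?b (m - k)) sums ((\<Sum>k. ?a k) * (\<Sum>m. ?b m))"
    by (rule Cauchy_product_sums)
  moreover have "(\<Sum>k\<le>m. ?a k * ?b (m - k)) = nb_conv s u t m * z ^ m" for m
    unfolding nb_conv_def sum_distrib_right
    by (intro sum.cong) (auto simp flip: power_add)
  ultimately show ?thesis
    using ln_succ_prob_sums[OF u z] neg_binomial_sums[OF s t z] by (simp add: sums_iff)
qed

lemma nb_conv_le:
  assumes "0 < s" "0 \<le> u" "0 \<le> t"
  shows "nb_conv s u t m \<le> ln (1 + u)"
proof -
  have "(\<lambda>m. nb_conv s u t m) sums ln (1 + u)" using nb_conv_sums[OF assms, of 1] by simp
  then show ?thesis
    using sum_le_suminf[of "nb_conv s u t" "{m}"] assms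
    by (simp add: sums_iff nb_conv_nonneg)
qed

text \<open>Each convolution contributes the constant ln (1 + density) to its logarithmic factor;
  the last summand of \<open>reservoir_defect\<close> removes exactly their difference.\<close>

lemma reservoir_defect_sums:
  assumes s: "0 < s" and u: "0 \<le> u" and t: "0 \<le> t" and z: "\<bar>z\<bar> \<le> 1"
  shows "(\<lambda>m. reservoir_defect s u t m * z ^ m) sums
     ((ln (1 + t * (1 - z)) - ln (1 + u * (1 - z))) * (1 + t * (1 - z)) powr (- (2 * s)))"
  using sums_add[OF sums_diff[OF nb_conv_sums[OF s u t z] nb_conv_sums[OF s t t z]]
      sums_mult[OF neg_binomial_sums[OF s t z], of "ln (1 + t) - ln (1 + u)"]]
  by (simp add: reservoir_defect_def algebra_simps)

text \<open>Uniformity in m permits the exchange of series and integral below; the bound also gives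
  integrability under the mixing measure.\<close>

lemma abs_reservoir_defect_le:
  assumes s: "0 < s" and u: "0 \<le> u" "u \<le> b" and t: "0 \<le> t" "t \<le> b"
  shows "\<bar>reservoir_defect s u t m\<bar> \<le> 2 * ln (1 + b)"
proof -
  have l: "0 \<le> ln (1 + u)" "ln (1 + u) \<le> ln (1 + b)" "0 \<le> ln (1 + t)" "ln (1 + t) \<le> ln (1 + b)"
    using u t by auto
  have "\<bar>nb_conv s u t m - nb_conv s t t m\<bar> \<le> ln (1 + b)"
    using nb_conv_nonneg[OF s u(1) t(1), of m] nb_conv_nonneg[OF s t(1) t(1), of m]
      nb_conv_le[OF s u(1) t(1), of m] nb_conv_le[OF s t(1) t(1), of m] l by linarith
  moreover have "\<bar>(ln (1 + t) - ln (1 + u)) * neg_binomial s t m\<bar> \<le> ln (1 + b) * 1"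
    unfolding abs_mult
    by (rule mult_mono) (use l neg_binomial_le_1[OF s t(1)] neg_binomial_nonneg[OF s t(1)] in auto)
  ultimately show ?thesis unfolding reservoir_defect_def by linarith
qed

lemma borel_measurable_neg_binomial [measurable (raw)]:
  assumes [measurable]: "f \<in> borel_measurable M"
  shows "(\<lambda>x. neg_binomial s (f x) m) \<in> borel_measurable M"
  unfolding neg_binomial_def by measurable

lemma borel_measurable_nb_conv [measurable (raw)]:
  assumes [measurable]: "f \<in> borel_measurable M" "g \<in> borel_measurable M"
  shows "(\<lambda>x. nb_conv s (f x) (g x) m) \<in> borel_measurable M"
  unfolding nb_conv_def succ_prob_def by measurable

lemma borel_measurable_reservoir_defect [measurable (raw)]:
  assumes [measurable]: "f \<in> borel_measurable M" "g \<in> borel_measurable M"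
  shows "(\<lambda>x. reservoir_defect s (f x) (g x) m) \<in> borel_measurable M"
  unfolding reservoir_defect_def by measurable

text \<open>The integrand is odd under the involution \<open>1 + t w \<mapsto> (1 + x w) (1 + y w) / (1 + t w)\<close>, which
  exchanges the endpoints.\<close>

lemma log_ratio_integral_zero:
  fixes x y w :: real
  assumes x: "0 \<le> x" and y: "x \<le> y" and w: "0 < w"
  shows "integral {x..y} (\<lambda>t. (t - x) ^ e * (y - t) ^ e * (1 / (1 + t * w) ^ Suc e) *
     (2 * ln (1 + t * w) - ln (1 + x * w) - ln (1 + y * w))) = 0"
proof -
  define X where "X = 1 + x * w"
  define Y where "Y = 1 + y * w"
  define f where "f t = (t - x) ^ e * (y - t) ^ e * (1 / (1 + t * w) ^ Suc e) *
     (2 * ln (1 + t * w) - ln X - ln Y)" for t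
  define \<sigma> where "\<sigma> t = (X * Y / (1 + t * w) - 1) / w" for t
  have pos: "0 < 1 + t * w" if "x \<le> t" for t
    using that x w by (intro add_pos_nonneg mult_nonneg_nonneg) auto
  have X: "X > 0" and Y: "Y > 0" using pos[of x] pos[of y] y by (auto simp: X_def Y_def)
  have s1: "1 + \<sigma> t * w = X * Y / (1 + t * w)" for t
    using w by (simp add: \<sigma>_def)
  have s2: "\<sigma> t - x = X * (y - t) / (1 + t * w)" and s3: "y - \<sigma> t = Y * (t - x) / (1 + t * w)"
    if "x \<le> t" for t
  proof -
    define v where "v = 1 + t * w"
    have v: "v > 0" using pos[OF that] by (simp add: v_def)
    have xyt: "x = (X - 1) / w" "y = (Y - 1) / w" "t = (v - 1) / w"
      using w by (simp_all add: X_def Y_def v_def)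
    show "\<sigma> t - x = X * (y - t) / (1 + t * w)" "y - \<sigma> t = Y * (t - x) / (1 + t * w)"
      unfolding \<sigma>_def v_def[symmetric] unfolding xyt using w v
      by (simp_all add: field_simps)
  qed
  have cont: "continuous_on {x..y} f"
    unfolding f_def using pos by (auto intro!: continuous_intros simp: less_imp_neq[THEN not_sym])
  have subst: "((\<lambda>t. (- (X * Y / (1 + t * w) ^ 2)) *\<^sub>R f (\<sigma> t)) has_integral
      (integral {\<sigma> x..\<sigma> y} f - integral {\<sigma> y..\<sigma> x} f)) {x..y}"
  proof (rule has_integral_substitution_general[where s = "{}" and c = x and d = y, OF _ y _ cont])
    show "\<sigma> ` {x..y} \<subseteq> {x..y}"
    proof safe
      fix t assume t: "t \<in> {x..y}"
      then have "0 \<le> \<sigma> t - x" "0 \<le> y - \<sigma> t"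
        using s2[of t] s3[of t] pos[of t] X Y by (auto intro!: divide_nonneg_pos mult_nonneg_nonneg)
      then show "\<sigma> t \<in> {x..y}" by simp
    qed
    show "continuous_on {x..y} \<sigma>"
      unfolding \<sigma>_def using pos w by (auto intro!: continuous_intros simp: less_imp_neq[THEN not_sym])
    fix t assume "t \<in> {x..y} - {}"
    then have "1 + t * w \<noteq> 0" using pos[of t] by auto
    then have "(\<sigma> has_real_derivative (((0 * (1 + t * w) - X * Y * w) / ((1 + t * w) * (1 + t * w))) - 0) / w)
        (at t within {x..y})"
      unfolding \<sigma>_def by (auto intro!: derivative_eq_intros)
    then show "(\<sigma> has_real_derivative - (X * Y / (1 + t * w)\<^sup>2)) (at t within {x..y})"
      using w by (simp add: power2_eq_square)
  qed simp
  have ends: "\<sigma> x = y" "\<sigma> y = x"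
    using s2[of x] s3[of y] y X Y by (simp_all add: X_def Y_def)
  \<comment> \<open>The logarithmic factor changes sign and the two gap powers change places. The
    surplus powers of X Y and of 1 + t w cancel against the Jacobian because the denominator has
    exponent \<open>Suc e\<close>.\<close>
  have odd: "(- (X * Y / (1 + t * w) ^ 2)) *\<^sub>R f (\<sigma> t) = f t" if t: "t \<in> {x..y}" for t
  proof -
    define v where "v = 1 + t * w"
    have v: "v > 0" using pos t by (simp add: v_def)
    have tx: "x \<le> t" using t by simp
    have "2 * ln (X * Y / v) - ln X - ln Y = - (2 * ln v - ln X - ln Y)"
      using X Y v by (simp add: ln_div ln_mult)
    then have "(- (X * Y / v ^ 2)) * f (\<sigma> t) =
        (X * Y / v ^ 2) * ((X * (y - t) / v) ^ e * (Y * (t - x) / v) ^ e * (1 / (X * Y / v) ^ Suc e)) *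
        (2 * ln v - ln X - ln Y)"
      unfolding f_def s1 s2[OF tx] s3[OF tx] v_def[symmetric]
      by (simp only: mult_minus_left mult_minus_right minus_minus mult.assoc)
    also have "(X * Y / v ^ 2) * ((X * B / v) ^ e * (Y * A / v) ^ e * (1 / (X * Y / v) ^ Suc e))
        = A ^ e * B ^ e * (1 / v ^ Suc e)" for A B
      using X Y v by (simp add: power_mult_distrib power_divide field_simps power2_eq_square)
    finally show ?thesis unfolding f_def v_def by simp
  qed
  \<comment> \<open>Since the endpoints are exchanged, the substitution formula returns the integral
    with a minus sign; over the reversed interval the integral is 0.\<close>
  have "(f has_integral (integral {y..x} f - integral {x..y} f)) {x..y}"
    using has_integral_eq[OF odd subst] unfolding ends .
  then have "integral {x..y} f = integral {y..x} f - integral {x..y} f"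
    by (rule integral_unique)
  moreover have "integral {y..x} f = 0"
    using y by (cases "x = y") auto
  ultimately have "integral {x..y} f = 0" by simp
  then show ?thesis unfolding f_def X_def Y_def .
qed

text \<open>Once all lower coefficients are 0, division by z ^ m and the limit z to 0 isolate the
  coefficient m.\<close>

lemma power_series_zero:
  fixes a :: "nat \<Rightarrow> real"
  assumes sums: "\<And>z. z \<noteq> 0 \<Longrightarrow> \<bar>z\<bar> < 1 \<Longrightarrow> (\<lambda>n. a n * z ^ n) sums 0"
  shows "a m = 0"
proof (induction m rule: less_induct)
  case (less m)
  have "((\<lambda>_. 0) \<longlongrightarrow> a (0 + m)) (at (0 :: real))"
  proof (rule powser_limit_0_strong[of 1])
    fix z :: real assume z: "z \<noteq> 0" "norm z < 1"
    have "(\<lambda>n. a n * z ^ n) sums (0 + (\<Sum>i<m. a i * z ^ i))"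
      using sums[of z] z less by simp
    then have "(\<lambda>n. a (n + m) * z ^ (n + m)) sums 0"
      by (subst sums_iff_shift)
    then have "(\<lambda>n. a (n + m) * z ^ (n + m) / z ^ m) sums (0 / z ^ m)"
      by (rule sums_divide)
    then show "(\<lambda>n. a (n + m) * z ^ n) sums 0"
      using z by (simp add: power_add)
  qed simp
  then show ?case by (simp add: tendsto_const_iff)
qed

text \<open>The generating function in m of these integrals is the integral in
  \<open>log_ratio_integral_zero\<close> with w = 1 - z and e = d - 1. It is 0 for all \<bar>z\<bar>
  < 1, hence so is each coefficient.\<close>

lemma reservoir_defect_integral_zero:
  fixes x y s :: real and d :: nat
  assumes s: "0 < s" "2 * s = real d" and x: "0 \<le> x" and y: "x \<le> y"
  shows "(\<integral>t. indicator {x..y} t * ((t - x) ^ (d - 1) * (y - t) ^ (d - 1) *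
     (reservoir_defect s x t m + reservoir_defect s y t m)) \<partial>lborel) = 0"
proof -
  define f where "f m t = indicator {x..y} t * ((t - x) ^ (d - 1) * (y - t) ^ (d - 1) *
     (reservoir_defect s x t m + reservoir_defect s y t m))" for m t
  \<comment> \<open>Each gap is at most y - x, and each of the two defects at most 2 ln (1 +
    y).\<close>
  define c where "c = (y - x) ^ (d - 1) * (y - x) ^ (d - 1) * (4 * ln (1 + y))"
  have d: "d = Suc (d - 1)" using s by (cases d) auto
  have f_le: "\<bar>f m t\<bar> \<le> indicator {x..y} t * c" for m t
  proof (cases "t \<in> {x..y}")
    case True
    then have t: "x \<le> t" "t \<le> y" "0 \<le> t" using x by auto
    have "\<bar>f m t\<bar> = (t - x) ^ (d - 1) * (y - t) ^ (d - 1) *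
        \<bar>reservoir_defect s x t m + reservoir_defect s y t m\<bar>"
      using t by (simp add: f_def abs_mult)
    also have "\<dots> \<le> c"
      unfolding c_def
      using t x y abs_reservoir_defect_le[OF s(1) x y t(3) t(2), of m]
        abs_reservoir_defect_le[OF s(1) order_trans[OF x y] order_refl t(3) t(2), of m]
      by (intro mult_mono power_mono) auto
    finally show ?thesis using t by simp
  qed (simp add: f_def)
  have c_int: "integrable lborel (\<lambda>t. indicator {x..y} t * c)"
    by (intro integrable_mult_left integrable_real_indicator) (auto simp: emeasure_lborel_Icc_eq)
  have f_int: "integrable lborel (f m)" for m
  proof (rule Bochner_Integration.integrable_bound[OF c_int])
    show "f m \<in> borel_measurable lborel" unfolding f_def by measurable
    show "AE t in lborel. norm (f m t) \<le> norm (indicator {x..y} t * c)"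
      using f_le[of m] by (intro AE_I2) (auto intro: order_trans[OF _ abs_ge_self])
  qed
  have "(\<lambda>m. (\<integral>t. f m t \<partial>lborel) * z ^ m) sums 0" if z: "\<bar>z\<bar> < 1" for z
  proof -
    have fz: "(\<lambda>m. f m t * z ^ m) sums (indicator {x..y} t * ((t - x) ^ (d - 1) * (y - t) ^ (d - 1) *
        (1 / (1 + t * (1 - z)) ^ Suc (d - 1)) *
        (2 * ln (1 + t * (1 - z)) - ln (1 + x * (1 - z)) - ln (1 + y * (1 - z)))))" (is "_ sums ?F t") for t
    proof (cases "t \<in> {x..y}")
      case True
      then have t: "0 \<le> t" using x by auto
      \<comment> \<open>Here 2 s = d turns the real power into a natural one whose exponent is
        \<open>Suc e\<close> for e = d - 1.\<close>
      have "(1 + t * (1 - z)) powr (- (2 * s)) = 1 / (1 + t * (1 - z)) ^ Suc (d - 1)"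
        using one_plus_mult_pos[OF t, of z] z d
        by (simp add: s(2) powr_minus powr_realpow inverse_eq_divide del: power_Suc)
      then show ?thesis
        using sums_mult[OF sums_add[OF reservoir_defect_sums[OF s(1) x t, of z]
              reservoir_defect_sums[OF s(1) order_trans[OF x y] t, of z]],
            of "(t - x) ^ (d - 1) * (y - t) ^ (d - 1)"] z True
        by (simp add: f_def algebra_simps diff_divide_distrib add_divide_distrib del: power_Suc)
    qed (simp add: f_def)
    \<comment> \<open>The bound on f is uniform in m, so the powers of \<bar>z\<bar> provide the
      summable majorant.\<close>
    have "(\<lambda>m. \<integral>t. f m t * z ^ m \<partial>lborel) sums (\<integral>t. (\<Sum>m. f m t * z ^ m) \<partial>lborel)"
    proof (rule sums_integral)
      show "AE t in lborel. summable (\<lambda>m. norm (f m t * z ^ m))"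
      proof (rule AE_I2)
        fix t
        have "summable (\<lambda>m. c * \<bar>z\<bar> ^ m)" using z by (intro summable_mult summable_geometric) auto
        then show "summable (\<lambda>m. norm (f m t * z ^ m))"
        proof (rule summable_comparison_test')
          fix m
          have "\<bar>f m t\<bar> \<le> c" using f_le[of m t] f_le[of m x] y abs_ge_zero[of "f m x"]
            by (cases "t \<in> {x..y}") (auto simp: f_def)
          then show "norm (norm (f m t * z ^ m)) \<le> c * \<bar>z\<bar> ^ m"
            by (simp add: abs_mult power_abs mult_right_mono)
        qed
      qed
      have "summable (\<lambda>m. (\<integral>t. indicator {x..y} t * c \<partial>lborel) * \<bar>z\<bar> ^ m)"
        using z by (intro summable_mult summable_geometric) auto
      then show "summable (\<lambda>m. \<integral>t. norm (f m t * z ^ m) \<partial>lborel)"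
      proof (rule summable_comparison_test')
        fix m
        have "(\<integral>t. \<bar>f m t\<bar> \<partial>lborel) \<le> (\<integral>t. indicator {x..y} t * c \<partial>lborel)"
          by (intro integral_mono integrable_abs f_int c_int f_le)
        then show "norm (\<integral>t. norm (f m t * z ^ m) \<partial>lborel) \<le> (\<integral>t. indicator {x..y} t * c \<partial>lborel) * \<bar>z\<bar> ^ m"
          by (simp add: abs_mult power_abs mult_right_mono)
      qed
    qed (use f_int in auto)
    moreover have "(\<integral>t. (\<Sum>m. f m t * z ^ m) \<partial>lborel) = 0"
    proof -
      let ?g = "\<lambda>t. (t - x) ^ (d - 1) * (y - t) ^ (d - 1) * (1 / (1 + t * (1 - z)) ^ Suc (d - 1)) *
        (2 * ln (1 + t * (1 - z)) - ln (1 + x * (1 - z)) - ln (1 + y * (1 - z)))"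
      have "set_integrable lborel {x..y} ?g"
      proof (rule borel_integrable_atLeastAtMost')
        have "1 + t * (1 - z) \<noteq> 0" if "t \<in> {x..y}" for t
          using one_plus_mult_pos[of t z] x z that by auto
        then show "continuous_on {x..y} ?g" by (intro continuous_intros) auto
      qed
      then have "(LINT t:{x..y}|lborel. ?g t) = integral {x..y} ?g"
        by (rule set_borel_integral_eq_integral)
      also have "\<dots> = 0" by (rule log_ratio_integral_zero) (use x y z in auto)
      finally show ?thesis using fz by (simp add: sums_iff set_lebesgue_integral_def)
    qed
    ultimately show ?thesis by simp
  qed
  then have "(\<integral>t. f m t \<partial>lborel) = 0" by (intro power_series_zero) auto
  then show ?thesis by (simp add: f_def)
qed

section \<open>Stationary mixtures of product laws\<close>

lemma \<phi>_nonneg: "0 < s \<Longrightarrow> k \<le> m \<Longrightarrow> 0 \<le> \<phi> s k m"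
  by (auto simp: \<phi>_def intro!: divide_nonneg_nonneg mult_nonneg_nonneg Gamma_real_nonneg)

lemma \<phi>_pos: "0 < s \<Longrightarrow> 1 \<le> k \<Longrightarrow> k \<le> m \<Longrightarrow> 0 < \<phi> s k m"
  by (auto simp: \<phi>_def intro!: divide_pos_pos mult_pos_pos Gamma_real_pos)

text \<open>The Gamma quotients of the rate replace those of the weight at m by those at m - k; what
  remains, q ^ k / k with q = \<open>succ_prob t\<close>, is the injection rate of a reservoir of
  the same density.\<close>

lemma \<phi>_mult_neg_binomial:
  assumes s: "0 < s" and k: "1 \<le> k" "k \<le> m"
  shows "\<phi> s k m * neg_binomial s t m = succ_prob t ^ k / real k * neg_binomial s t (m - k)"
proof -
  have p: "succ_prob t ^ m = succ_prob t ^ k * succ_prob t ^ (m - k)"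
    using k by (simp flip: power_add)
  have "Gamma (2 * s + real m) > 0"
    using s by (intro Gamma_real_pos) auto
  have "\<phi> s k m = 1 / real k * (fact m * Gamma (2 * s + real (m - k))) / (fact (m - k) * Gamma (2 * s + real m))"
    using k by (simp add: \<phi>_def Gamma_fact[symmetric] of_nat_diff add.commute)
  moreover have "1 / K * (F * g') / (F' * g) * (1 / F * (g / G) * (P * P') * W) = P / K * (1 / F' * (g' / G) * P' * W)"
    if "g \<noteq> 0" "F \<noteq> 0" for K F g' F' g G P P' W :: real
    using that by simp
  ultimately show ?thesis
    using \<open>Gamma (2 * s + real m) > 0\<close>
    unfolding neg_binomial_def succ_prob_def[symmetric] p by simp
qed

text \<open>Over a countable set, sums can be exchanged with the mixing integral once each summand
  is measurable in the mixing variable.\<close>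

lemma countable_configs: "countable (configs N)"
proof -
  have "configs N \<subseteq> range (\<lambda>xs i. if i \<in> {1..N} then xs ! (i - 1) else 0)"
  proof
    fix \<eta> assume "\<eta> \<in> configs N"
    then have "\<eta> = (\<lambda>i. if i \<in> {1..N} then map (\<eta> \<circ> Suc) [0..<N] ! (i - 1) else 0)"
      by (auto simp: configs_def fun_eq_iff)
    then show "\<eta> \<in> range (\<lambda>xs i. if i \<in> {1..N} then xs ! (i - 1) else 0)" by blast
  qed
  then show ?thesis by (rule countable_subset) auto
qed

text \<open>Removing k particles from site i maps the configurations with at least k there
  bijectively onto all configurations.\<close>

lemma nn_integral_configs_shift:
  assumes i: "i \<in> {1..N}"
  shows "(\<integral>\<^sup>+\<xi>. (if k \<le> \<xi> i then F (\<xi>(i := \<xi> i - k)) else 0) \<partial>count_space (configs N))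
       = (\<integral>\<^sup>+\<xi>. F \<xi> \<partial>count_space (configs N))"
proof -
  have "(\<integral>\<^sup>+\<xi>. (if k \<le> \<xi> i then F (\<xi>(i := \<xi> i - k)) else 0) \<partial>count_space (configs N))
      = (\<integral>\<^sup>+\<xi>. F (\<xi>(i := \<xi> i - k)) \<partial>count_space {\<xi> \<in> configs N. k \<le> \<xi> i})"
    unfolding nn_integral_count_space_indicator[where X = "{\<xi> \<in> configs N. k \<le> \<xi> i}", simplified]
      nn_integral_count_space_indicator[where X = "configs N", simplified]
    by (intro nn_integral_cong) (auto simp: indicator_def)
  also have "\<dots> = (\<integral>\<^sup>+\<xi>. F \<xi> \<partial>count_space (configs N))"
  proof (rule nn_integral_bij_count_space)
    show "bij_betw (\<lambda>\<xi>. \<xi>(i := \<xi> i - k)) {\<xi> \<in> configs N. k \<le> \<xi> i} (configs N)"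
      by (rule bij_betw_byWitness[where f' = "\<lambda>\<xi>. \<xi>(i := \<xi> i + k)"])
         (use i in \<open>auto simp: configs_def\<close>)
  qed
  finally show ?thesis .
qed

text \<open>Trades a finite sum whose length depends on the state for a series with a fixed index
  set, which can be exchanged with the sum over states.\<close>

lemma sum_eq_suminf_ennreal:
  fixes f :: "nat \<Rightarrow> ennreal"
  shows "(\<Sum>k=1..n. f k) = (\<Sum>j. if Suc j \<le> n then f (Suc j) else 0)"
proof -
  have "(\<Sum>j. if Suc j \<le> n then f (Suc j) else 0) = (\<Sum>j<n. if Suc j \<le> n then f (Suc j) else 0)"
    by (rule suminf_finite) auto
  also have "\<dots> = (\<Sum>j<n. f (Suc j))" by (intro sum.cong) auto
  also have "\<dots> = (\<Sum>k=1..n. f k)"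
    by (rule sum.reindex_bij_witness[of _ "\<lambda>k. k - 1" Suc]) auto
  finally show ?thesis by simp
qed

section \<open>The dynamics acting on product laws\<close>

definition product_law :: "real \<Rightarrow> nat \<Rightarrow> (nat \<Rightarrow> real) \<Rightarrow> (nat \<Rightarrow> nat) \<Rightarrow> real" where
  "product_law s N \<theta> \<xi> = (\<Prod>i\<in>{1..N}. neg_binomial s (\<theta> i) (\<xi> i))"

definition product_law_except :: "real \<Rightarrow> nat \<Rightarrow> nat \<Rightarrow> (nat \<Rightarrow> real) \<Rightarrow> (nat \<Rightarrow> nat) \<Rightarrow> real" where
  "product_law_except s N i \<theta> \<xi> = (\<Prod>j\<in>{1..N} - {i}. neg_binomial s (\<theta> j) (\<xi> j))"

lemma product_law_split:
  assumes "i \<in> {1..N}"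
  shows "product_law s N \<theta> \<xi> = neg_binomial s (\<theta> i) (\<xi> i) * product_law_except s N i \<theta> \<xi>"
  using assms by (simp add: product_law_def product_law_except_def prod.remove)

lemma product_law_except_upd [simp]:
  "product_law_except s N i \<theta> (\<xi>(i := m)) = product_law_except s N i \<theta> \<xi>"
  by (simp add: product_law_except_def)

text \<open>This and the next definitions are the gain parts of the generator. With values in
  [0, \<infinity>] they raise no question of convergence.\<close>

definition leaving :: "real \<Rightarrow> nat \<Rightarrow> ((nat \<Rightarrow> nat) \<Rightarrow> ennreal) \<Rightarrow> (nat \<Rightarrow> nat) \<Rightarrow> ennreal" where
  "leaving s i f \<xi> = (\<Sum>k=1..\<xi> i. ennreal (\<phi> s k (\<xi> i)) * f (\<xi>(i := \<xi> i - k)))"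

definition jumping ::
    "real \<Rightarrow> nat \<Rightarrow> nat \<Rightarrow> ((nat \<Rightarrow> nat) \<Rightarrow> ennreal) \<Rightarrow> (nat \<Rightarrow> nat) \<Rightarrow> ennreal" where
  "jumping s i j f \<xi> = (\<Sum>k=1..\<xi> i. ennreal (\<phi> s k (\<xi> i)) * f (\<xi>(i := \<xi> i - k, j := \<xi> j + k)))"

definition entering :: "real \<Rightarrow> nat \<Rightarrow> ((nat \<Rightarrow> nat) \<Rightarrow> ennreal) \<Rightarrow> (nat \<Rightarrow> nat) \<Rightarrow> ennreal" where
  "entering u i f \<xi> = (\<Sum>l. ennreal (succ_prob u ^ Suc l / real (Suc l)) * f (\<xi>(i := \<xi> i + Suc l)))"

definition inflow ::
    "real \<Rightarrow> nat \<Rightarrow> real \<Rightarrow> real \<Rightarrow> ((nat \<Rightarrow> nat) \<Rightarrow> ennreal) \<Rightarrow> (nat \<Rightarrow> nat) \<Rightarrow> ennreal" where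
  "inflow s N \<rho>l \<rho>r f \<xi> = entering \<rho>l 1 f \<xi> + leaving s 1 f \<xi> +
     (\<Sum>i=1..<N. jumping s i (i + 1) f \<xi> + jumping s (i + 1) i f \<xi>) +
     entering \<rho>r N f \<xi> + leaving s N f \<xi>"

definition site_rate :: "real \<Rightarrow> nat \<Rightarrow> real" where
  "site_rate s m = (\<Sum>k=1..m. \<phi> s k m)"

text \<open>Every site emits through two channels, its bonds or reservoirs (both reservoirs if N =
  1), hence the factor 2. The logarithms are the total injection rates.\<close>

definition exit_rate :: "real \<Rightarrow> nat \<Rightarrow> real \<Rightarrow> real \<Rightarrow> (nat \<Rightarrow> nat) \<Rightarrow> real" where
  "exit_rate s N \<rho>l \<rho>r \<xi> = 2 * (\<Sum>i=1..N. site_rate s (\<xi> i)) + ln (1 + \<rho>l) + ln (1 + \<rho>r)"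

lemma site_rate_nonneg: "0 < s \<Longrightarrow> 0 \<le> site_rate s m"
  by (auto simp: site_rate_def intro!: sum_nonneg \<phi>_nonneg)

lemma exit_rate_nonneg:
  "0 < s \<Longrightarrow> 0 \<le> \<rho>l \<Longrightarrow> 0 \<le> \<rho>r \<Longrightarrow> 0 \<le> exit_rate s N \<rho>l \<rho>r \<xi>"
  by (auto simp: exit_rate_def intro!: add_nonneg_nonneg sum_nonneg site_rate_nonneg)

lemma nb_conv_alt:
  "nb_conv s u t m = (\<Sum>k=1..m. succ_prob u ^ k / real k * neg_binomial s t (m - k))"
proof -
  have "{..m} = insert 0 {1..m}" by auto
  then show ?thesis by (simp add: nb_conv_def)
qed

lemma site_rate_mult_neg_binomial:
  "0 < s \<Longrightarrow> site_rate s m * neg_binomial s t m = nb_conv s t t m"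
  unfolding site_rate_def nb_conv_alt sum_distrib_right
  by (intro sum.cong \<phi>_mult_neg_binomial) auto

lemma succ_prob_sums_ln: "0 \<le> t \<Longrightarrow> (\<lambda>l. succ_prob t ^ Suc l / real (Suc l)) sums ln (1 + t)"
  using ln_succ_prob_sums[of t 1] sums_Suc_iff[of "\<lambda>k. succ_prob t ^ k / real k"] by simp

lemma suminf_succ_prob_ennreal:
  assumes "0 \<le> t"
  shows "(\<Sum>l. ennreal (succ_prob t ^ Suc l / real (Suc l))) = ennreal (ln (1 + t))"
  using succ_prob_sums_ln[OF assms] assms
  by (subst suminf_ennreal2) (auto simp: sums_iff simp del: power_Suc of_nat_Suc)

text \<open>Passes from bookkeeping by bonds, as in the generator, to bookkeeping by sites, as in
  the balance equation. When c depends on one index only, it yields the telescoping of the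
  logarithms.\<close>

lemma sum_neighbours:
  fixes c :: "nat \<Rightarrow> nat \<Rightarrow> real"
  assumes "1 \<le> N"
  shows "c 0 1 + (\<Sum>i=1..<N. c i (i + 1) + c (i + 1) i) + c (N + 1) N
       = (\<Sum>i=1..N. c (i - 1) i + c (i + 1) i)"
  using assms
proof (induction N rule: nat_induct_at_least)
  case (Suc N)
  then show ?case by (simp add: sum.atLeastLessThan_Suc sum.cl_ivl_Suc algebra_simps)
qed simp

context
  fixes s :: real and N :: nat and \<theta> :: "nat \<Rightarrow> real"
  assumes s: "0 < s" and \<theta>: "\<And>i. 0 \<le> \<theta> i"
begin

lemma product_law_nonneg: "0 \<le> product_law s N \<theta> \<xi>"
  by (auto simp: product_law_def intro!: prod_nonneg neg_binomial_nonneg s \<theta>)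

lemma product_law_except_nonneg: "0 \<le> product_law_except s N i \<theta> \<xi>"
  by (auto simp: product_law_except_def intro!: prod_nonneg neg_binomial_nonneg s \<theta>)

lemma product_law_le_1: "product_law s N \<theta> \<xi> \<le> 1"
  by (auto simp: product_law_def intro!: prod_le_1 neg_binomial_nonneg neg_binomial_le_1 s \<theta>)

lemma product_law_except_le_1: "product_law_except s N i \<theta> \<xi> \<le> 1"
  by (auto simp: product_law_except_def intro!: prod_le_1 neg_binomial_nonneg neg_binomial_le_1 s \<theta>)

lemma nn_integral_product_law:
  "(\<integral>\<^sup>+\<xi>. ennreal (product_law s N \<theta> \<xi>) \<partial>count_space (configs N)) = 1"
proof -
  define p where "p t = embed_pmf (neg_binomial s t)" for t
  have p: "pmf (p t) m = neg_binomial s t m" if "0 \<le> t" for t m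
    unfolding p_def
  proof (rule pmf_embed_pmf)
    show "(\<integral>\<^sup>+m. ennreal (neg_binomial s t m) \<partial>count_space UNIV) = 1"
      using neg_binomial_sums[OF s that, of 1] s that
      by (simp add: nn_integral_count_space_nat suminf_ennreal2 sums_iff neg_binomial_nonneg)
  qed (use s that in \<open>auto intro: neg_binomial_nonneg\<close>)
  \<comment> \<open>The default value 0 off the sites matches the zero extension in
    \<open>configs\<close>.\<close>
  let ?\<pi> = "Pi_pmf {1..N} 0 (\<lambda>i. p (\<theta> i))"
  have "(\<integral>\<^sup>+\<xi>. ennreal (product_law s N \<theta> \<xi>) \<partial>count_space (configs N))
      = (\<integral>\<^sup>+\<xi>. ennreal (pmf ?\<pi> \<xi>) \<partial>count_space (configs N))"
  proof (intro nn_integral_cong)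
    fix \<xi> assume "\<xi> \<in> space (count_space (configs N))"
    then show "ennreal (product_law s N \<theta> \<xi>) = ennreal (pmf ?\<pi> \<xi>)"
      by (subst pmf_Pi') (auto simp: configs_def product_law_def p \<theta>)
  qed
  also have "\<dots> = 1"
  proof -
    have "set_pmf ?\<pi> \<subseteq> configs N"
      using set_Pi_pmf_subset[of "{1..N}" 0 "\<lambda>i. p (\<theta> i)"] by (auto simp: configs_def)
    then have "measure_pmf.prob ?\<pi> (configs N) = 1"
      by (subst measure_pmf.prob_eq_1) (auto simp: AE_measure_pmf_iff)
    then show ?thesis by (simp add: nn_integral_pmf measure_pmf.emeasure_eq_measure)
  qed
  finally show ?thesis .
qed

text \<open>The rate identity at site i, then relabelling by the configuration that remains after
  the emission: site i acts like a reservoir of density \<theta> i. F stands for what becomes of the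
  k emitted particles.\<close>

lemma nn_integral_product_law_shift:
  assumes i: "i \<in> {1..N}"
  shows "(\<integral>\<^sup>+\<xi>. ennreal (product_law s N \<theta> \<xi>) *
            (\<Sum>k=1..\<xi> i. ennreal (\<phi> s k (\<xi> i)) * F k (\<xi>(i := \<xi> i - k))) \<partial>count_space (configs N))
       = (\<integral>\<^sup>+\<xi>. ennreal (product_law s N \<theta> \<xi>) *
            (\<Sum>l. ennreal (succ_prob (\<theta> i) ^ Suc l / real (Suc l)) * F (Suc l) \<xi>) \<partial>count_space (configs N))"
proof -
  define G where "G l \<xi> = ennreal (product_law s N \<theta> \<xi>) *
    (ennreal (succ_prob (\<theta> i) ^ Suc l / real (Suc l)) * F (Suc l) \<xi>)" for l \<xi>
  have "ennreal (product_law s N \<theta> \<xi>) *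
          (\<Sum>k=1..\<xi> i. ennreal (\<phi> s k (\<xi> i)) * F k (\<xi>(i := \<xi> i - k)))
      = (\<Sum>l. if Suc l \<le> \<xi> i then G l (\<xi>(i := \<xi> i - Suc l)) else 0)" for \<xi>
  proof -
    have "ennreal (product_law s N \<theta> \<xi>) * (ennreal (\<phi> s (Suc l) (\<xi> i)) * F (Suc l) (\<xi>(i := \<xi> i - Suc l)))
        = G l (\<xi>(i := \<xi> i - Suc l))" if l: "Suc l \<le> \<xi> i" for l
    proof -
      let ?r = "succ_prob (\<theta> i) ^ Suc l / real (Suc l)"
      have rate: "\<phi> s (Suc l) (\<xi> i) * neg_binomial s (\<theta> i) (\<xi> i) = ?r * neg_binomial s (\<theta> i) (\<xi> i - Suc l)"
        using l by (intro \<phi>_mult_neg_binomial s) auto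
      have "product_law s N \<theta> \<xi> * \<phi> s (Suc l) (\<xi> i)
          = (\<phi> s (Suc l) (\<xi> i) * neg_binomial s (\<theta> i) (\<xi> i)) * product_law_except s N i \<theta> \<xi>"
        unfolding product_law_split[OF i] by (simp only: mult_ac)
      also have "\<dots> = product_law s N \<theta> (\<xi>(i := \<xi> i - Suc l)) * ?r"
        unfolding rate product_law_split[OF i] product_law_except_upd fun_upd_same by (simp only: mult_ac)
      finally have "product_law s N \<theta> \<xi> * \<phi> s (Suc l) (\<xi> i) = product_law s N \<theta> (\<xi>(i := \<xi> i - Suc l)) * ?r" .
      then show ?thesis
        unfolding G_def mult.assoc[symmetric]
        using \<phi>_nonneg[OF s l] \<theta>[of i]
        by (simp add: ennreal_mult[symmetric] product_law_nonneg del: power_Suc of_nat_Suc)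
    qed
    then show ?thesis
      unfolding sum_distrib_left by (subst sum_eq_suminf_ennreal) (auto intro!: suminf_cong)
  qed
  then have "(\<integral>\<^sup>+\<xi>. ennreal (product_law s N \<theta> \<xi>) *
            (\<Sum>k=1..\<xi> i. ennreal (\<phi> s k (\<xi> i)) * F k (\<xi>(i := \<xi> i - k))) \<partial>count_space (configs N))
      = (\<Sum>l. \<integral>\<^sup>+\<xi>. (if Suc l \<le> \<xi> i then G l (\<xi>(i := \<xi> i - Suc l)) else 0) \<partial>count_space (configs N))"
    by (simp add: nn_integral_suminf)
  also have "\<dots> = (\<Sum>l. \<integral>\<^sup>+\<xi>. G l \<xi> \<partial>count_space (configs N))"
    by (simp only: nn_integral_configs_shift[OF i])
  also have "\<dots> = (\<integral>\<^sup>+\<xi>. (\<Sum>l. G l \<xi>) \<partial>count_space (configs N))"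
    by (simp add: nn_integral_suminf)
  finally show ?thesis by (simp add: G_def ennreal_suminf_cmult)
qed

lemma nn_integral_entering:
  assumes j: "j \<in> {1..N}" and u: "0 \<le> u"
  shows "(\<integral>\<^sup>+\<xi>. ennreal (product_law s N \<theta> \<xi>) * entering u j f \<xi> \<partial>count_space (configs N))
       = (\<integral>\<^sup>+\<xi>. f \<xi> * ennreal (product_law_except s N j \<theta> \<xi> * nb_conv s u (\<theta> j) (\<xi> j)) \<partial>count_space (configs N))"
proof -
  define G where "G l \<xi> = ennreal (product_law s N \<theta> \<xi>) *
    (ennreal (succ_prob u ^ Suc l / real (Suc l)) * f (\<xi>(j := \<xi> j + Suc l)))" for l \<xi>
  \<comment> \<open>Regroups by the final configuration: before \<open>Suc l\<close> particles
    arrived, site j held \<open>\<xi> j - Suc l\<close> of them.\<close>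
  have G: "(\<Sum>l. if Suc l \<le> \<xi> j then G l (\<xi>(j := \<xi> j - Suc l)) else 0)
      = f \<xi> * ennreal (product_law_except s N j \<theta> \<xi> * nb_conv s u (\<theta> j) (\<xi> j))" for \<xi>
  proof -
    define H where "H k = f \<xi> * ennreal (product_law_except s N j \<theta> \<xi> *
       (succ_prob u ^ k / real k * neg_binomial s (\<theta> j) (\<xi> j - k)))" for k
    have "G l (\<xi>(j := \<xi> j - Suc l)) = H (Suc l)" if "Suc l \<le> \<xi> j" for l
      unfolding G_def H_def product_law_split[OF j]
      using that s \<theta>[of j] u
      by (simp add: ennreal_mult product_law_except_nonneg neg_binomial_nonneg fun_upd_idem mult_ac
          del: power_Suc of_nat_Suc times_divide_eq_left times_divide_eq_right)
    then have "(\<Sum>l. if Suc l \<le> \<xi> j then G l (\<xi>(j := \<xi> j - Suc l)) else 0) = (\<Sum>k=1..\<xi> j. H k)"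
      by (subst sum_eq_suminf_ennreal) (auto intro!: suminf_cong)
    also have "\<dots> = f \<xi> * ennreal (product_law_except s N j \<theta> \<xi> * nb_conv s u (\<theta> j) (\<xi> j))"
      unfolding H_def nb_conv_alt sum_distrib_left[symmetric]
      using s \<theta>[of j] u
      by (subst sum_ennreal) (auto simp: sum_distrib_left product_law_except_nonneg neg_binomial_nonneg)
    finally show ?thesis .
  qed
  have "(\<integral>\<^sup>+\<xi>. ennreal (product_law s N \<theta> \<xi>) * entering u j f \<xi> \<partial>count_space (configs N))
      = (\<Sum>l. \<integral>\<^sup>+\<xi>. G l \<xi> \<partial>count_space (configs N))"
    by (simp add: entering_def G_def nn_integral_suminf flip: ennreal_suminf_cmult)
  also have "\<dots> = (\<Sum>l. \<integral>\<^sup>+\<xi>. (if Suc l \<le> \<xi> j then G l (\<xi>(j := \<xi> j - Suc l)) else 0) \<partial>count_space (configs N))"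
    by (simp only: nn_integral_configs_shift[OF j])
  also have "\<dots> = (\<integral>\<^sup>+\<xi>. (\<Sum>l. if Suc l \<le> \<xi> j then G l (\<xi>(j := \<xi> j - Suc l)) else 0) \<partial>count_space (configs N))"
    by (simp add: nn_integral_suminf)
  finally show ?thesis by (simp only: G)
qed

text \<open>Particles that leave the system have no further effect on the configuration, so the
  emission rates of all sizes add up to ln (1 + \<theta> i).\<close>

lemma nn_integral_leaving:
  assumes i: "i \<in> {1..N}"
  shows "(\<integral>\<^sup>+\<xi>. ennreal (product_law s N \<theta> \<xi>) * leaving s i f \<xi> \<partial>count_space (configs N))
       = (\<integral>\<^sup>+\<xi>. f \<xi> * ennreal (ln (1 + \<theta> i) * product_law s N \<theta> \<xi>) \<partial>count_space (configs N))"
proof -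
  have "(\<Sum>l. ennreal (succ_prob (\<theta> i) ^ Suc l / real (Suc l)) * f \<xi>) = ennreal (ln (1 + \<theta> i)) * f \<xi>" for \<xi>
    by (simp only: ennreal_suminf_multc suminf_succ_prob_ennreal[OF \<theta>])
  then show ?thesis
    unfolding leaving_def nn_integral_product_law_shift[OF i, of "\<lambda>_. f"]
    using \<theta>[of i] by (simp add: ennreal_mult product_law_nonneg mult_ac del: power_Suc of_nat_Suc)
qed

text \<open>Emission from i is, after the shift, injection into j by a reservoir of density \<theta>
  i, so the formula for entering particles applies.\<close>

lemma nn_integral_jumping:
  assumes i: "i \<in> {1..N}" and j: "j \<in> {1..N}" and "i \<noteq> j"
  shows "(\<integral>\<^sup>+\<xi>. ennreal (product_law s N \<theta> \<xi>) * jumping s i j f \<xi> \<partial>count_space (configs N))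
       = (\<integral>\<^sup>+\<xi>. f \<xi> * ennreal (product_law_except s N j \<theta> \<xi> * nb_conv s (\<theta> i) (\<theta> j) (\<xi> j)) \<partial>count_space (configs N))"
  using nn_integral_product_law_shift[OF i, of "\<lambda>k \<xi>. f (\<xi>(j := \<xi> j + k))"]
    nn_integral_entering[OF j \<theta>[of i], of f] \<open>i \<noteq> j\<close>
  by (simp add: jumping_def entering_def)

text \<open>The adjoint of \<open>inflow\<close> applied to the product law, term by term.\<close>

definition inflow_density :: "real \<Rightarrow> real \<Rightarrow> (nat \<Rightarrow> nat) \<Rightarrow> real" where
  "inflow_density u v \<xi> =
     product_law_except s N 1 \<theta> \<xi> * nb_conv s u (\<theta> 1) (\<xi> 1) + ln (1 + \<theta> 1) * product_law s N \<theta> \<xi> +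
     (\<Sum>i=1..<N. product_law_except s N (i + 1) \<theta> \<xi> * nb_conv s (\<theta> i) (\<theta> (i + 1)) (\<xi> (i + 1)) +
        product_law_except s N i \<theta> \<xi> * nb_conv s (\<theta> (i + 1)) (\<theta> i) (\<xi> i)) +
     product_law_except s N N \<theta> \<xi> * nb_conv s v (\<theta> N) (\<xi> N) + ln (1 + \<theta> N) * product_law s N \<theta> \<xi>"

lemma nn_integral_inflow:
  assumes N: "1 \<le> N" and u: "0 \<le> u" "0 \<le> v"
  shows "(\<integral>\<^sup>+\<xi>. ennreal (product_law s N \<theta> \<xi>) * inflow s N u v f \<xi> \<partial>count_space (configs N))
       = (\<integral>\<^sup>+\<xi>. f \<xi> * ennreal (inflow_density u v \<xi>) \<partial>count_space (configs N))"
proof -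
  have c: "0 \<le> product_law_except s N j \<theta> \<xi> * nb_conv s a (\<theta> j) m" if "0 \<le> a" for j a m \<xi>
    using that by (intro mult_nonneg_nonneg product_law_except_nonneg nb_conv_nonneg s \<theta>)
  have l: "0 \<le> ln (1 + \<theta> j) * product_law s N \<theta> \<xi>" for j \<xi>
    using \<theta>[of j] by (intro mult_nonneg_nonneg product_law_nonneg) auto
  have "(\<integral>\<^sup>+\<xi>. ennreal (product_law s N \<theta> \<xi>) * inflow s N u v f \<xi> \<partial>count_space (configs N)) =
     (\<integral>\<^sup>+\<xi>. ennreal (product_law s N \<theta> \<xi>) * entering u 1 f \<xi> \<partial>count_space (configs N)) +
     (\<integral>\<^sup>+\<xi>. ennreal (product_law s N \<theta> \<xi>) * leaving s 1 f \<xi> \<partial>count_space (configs N)) +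
     (\<Sum>i=1..<N. (\<integral>\<^sup>+\<xi>. ennreal (product_law s N \<theta> \<xi>) * jumping s i (i + 1) f \<xi> \<partial>count_space (configs N)) +
        (\<integral>\<^sup>+\<xi>. ennreal (product_law s N \<theta> \<xi>) * jumping s (i + 1) i f \<xi> \<partial>count_space (configs N))) +
     (\<integral>\<^sup>+\<xi>. ennreal (product_law s N \<theta> \<xi>) * entering v N f \<xi> \<partial>count_space (configs N)) +
     (\<integral>\<^sup>+\<xi>. ennreal (product_law s N \<theta> \<xi>) * leaving s N f \<xi> \<partial>count_space (configs N))"
    unfolding inflow_def distrib_left sum_distrib_left
    by (simp add: nn_integral_add nn_integral_sum)
  also have "\<dots> =
     (\<integral>\<^sup>+\<xi>. f \<xi> * ennreal (product_law_except s N 1 \<theta> \<xi> * nb_conv s u (\<theta> 1) (\<xi> 1)) \<partial>count_space (configs N)) +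
     (\<integral>\<^sup>+\<xi>. f \<xi> * ennreal (ln (1 + \<theta> 1) * product_law s N \<theta> \<xi>) \<partial>count_space (configs N)) +
     (\<Sum>i=1..<N.
       (\<integral>\<^sup>+\<xi>. f \<xi> * ennreal (product_law_except s N (i + 1) \<theta> \<xi> * nb_conv s (\<theta> i) (\<theta> (i + 1)) (\<xi> (i + 1))) \<partial>count_space (configs N)) +
       (\<integral>\<^sup>+\<xi>. f \<xi> * ennreal (product_law_except s N i \<theta> \<xi> * nb_conv s (\<theta> (i + 1)) (\<theta> i) (\<xi> i)) \<partial>count_space (configs N))) +
     (\<integral>\<^sup>+\<xi>. f \<xi> * ennreal (product_law_except s N N \<theta> \<xi> * nb_conv s v (\<theta> N) (\<xi> N)) \<partial>count_space (configs N)) +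
     (\<integral>\<^sup>+\<xi>. f \<xi> * ennreal (ln (1 + \<theta> N) * product_law s N \<theta> \<xi>) \<partial>count_space (configs N))"
    using N u by (simp add: nn_integral_entering nn_integral_leaving nn_integral_jumping)
  also have "\<dots> = (\<integral>\<^sup>+\<xi>. f \<xi> * ennreal (inflow_density u v \<xi>) \<partial>count_space (configs N))"
    unfolding inflow_density_def
    by (simp add: ennreal_plus c l u \<theta> sum_nonneg sum_ennreal[symmetric] distrib_left sum_distrib_left
        nn_integral_add nn_integral_sum)
  finally show ?thesis .
qed

text \<open>At each site the two subtracted terms \<open>nb_conv s t t\<close> make up the doubled
  exit rate. Summed over the sites, the logarithms telescope to those of \<theta> 1 and \<theta> N,
  which come from particles leaving at the ends, minus those of the reservoirs, which are injection
  rates.\<close>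

lemma inflow_density_minus_outflow:
  assumes N: "1 \<le> N" and u: "\<theta> 0 = u" "\<theta> (N + 1) = v"
  shows "inflow_density u v \<xi> - exit_rate s N u v \<xi> * product_law s N \<theta> \<xi> =
    (\<Sum>i=1..N. product_law_except s N i \<theta> \<xi> *
       (reservoir_defect s (\<theta> (i - 1)) (\<theta> i) (\<xi> i) + reservoir_defect s (\<theta> (i + 1)) (\<theta> i) (\<xi> i)))"
proof -
  let ?p = "product_law s N \<theta> \<xi>"
  let ?c = "\<lambda>i j. product_law_except s N j \<theta> \<xi> * nb_conv s (\<theta> i) (\<theta> j) (\<xi> j)"
  let ?l = "\<lambda>i. ln (1 + \<theta> i)"
  have rate: "site_rate s (\<xi> i) * ?p = ?c i i" if "i \<in> {1..N}" for i
    unfolding product_law_split[OF that] site_rate_mult_neg_binomial[OF s, symmetric] by (simp add: mult_ac)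
  have "(\<Sum>i=1..N. product_law_except s N i \<theta> \<xi> *
       (reservoir_defect s (\<theta> (i - 1)) (\<theta> i) (\<xi> i) + reservoir_defect s (\<theta> (i + 1)) (\<theta> i) (\<xi> i)))
    = (\<Sum>i=1..N. (?c (i - 1) i + ?c (i + 1) i) - 2 * (site_rate s (\<xi> i) * ?p)
        + (?l i + ?l i) * ?p - (?l (i - 1) + ?l (i + 1)) * ?p)"
  proof (intro sum.cong refl)
    fix i assume i: "i \<in> {1..N}"
    show "product_law_except s N i \<theta> \<xi> *
       (reservoir_defect s (\<theta> (i - 1)) (\<theta> i) (\<xi> i) + reservoir_defect s (\<theta> (i + 1)) (\<theta> i) (\<xi> i))
      = (?c (i - 1) i + ?c (i + 1) i) - 2 * (site_rate s (\<xi> i) * ?p)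
        + (?l i + ?l i) * ?p - (?l (i - 1) + ?l (i + 1)) * ?p"
      unfolding rate[OF i] unfolding product_law_split[OF i] reservoir_defect_def
      by (simp add: algebra_simps)
  qed
  also have "\<dots> = (\<Sum>i=1..N. ?c (i - 1) i + ?c (i + 1) i) - 2 * (\<Sum>i=1..N. site_rate s (\<xi> i)) * ?p
      + (\<Sum>i=1..N. ?l i + ?l i) * ?p - (\<Sum>i=1..N. ?l (i - 1) + ?l (i + 1)) * ?p"
    by (simp only: sum.distrib sum_subtractf sum_distrib_left sum_distrib_right mult.assoc distrib_right)
  also have "\<dots> = inflow_density u v \<xi> - exit_rate s N u v \<xi> * ?p"
    unfolding sum_neighbours[OF N, of ?c, symmetric] sum_neighbours[OF N, of "\<lambda>i j. ?l j", symmetric]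
      sum_neighbours[OF N, of "\<lambda>i j. ?l i", symmetric] inflow_density_def exit_rate_def u
    by (simp add: algebra_simps)
  finally show ?thesis by simp
qed

lemma nn_integral_exit_rate:
  assumes N: "1 \<le> N" and u: "0 \<le> u" "0 \<le> v"
  shows "(\<integral>\<^sup>+\<xi>. ennreal (product_law s N \<theta> \<xi> * exit_rate s N u v \<xi>) \<partial>count_space (configs N))
       = ennreal (2 * (\<Sum>i=1..N. ln (1 + \<theta> i)) + ln (1 + u) + ln (1 + v))"
proof -
  have rate: "(\<integral>\<^sup>+\<xi>. ennreal (product_law s N \<theta> \<xi>) * ennreal (site_rate s (\<xi> i)) \<partial>count_space (configs N)) = ennreal (ln (1 + \<theta> i))"
    if i: "i \<in> {1..N}" for i
  proof -
    \<comment> \<open>For the constant test function the emission gain is the site rate itself, so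
      its mean is already known.\<close>
    have "leaving s i (\<lambda>_. 1) \<xi> = ennreal (site_rate s (\<xi> i))" for \<xi>
      unfolding leaving_def site_rate_def by (subst sum_ennreal[symmetric]) (auto simp: \<phi>_nonneg s)
    then have "(\<integral>\<^sup>+\<xi>. ennreal (product_law s N \<theta> \<xi>) * ennreal (site_rate s (\<xi> i)) \<partial>count_space (configs N))
      = (\<integral>\<^sup>+\<xi>. ennreal (ln (1 + \<theta> i)) * ennreal (product_law s N \<theta> \<xi>) \<partial>count_space (configs N))"
      using nn_integral_leaving[OF i, of "\<lambda>_. 1"] \<theta>[of i] by (simp add: ennreal_mult product_law_nonneg)
    then show ?thesis by (simp add: nn_integral_cmult nn_integral_product_law)
  qed
  have "ennreal (product_law s N \<theta> \<xi> * exit_rate s N u v \<xi>) =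
      2 * (\<Sum>i=1..N. ennreal (product_law s N \<theta> \<xi>) * ennreal (site_rate s (\<xi> i))) +
      (ennreal (ln (1 + u)) + ennreal (ln (1 + v))) * ennreal (product_law s N \<theta> \<xi>)" for \<xi>
  proof -
    have "(\<Sum>i=1..N. ennreal (product_law s N \<theta> \<xi>) * ennreal (site_rate s (\<xi> i)))
        = ennreal (product_law s N \<theta> \<xi>) * ennreal (\<Sum>i=1..N. site_rate s (\<xi> i))"
      by (simp add: site_rate_nonneg s flip: sum_distrib_left)
    then show ?thesis
      using u unfolding exit_rate_def
      by (simp add: ennreal_mult product_law_nonneg sum_nonneg site_rate_nonneg s distrib_left mult_ac add_ac)
  qed
  then have "(\<integral>\<^sup>+\<xi>. ennreal (product_law s N \<theta> \<xi> * exit_rate s N u v \<xi>) \<partial>count_space (configs N))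
      = 2 * (\<Sum>i=1..N. ennreal (ln (1 + \<theta> i))) + (ennreal (ln (1 + u)) + ennreal (ln (1 + v)))"
    by (simp add: nn_integral_add nn_integral_cmult nn_integral_sum rate nn_integral_product_law)
  then show ?thesis using u \<theta> by (simp add: sum_ennreal ennreal_mult sum_nonneg add.assoc)
qed

end

section \<open>Gain and loss in the generator\<close>

lemma harmonic_generator_eq:
  assumes s: "0 < s" and N: "1 \<le> N" and u: "0 \<le> \<rho>l" "0 \<le> \<rho>r"
    and f: "\<And>\<xi>. 0 \<le> f \<xi>" "\<And>\<xi>. f \<xi> \<le> 1"
  obtains R where "0 \<le> R" "inflow s N \<rho>l \<rho>r (\<lambda>\<xi>. ennreal (f \<xi>)) \<xi> = ennreal R"
    "harmonic_generator s N \<rho>l \<rho>r f \<xi> = R - exit_rate s N \<rho>l \<rho>r \<xi> * f \<xi>"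
proof -
  define jump where "jump i j = (\<Sum>k=1..\<xi> i. \<phi> s k (\<xi> i) * f (\<xi>(i := \<xi> i - k, j := \<xi> j + k)))" for i j
  define leave where "leave i = (\<Sum>k=1..\<xi> i. \<phi> s k (\<xi> i) * f (\<xi>(i := \<xi> i - k)))" for i
  define enter where "enter v i = (\<Sum>l. succ_prob v ^ Suc l / real (Suc l) * f (\<xi>(i := \<xi> i + Suc l)))" for v i
  have J: "jumping s i j (\<lambda>\<xi>. ennreal (f \<xi>)) \<xi> = ennreal (jump i j)" "0 \<le> jump i j" for i j
    unfolding jumping_def jump_def
    by (auto simp: ennreal_mult[symmetric] \<phi>_nonneg s f intro!: sum_nonneg sum_ennreal)
  have V: "leaving s i (\<lambda>\<xi>. ennreal (f \<xi>)) \<xi> = ennreal (leave i)" "0 \<le> leave i" for i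
    unfolding leaving_def leave_def
    by (auto simp: ennreal_mult[symmetric] \<phi>_nonneg s f intro!: sum_nonneg sum_ennreal)
  have summ: "summable (\<lambda>l. succ_prob v ^ Suc l / real (Suc l) * f (\<xi>(i := \<xi> i + Suc l)))" if "0 \<le> v" for v i
  proof (rule summable_comparison_test')
    show "summable (\<lambda>l. succ_prob v ^ Suc l / real (Suc l))"
      using succ_prob_sums_ln[OF that] by (rule sums_summable)
    show "norm (succ_prob v ^ Suc l / real (Suc l) * f (\<xi>(i := \<xi> i + Suc l)))
        \<le> succ_prob v ^ Suc l / real (Suc l)" for l :: nat
    proof -
      have "norm (succ_prob v ^ Suc l / real (Suc l) * f (\<xi>(i := \<xi> i + Suc l)))
          = succ_prob v ^ Suc l / real (Suc l) * f (\<xi>(i := \<xi> i + Suc l))"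
        using that f(1) by (simp add: abs_mult)
      also have "\<dots> \<le> succ_prob v ^ Suc l / real (Suc l) * 1"
        by (intro mult_left_mono f) (use that in auto)
      finally show ?thesis by simp
    qed
  qed
  have E: "entering v i (\<lambda>\<xi>. ennreal (f \<xi>)) \<xi> = ennreal (enter v i)" "0 \<le> enter v i" if "0 \<le> v" for v i
  proof -
    have nn: "0 \<le> succ_prob v ^ Suc l / real (Suc l)" for l using that by simp
    show "0 \<le> enter v i"
      unfolding enter_def by (intro suminf_nonneg summ that mult_nonneg_nonneg nn f)
    have "entering v i (\<lambda>\<xi>. ennreal (f \<xi>)) \<xi> = (\<Sum>l. ennreal (succ_prob v ^ Suc l / real (Suc l) * f (\<xi>(i := \<xi> i + Suc l))))"
      unfolding entering_def by (simp only: ennreal_mult[OF nn f(1)])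
    also have "\<dots> = ennreal (enter v i)"
      unfolding enter_def by (intro suminf_ennreal2 summ that mult_nonneg_nonneg nn f)
    finally show "entering v i (\<lambda>\<xi>. ennreal (f \<xi>)) \<xi> = ennreal (enter v i)" .
  qed
  have bulk: "bulk_generator s i f \<xi> = jump i (i + 1) + jump (i + 1) i - (site_rate s (\<xi> (i + 1)) + site_rate s (\<xi> i)) * f \<xi>" for i
  proof -
    \<comment> \<open>The generator lists the updates by site, \<open>jumping\<close> by source and
      target; at distinct sites the order is immaterial.\<close>
    have "\<xi>(i := \<xi> i + k, i + 1 := \<xi> (i + 1) - k) = \<xi>(i + 1 := \<xi> (i + 1) - k, i := \<xi> i + k)" for k
      by (rule fun_upd_twist) simp
    then show ?thesis
      unfolding bulk_generator_def jump_def site_rate_def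
      by (simp only: right_diff_distrib sum_subtractf sum_distrib_right[symmetric] distrib_right)
  qed
  have reservoir: "reservoir_generator s v i f \<xi> = leave i + enter v i - (site_rate s (\<xi> i) + ln (1 + v)) * f \<xi>"
    if v: "0 \<le> v" for v i
  proof -
    have "(\<lambda>l. succ_prob v ^ Suc l / real (Suc l) * f (\<xi>(i := \<xi> i + Suc l)) - succ_prob v ^ Suc l / real (Suc l) * f \<xi>)
        sums (enter v i - ln (1 + v) * f \<xi>)"
      unfolding enter_def by (intro sums_diff summable_sums summ v sums_mult2 succ_prob_sums_ln)
    then have "(\<Sum>l. 1 / real (Suc l) * (v / (1 + v)) ^ Suc l * (f (\<xi>(i := \<xi> i + Suc l)) - f \<xi>)) = enter v i - ln (1 + v) * f \<xi>"
      by (simp add: sums_iff succ_prob_def right_diff_distrib del: power_Suc of_nat_Suc)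
    then show ?thesis
      unfolding reservoir_generator_def leave_def site_rate_def
      by (simp only: right_diff_distrib sum_subtractf sum_distrib_right[symmetric] distrib_right)
  qed
  define R where "R = enter \<rho>l 1 + leave 1 + (\<Sum>i=1..<N. jump i (i + 1) + jump (i + 1) i) + enter \<rho>r N + leave N"
  show thesis
  proof
    have pos: "0 \<le> (\<Sum>i=1..<N. jump i (i + 1) + jump (i + 1) i)"
      by (intro sum_nonneg add_nonneg_nonneg J)
    then show "0 \<le> R"
      using J V E u by (auto simp: R_def)
    have "(\<Sum>i=1..<N. jumping s i (i + 1) (\<lambda>\<xi>. ennreal (f \<xi>)) \<xi> + jumping s (i + 1) i (\<lambda>\<xi>. ennreal (f \<xi>)) \<xi>)
        = ennreal (\<Sum>i=1..<N. jump i (i + 1) + jump (i + 1) i)"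
      by (simp add: J ennreal_plus[symmetric] sum_ennreal del: ennreal_plus)
    then show "inflow s N \<rho>l \<rho>r (\<lambda>\<xi>. ennreal (f \<xi>)) \<xi> = ennreal R"
      unfolding inflow_def R_def using pos u
      by (simp only: V E ennreal_plus add_nonneg_nonneg)
    have bulk_sum: "(\<Sum>i=1..<N. bulk_generator s i f \<xi>) = (\<Sum>i=1..<N. jump i (i + 1) + jump (i + 1) i)
        - (\<Sum>i=1..<N. site_rate s (\<xi> (i + 1)) + site_rate s (\<xi> i)) * f \<xi>"
      by (simp only: bulk sum_subtractf sum_distrib_right)
    \<comment> \<open>Pure rearrangement of reals, stated with variables so that the sums stay
      untouched.\<close>
    have "(v1 + e1 - (h1 + l1) * F) + (A - B * F) + (vN + eN - (hN + lN) * F)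
        = (e1 + v1 + A + eN + vN) - ((h1 + B + hN) + l1 + lN) * F"
      for v1 e1 h1 l1 A B vN eN hN lN F :: real
      by (simp add: algebra_simps)
    then have "harmonic_generator s N \<rho>l \<rho>r f \<xi> = R - ((site_rate s (\<xi> 1) + (\<Sum>i=1..<N. site_rate s (\<xi> (i + 1)) + site_rate s (\<xi> i)) +
        site_rate s (\<xi> N)) + ln (1 + \<rho>l) + ln (1 + \<rho>r)) * f \<xi>"
      unfolding harmonic_generator_def R_def bulk_sum reservoir[OF u(1)] reservoir[OF u(2)] .
    also have "(site_rate s (\<xi> 1) + (\<Sum>i=1..<N. site_rate s (\<xi> (i + 1)) + site_rate s (\<xi> i)) + site_rate s (\<xi> N))
        = 2 * (\<Sum>i=1..N. site_rate s (\<xi> i))"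
      unfolding sum_neighbours[OF N, of "\<lambda>i j. site_rate s (\<xi> j)"] by (simp only: sum.distrib mult_2)
    finally show "harmonic_generator s N \<rho>l \<rho>r f \<xi> = R - exit_rate s N \<rho>l \<rho>r \<xi> * f \<xi>"
      by (simp add: exit_rate_def)
  qed
qed

section \<open>Accessibility of the empty configuration\<close>

lemma jumping_mono_term:
  assumes "1 \<le> k" "k \<le> \<xi> i"
  shows "ennreal (\<phi> s k (\<xi> i)) * f (\<xi>(i := \<xi> i - k, j := \<xi> j + k)) \<le> jumping s i j f \<xi>"
  unfolding jumping_def
  by (rule member_le_sum[where f = "\<lambda>k. ennreal (\<phi> s k (\<xi> i)) * f (\<xi>(i := \<xi> i - k, j := \<xi> j + k))"])
     (use assms in auto)

lemma leaving_mono_term: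
  assumes "1 \<le> k" "k \<le> \<xi> i"
  shows "ennreal (\<phi> s k (\<xi> i)) * f (\<xi>(i := \<xi> i - k)) \<le> leaving s i f \<xi>"
  unfolding leaving_def
  by (rule member_le_sum[where f = "\<lambda>k. ennreal (\<phi> s k (\<xi> i)) * f (\<xi>(i := \<xi> i - k))"])
     (use assms in auto)

lemma harmonic_generator_indicator_pos:
  assumes s: "0 < s" and N: "1 \<le> N" and u: "0 \<le> \<rho>l" "0 \<le> \<rho>r" and ne: "\<zeta> \<noteq> \<xi>"
    and pos: "0 < inflow s N \<rho>l \<rho>r (\<lambda>\<xi>. ennreal (indicator {\<zeta>} \<xi>)) \<xi>"
  shows "0 < harmonic_generator s N \<rho>l \<rho>r (indicator {\<zeta>}) \<xi>"
proof -
  obtain R where "0 \<le> R" "inflow s N \<rho>l \<rho>r (\<lambda>\<xi>. ennreal (indicator {\<zeta>} \<xi>)) \<xi> = ennreal R"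
    "harmonic_generator s N \<rho>l \<rho>r (indicator {\<zeta>}) \<xi> = R - exit_rate s N \<rho>l \<rho>r \<xi> * indicator {\<zeta>} \<xi>"
    by (rule harmonic_generator_eq[OF s N u, of "indicator {\<zeta>}" \<xi>]) auto
  then show ?thesis using pos ne by auto
qed

text \<open>Every particle can be moved to the left, one site at a time, and out through site 1, so the
  empty configuration is accessible even when both reservoirs have density zero.\<close>

lemma harmonic_empty_accessible:
  assumes s: "0 < s" and N: "1 \<le> N" and u: "0 \<le> \<rho>l" "0 \<le> \<rho>r"
    and P: "harmonic_process s N \<rho>l \<rho>r P" and \<eta>: "\<eta> \<in> configs N" and t: "0 < t"
  shows "0 < pmf (P t \<eta>) (\<lambda>_. 0)"
  using \<eta> t
\<comment> \<open>Weighting each particle by its site makes every move to the left, and every exit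
  from site 1, a decrease. The time is arbitrary because each step uses up half of it.\<close>
proof (induction "\<Sum>i=1..N. i * \<eta> i" arbitrary: \<eta> t rule: less_induct)
  case less
  note gen = P[unfolded harmonic_process_def, THEN conjunct1] P[unfolded harmonic_process_def, THEN conjunct2]
  show ?case
  proof (cases "\<exists>i\<in>{1..N}. \<eta> i > 0")
    case False
    then have "\<eta> i = 0" for i
      using less.prems by (cases "i \<in> {1..N}") (auto simp: configs_def)
    then have "\<eta> = (\<lambda>_. 0)" by (rule ext)
    then show ?thesis using pmf_diag_pos[OF gen less.prems(1), of t] less.prems by simp
  next
    case True
    then obtain i where i: "i \<in> {1..N}" "\<eta> i > 0" by blast
    have step: "0 < pmf (P t \<eta>) (\<lambda>_. 0)"
      if z: "\<zeta> \<in> configs N" "\<zeta> \<noteq> \<eta>" "(\<Sum>i=1..N. i * \<zeta> i) < (\<Sum>i=1..N. i * \<eta> i)"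
        "0 < inflow s N \<rho>l \<rho>r (\<lambda>\<xi>. ennreal (indicator {\<zeta>} \<xi>)) \<eta>" for \<zeta>
      using pmf_pos_step[OF gen, of \<eta> \<zeta> "\<lambda>_. 0" t] harmonic_generator_indicator_pos[OF s N u z(2,4)]
        less.hyps[OF z(3,1)] less.prems z(2) by blast
    show ?thesis
    proof (cases "i = 1")
      case True
      \<comment> \<open>All particles of site 1 leave in a single jump.\<close>
      define \<zeta> where "\<zeta> = \<eta>(1 := 0)"
      have "0 < ennreal (\<phi> s (\<eta> 1) (\<eta> 1)) * ennreal (indicator {\<zeta>} (\<eta>(1 := \<eta> 1 - \<eta> 1)))"
        using i True by (simp add: \<zeta>_def \<phi>_pos s)
      also have "\<dots> \<le> leaving s 1 (\<lambda>\<xi>. ennreal (indicator {\<zeta>} \<xi>)) \<eta>"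
        by (rule leaving_mono_term) (use i True in auto)
      also have "\<dots> \<le> inflow s N \<rho>l \<rho>r (\<lambda>\<xi>. ennreal (indicator {\<zeta>} \<xi>)) \<eta>"
        unfolding inflow_def by (simp add: add_increasing add_increasing2)
      finally show ?thesis
      proof (rule step[rotated 3])
        show "(\<Sum>i=1..N. i * \<zeta> i) < (\<Sum>i=1..N. i * \<eta> i)"
          by (rule sum_strict_mono_ex1) (use i True in \<open>auto simp: \<zeta>_def intro!: bexI[of _ 1]\<close>)
        show "\<zeta> \<noteq> \<eta>" using i True by (auto simp: \<zeta>_def fun_eq_iff)
      qed (use less.prems in \<open>auto simp: configs_def \<zeta>_def\<close>)
    next
      case False
      then obtain j where j: "i = j + 1" "1 \<le> j" using i by (cases i) auto
      \<comment> \<open>Emptying site j + 1 into site j in one jump lowers the weighted sum by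
        \<eta> (j + 1).\<close>
      define \<zeta> where "\<zeta> = \<eta>(j + 1 := 0, j := \<eta> j + \<eta> (j + 1))"
      have "0 < ennreal (\<phi> s (\<eta> (j + 1)) (\<eta> (j + 1))) *
          ennreal (indicator {\<zeta>} (\<eta>(j + 1 := \<eta> (j + 1) - \<eta> (j + 1), j := \<eta> j + \<eta> (j + 1))))"
        using i j by (simp add: \<zeta>_def \<phi>_pos s)
      also have "\<dots> \<le> jumping s (j + 1) j (\<lambda>\<xi>. ennreal (indicator {\<zeta>} \<xi>)) \<eta>"
        by (rule jumping_mono_term) (use i j in auto)
      also have "\<dots> \<le> (\<Sum>i=1..<N. jumping s i (i + 1) (\<lambda>\<xi>. ennreal (indicator {\<zeta>} \<xi>)) \<eta> +
          jumping s (i + 1) i (\<lambda>\<xi>. ennreal (indicator {\<zeta>} \<xi>)) \<eta>)"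
        by (rule order_trans[OF _ member_le_sum[of j]]) (use i j in \<open>auto simp: add_increasing\<close>)
      also have "\<dots> \<le> inflow s N \<rho>l \<rho>r (\<lambda>\<xi>. ennreal (indicator {\<zeta>} \<xi>)) \<eta>"
        unfolding inflow_def by (simp add: add_increasing add_increasing2)
      finally show ?thesis
      proof (rule step[rotated 3])
        have split: "(\<Sum>i=1..N. i * h i) = (j + 1) * h (j + 1) + j * h j + (\<Sum>i\<in>{1..N} - {j + 1} - {j}. i * h i)" for h :: "nat \<Rightarrow> nat"
          using i j by (simp add: sum.remove[of _ "j + 1"] sum.remove[of _ j])
        have "(\<Sum>i\<in>{1..N} - {j + 1} - {j}. i * \<zeta> i) = (\<Sum>i\<in>{1..N} - {j + 1} - {j}. i * \<eta> i)"
          by (intro sum.cong) (auto simp: \<zeta>_def)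
        then show "(\<Sum>i=1..N. i * \<zeta> i) < (\<Sum>i=1..N. i * \<eta> i)"
          unfolding split using i j by (simp add: \<zeta>_def algebra_simps)
        show "\<zeta> \<noteq> \<eta>" using i j by (auto simp: \<zeta>_def fun_eq_iff)
      qed (use less.prems i j in \<open>auto simp: configs_def \<zeta>_def\<close>)
    qed
  qed
qed

text \<open>What the invariance argument requires of a random density profile whose ends are the
  reservoirs. The balance is asked only on average over the profile. There are two instances: the
  law with gap density, and the constant profile when the reservoirs agree.\<close>

locale stationary_mixture = prob_space K for K :: "'k measure" +
  fixes s b \<rho>l \<rho>r :: real and N :: nat and \<theta> :: "nat \<Rightarrow> 'k \<Rightarrow> real"
  assumes s: "0 < s" and N: "1 \<le> N"
    and meas [measurable]: "\<And>i. \<theta> i \<in> borel_measurable K"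
    and nonneg: "\<And>i x. 0 \<le> \<theta> i x" and bounded: "\<And>i x. \<theta> i x \<le> b"
    and left: "\<And>x. \<theta> 0 x = \<rho>l" and right: "\<And>x. \<theta> (N + 1) x = \<rho>r"
    and balance: "\<And>i \<xi>. i \<in> {1..N} \<Longrightarrow>
      (\<integral>x. product_law_except s N i (\<lambda>j. \<theta> j x) \<xi> *
        (reservoir_defect s (\<theta> (i - 1) x) (\<theta> i x) (\<xi> i) +
         reservoir_defect s (\<theta> (i + 1) x) (\<theta> i x) (\<xi> i)) \<partial>K) = 0"
begin

definition mixed_law :: "(nat \<Rightarrow> nat) \<Rightarrow> real" where
  "mixed_law \<xi> = (\<integral>x. product_law s N (\<lambda>j. \<theta> j x) \<xi> \<partial>K)"

lemma \<rho>_nonneg: "0 \<le> \<rho>l" "0 \<le> \<rho>r"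
  using nonneg left right by metis+

lemma measurable_product_law [measurable]:
  "(\<lambda>x. product_law s N (\<lambda>j. \<theta> j x) \<xi>) \<in> borel_measurable K"
  "(\<lambda>x. product_law_except s N i (\<lambda>j. \<theta> j x) \<xi>) \<in> borel_measurable K"
  unfolding product_law_def product_law_except_def by measurable

lemma integrable_product_law [simp]: "integrable K (\<lambda>x. product_law s N (\<lambda>j. \<theta> j x) \<xi>)"
  by (rule integrable_const_bound[of _ 1])
     (auto simp: product_law_nonneg product_law_le_1 s nonneg)

lemma ennreal_mixed_law: "ennreal (mixed_law \<xi>) = (\<integral>\<^sup>+x. ennreal (product_law s N (\<lambda>j. \<theta> j x) \<xi>) \<partial>K)"
  unfolding mixed_law_def
  by (rule nn_integral_eq_integral[symmetric]) (auto simp: product_law_nonneg s nonneg)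

lemma mixed_law_nonneg: "0 \<le> mixed_law \<xi>"
  unfolding mixed_law_def by (intro Bochner_Integration.integral_nonneg product_law_nonneg s nonneg)

lemma nn_integral_mixed_law:
  "(\<integral>\<^sup>+\<xi>. ennreal (mixed_law \<xi>) * F \<xi> \<partial>count_space (configs N)) =
   (\<integral>\<^sup>+x. \<integral>\<^sup>+\<xi>. ennreal (product_law s N (\<lambda>j. \<theta> j x) \<xi>) * F \<xi> \<partial>count_space (configs N) \<partial>K)"
  unfolding ennreal_mixed_law
  by (subst nn_integral_count_space_nn_integral[OF countable_configs]) (auto simp: nn_integral_multc)

lemma nn_integral_mixed_law_1: "(\<integral>\<^sup>+\<xi>. ennreal (mixed_law \<xi>) \<partial>count_space (configs N)) = 1"
  using nn_integral_mixed_law[of "\<lambda>_. 1"] nn_integral_product_law[OF s, of "\<lambda>j. \<theta> j _" N]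
  by (simp add: nonneg emeasure_space_1)

text \<open>For a fixed profile gain and loss differ by a sum of site terms; each of these has mean
  0 by \<open>balance\<close>.\<close>

lemma integral_inflow_density:
  "(\<integral>\<^sup>+x. ennreal (inflow_density s N (\<lambda>j. \<theta> j x) \<rho>l \<rho>r \<xi>) \<partial>K)
    = ennreal (exit_rate s N \<rho>l \<rho>r \<xi> * mixed_law \<xi>)"
proof -
  let ?B = "\<lambda>i x. product_law_except s N i (\<lambda>j. \<theta> j x) \<xi> *
       (reservoir_defect s (\<theta> (i - 1) x) (\<theta> i x) (\<xi> i) + reservoir_defect s (\<theta> (i + 1) x) (\<theta> i x) (\<xi> i))"
  have eq: "inflow_density s N (\<lambda>j. \<theta> j x) \<rho>l \<rho>r \<xi> = exit_rate s N \<rho>l \<rho>r \<xi> * product_law s N (\<lambda>j. \<theta> j x) \<xi> + (\<Sum>i=1..N. ?B i x)" for x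
    using inflow_density_minus_outflow[OF s, of "\<lambda>j. \<theta> j x" N \<rho>l \<rho>r \<xi>] nonneg N left right by simp
  have B: "integrable K (?B i)" for i
  proof (rule integrable_const_bound[of _ "1 * (2 * ln (1 + b) + 2 * ln (1 + b))"], rule AE_I2)
    fix x
    have "\<bar>reservoir_defect s (\<theta> (i - 1) x) (\<theta> i x) (\<xi> i) + reservoir_defect s (\<theta> (i + 1) x) (\<theta> i x) (\<xi> i)\<bar>
        \<le> 2 * ln (1 + b) + 2 * ln (1 + b)"
      by (intro order_trans[OF abs_triangle_ineq] add_mono abs_reservoir_defect_le s nonneg bounded)
    then show "norm (?B i x) \<le> 1 * (2 * ln (1 + b) + 2 * ln (1 + b))"
      unfolding real_norm_def abs_mult
      by (intro mult_mono) (auto simp: product_law_except_nonneg product_law_except_le_1 s nonneg)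
  qed measurable
  have "0 \<le> inflow_density s N (\<lambda>j. \<theta> j x) \<rho>l \<rho>r \<xi>" for x
    unfolding inflow_density_def[OF s nonneg]
    by (intro add_nonneg_nonneg sum_nonneg mult_nonneg_nonneg product_law_nonneg product_law_except_nonneg
        nb_conv_nonneg s nonneg \<rho>_nonneg) (auto simp: nonneg)
  moreover have int: "integrable K (\<lambda>x. inflow_density s N (\<lambda>j. \<theta> j x) \<rho>l \<rho>r \<xi>)"
    unfolding eq using B by simp
  ultimately have "(\<integral>\<^sup>+x. ennreal (inflow_density s N (\<lambda>j. \<theta> j x) \<rho>l \<rho>r \<xi>) \<partial>K)
     = ennreal (\<integral>x. inflow_density s N (\<lambda>j. \<theta> j x) \<rho>l \<rho>r \<xi> \<partial>K)"
    by (intro nn_integral_eq_integral) auto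
  also have "(\<integral>x. inflow_density s N (\<lambda>j. \<theta> j x) \<rho>l \<rho>r \<xi> \<partial>K) = exit_rate s N \<rho>l \<rho>r \<xi> * mixed_law \<xi>"
    unfolding eq using B by (simp add: mixed_law_def balance del: One_nat_def add_Suc_right Suc_eq_plus1)
  finally show ?thesis .
qed

text \<open>Stationarity tested against f, written as gain equals loss: without a subtraction,
  infinite values are harmless.\<close>

lemma mixed_law_inflow:
  "(\<integral>\<^sup>+\<xi>. ennreal (mixed_law \<xi>) * inflow s N \<rho>l \<rho>r f \<xi> \<partial>count_space (configs N)) =
   (\<integral>\<^sup>+\<xi>. ennreal (mixed_law \<xi>) * (ennreal (exit_rate s N \<rho>l \<rho>r \<xi>) * f \<xi>) \<partial>count_space (configs N))"
proof -
  have "(\<integral>\<^sup>+\<xi>. ennreal (mixed_law \<xi>) * inflow s N \<rho>l \<rho>r f \<xi> \<partial>count_space (configs N)) =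
    (\<integral>\<^sup>+x. \<integral>\<^sup>+\<xi>. f \<xi> * ennreal (inflow_density s N (\<lambda>j. \<theta> j x) \<rho>l \<rho>r \<xi>) \<partial>count_space (configs N) \<partial>K)"
    unfolding nn_integral_mixed_law
    by (intro nn_integral_cong nn_integral_inflow s nonneg N \<rho>_nonneg)
  also have "\<dots> = (\<integral>\<^sup>+\<xi>. \<integral>\<^sup>+x. f \<xi> * ennreal (inflow_density s N (\<lambda>j. \<theta> j x) \<rho>l \<rho>r \<xi>) \<partial>K \<partial>count_space (configs N))"
    by (rule nn_integral_count_space_nn_integral[OF countable_configs])
       (auto simp: inflow_density_def[OF s nonneg])
  also have "\<dots> = (\<integral>\<^sup>+\<xi>. f \<xi> * ennreal (exit_rate s N \<rho>l \<rho>r \<xi> * mixed_law \<xi>) \<partial>count_space (configs N))"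
    by (simp add: nn_integral_cmult integral_inflow_density inflow_density_def[OF s nonneg] cong: nn_integral_cong
        flip: integral_inflow_density)
  also have "\<dots> = (\<integral>\<^sup>+\<xi>. ennreal (mixed_law \<xi>) * (ennreal (exit_rate s N \<rho>l \<rho>r \<xi>) * f \<xi>) \<partial>count_space (configs N))"
    by (simp add: ennreal_mult exit_rate_nonneg mixed_law_nonneg s \<rho>_nonneg mult_ac)
  finally show ?thesis .
qed

text \<open>A profile bounded by b has mean exit rate bounded in terms of ln (1 + b), although the
  rates themselves are unbounded in the state.\<close>

lemma mixed_law_exit_rate_finite:
  "(\<integral>\<^sup>+\<xi>. ennreal (mixed_law \<xi>) * ennreal (exit_rate s N \<rho>l \<rho>r \<xi>) \<partial>count_space (configs N)) < \<infinity>"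
proof -
  have "(\<integral>\<^sup>+\<xi>. ennreal (mixed_law \<xi>) * ennreal (exit_rate s N \<rho>l \<rho>r \<xi>) \<partial>count_space (configs N)) =
    (\<integral>\<^sup>+x. ennreal (2 * (\<Sum>i=1..N. ln (1 + \<theta> i x)) + ln (1 + \<rho>l) + ln (1 + \<rho>r)) \<partial>K)"
    unfolding nn_integral_mixed_law
    using nn_integral_exit_rate[OF s, of "\<lambda>j. \<theta> j _" N \<rho>l \<rho>r] N \<rho>_nonneg
    by (simp add: nonneg ennreal_mult product_law_nonneg s exit_rate_nonneg)
  also have "\<dots> \<le> (\<integral>\<^sup>+x. ennreal (2 * (\<Sum>i=1..N. ln (1 + b)) + ln (1 + \<rho>l) + ln (1 + \<rho>r)) \<partial>K)"
  proof (intro nn_integral_mono ennreal_leI add_mono mult_left_mono sum_mono)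
    fix x i show "ln (1 + \<theta> i x) \<le> ln (1 + b)"
      using nonneg[of i x] bounded[of i x] by simp
  qed auto
  also have "\<dots> < \<infinity>" by (simp add: emeasure_space_1)
  finally show ?thesis .
qed

definition mixed_pmf :: "(nat \<Rightarrow> nat) pmf" where
  "mixed_pmf = embed_pmf (\<lambda>\<xi>. if \<xi> \<in> configs N then mixed_law \<xi> else 0)"

lemma pmf_mixed: "pmf mixed_pmf \<xi> = (if \<xi> \<in> configs N then mixed_law \<xi> else 0)"
  unfolding mixed_pmf_def
proof (rule pmf_embed_pmf)
  have "(\<integral>\<^sup>+\<xi>. ennreal (if \<xi> \<in> configs N then mixed_law \<xi> else 0) \<partial>count_space UNIV)
      = (\<integral>\<^sup>+\<xi>. ennreal (mixed_law \<xi>) \<partial>count_space (configs N))"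
    unfolding nn_integral_count_space_indicator[where X = "configs N", simplified]
    by (intro nn_integral_cong) (auto simp: indicator_def)
  then show "(\<integral>\<^sup>+\<xi>. ennreal (if \<xi> \<in> configs N then mixed_law \<xi> else 0) \<partial>count_space UNIV) = 1"
    by (simp add: nn_integral_mixed_law_1)
qed (auto simp: mixed_law_nonneg)

lemma set_mixed_pmf: "set_pmf mixed_pmf \<subseteq> configs N"
  by (auto simp: set_pmf_eq pmf_mixed)

lemma nn_integral_mixed_pmf:
  "(\<integral>\<^sup>+\<xi>. F \<xi> \<partial>measure_pmf mixed_pmf) = (\<integral>\<^sup>+\<xi>. ennreal (mixed_law \<xi>) * F \<xi> \<partial>count_space (configs N))"
  unfolding nn_integral_measure_pmf pmf_mixed
    nn_integral_count_space_indicator[where X = "configs N", simplified]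
  by (intro nn_integral_cong) (auto simp: indicator_def)

lemma integrable_exit_rate:
  assumes f: "\<And>\<xi>. 0 \<le> f \<xi>" "\<And>\<xi>. f \<xi> \<le> 1"
  shows "integrable (measure_pmf mixed_pmf) (\<lambda>\<xi>. exit_rate s N \<rho>l \<rho>r \<xi> * f \<xi>)"
proof (rule Bochner_Integration.integrable_bound)
  show "integrable (measure_pmf mixed_pmf) (exit_rate s N \<rho>l \<rho>r)"
    using mixed_law_exit_rate_finite
    by (intro integrableI_bounded) (auto simp: nn_integral_mixed_pmf exit_rate_nonneg s \<rho>_nonneg)
  show "AE \<xi> in measure_pmf mixed_pmf. norm (exit_rate s N \<rho>l \<rho>r \<xi> * f \<xi>) \<le> norm (exit_rate s N \<rho>l \<rho>r \<xi>)"
    using f by (intro AE_I2) (auto simp: abs_mult exit_rate_nonneg s \<rho>_nonneg intro!: mult_left_le)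
qed auto

lemma expectation_harmonic_generator:
  assumes f: "\<And>\<xi>. 0 \<le> f \<xi>" "\<And>\<xi>. f \<xi> \<le> 1"
  shows "measure_pmf.expectation mixed_pmf (harmonic_generator s N \<rho>l \<rho>r f) = 0"
proof -
  let ?q = "exit_rate s N \<rho>l \<rho>r"
  have "\<exists>R. 0 \<le> R \<and> inflow s N \<rho>l \<rho>r (\<lambda>\<xi>. ennreal (f \<xi>)) \<xi> = ennreal R \<and>
      harmonic_generator s N \<rho>l \<rho>r f \<xi> = R - ?q \<xi> * f \<xi>" for \<xi>
    by (rule harmonic_generator_eq[OF s N \<rho>_nonneg, of f \<xi>]) (use f in auto)
  then obtain R where R: "\<And>\<xi>. 0 \<le> R \<xi>" "\<And>\<xi>. inflow s N \<rho>l \<rho>r (\<lambda>\<xi>. ennreal (f \<xi>)) \<xi> = ennreal (R \<xi>)"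
      "\<And>\<xi>. harmonic_generator s N \<rho>l \<rho>r f \<xi> = R \<xi> - ?q \<xi> * f \<xi>"
    by metis
  have qf: "0 \<le> ?q \<xi> * f \<xi>" for \<xi> by (intro mult_nonneg_nonneg exit_rate_nonneg s \<rho>_nonneg f)
  have "(\<integral>\<^sup>+\<xi>. ennreal (R \<xi>) \<partial>measure_pmf mixed_pmf) = (\<integral>\<^sup>+\<xi>. ennreal (?q \<xi> * f \<xi>) \<partial>measure_pmf mixed_pmf)"
    unfolding nn_integral_mixed_pmf R(2)[symmetric] mixed_law_inflow
    by (simp add: ennreal_mult exit_rate_nonneg s \<rho>_nonneg f)
  also have "\<dots> = ennreal (measure_pmf.expectation mixed_pmf (\<lambda>\<xi>. ?q \<xi> * f \<xi>))"
    by (intro nn_integral_eq_integral integrable_exit_rate f AE_I2 qf)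
  \<comment> \<open>The loss is integrable, and the gain has the same extended integral; hence the
    gain is integrable too and the difference has mean 0.\<close>
  finally have "integrable (measure_pmf mixed_pmf) R \<and>
      measure_pmf.expectation mixed_pmf R = measure_pmf.expectation mixed_pmf (\<lambda>\<xi>. ?q \<xi> * f \<xi>)"
    by (subst (asm) nn_integral_eq_integrable) (auto simp: R integral_nonneg qf)
  then show ?thesis
    unfolding R(3) by (simp add: integrable_exit_rate f)
qed

theorem invariant_law_mixed:
  assumes P: "harmonic_process s N \<rho>l \<rho>r P"
  shows "invariant_law (configs N) P \<mu> \<longleftrightarrow> \<mu> = mixed_pmf"
proof -
  note gen = P[unfolded harmonic_process_def, THEN conjunct1] P[unfolded harmonic_process_def, THEN conjunct2]
  \<comment> \<open>No jump ends where it started, so the indicator receives no gain at its own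
    point and only the exit rate is left.\<close>
  have diag: "- harmonic_generator s N \<rho>l \<rho>r (indicator {\<xi>}) \<xi> = exit_rate s N \<rho>l \<rho>r \<xi>" for \<xi>
  proof -
    obtain R where R: "0 \<le> R" "inflow s N \<rho>l \<rho>r (\<lambda>\<zeta>. ennreal (indicator {\<xi>} \<zeta>)) \<xi> = ennreal R"
      "harmonic_generator s N \<rho>l \<rho>r (indicator {\<xi>}) \<xi> = R - exit_rate s N \<rho>l \<rho>r \<xi> * indicator {\<xi>} \<xi>"
      by (rule harmonic_generator_eq[OF s N \<rho>_nonneg, of "indicator {\<xi>}" \<xi>]) auto
    have ne: "\<xi>(i := \<xi> i - k, j := \<xi> j + k) \<noteq> \<xi>" "\<xi>(i := \<xi> i - k) \<noteq> \<xi>" if "1 \<le> k" "k \<le> \<xi> i" "i \<noteq> j" for i j k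
      using that by (auto simp: fun_eq_iff)
    have "inflow s N \<rho>l \<rho>r (\<lambda>\<zeta>. ennreal (indicator {\<xi>} \<zeta>)) \<xi> = 0"
      unfolding inflow_def entering_def leaving_def jumping_def
      using ne(1) ne(2)[of _ _ "Suc _"] by (auto simp: fun_eq_iff indicator_def)
    then show ?thesis using R by simp
  qed
  have inv: "invariant_law (configs N) P mixed_pmf"
  proof (rule invariant_lawI[OF gen set_mixed_pmf])
    show "integrable (measure_pmf mixed_pmf) (\<lambda>\<xi>. - harmonic_generator s N \<rho>l \<rho>r (indicator {\<xi>}) \<xi>)"
      unfolding diag using integrable_exit_rate[of "\<lambda>_. 1"] by simp
  qed (rule expectation_harmonic_generator)
  have "\<mu> = mixed_pmf" if "invariant_law (configs N) P \<mu>"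
    using harmonic_empty_accessible[OF s N \<rho>_nonneg P _ zero_less_one] that inv
    by (rule invariant_law_unique)
  then show ?thesis using inv by auto
qed

end

section \<open>Order statistics\<close>

text \<open>Sorting over an arbitrary finite index set allows the induction below to delete the
  index of the minimum.\<close>

definition sorted_values :: "nat set \<Rightarrow> (nat \<Rightarrow> real) \<Rightarrow> real list" where
  "sorted_values I x = sorted_list_of_multiset (image_mset x (mset_set I))"

lemma sorted_values_empty [simp]: "sorted_values {} x = []"
  by (simp add: sorted_values_def)

lemma sorted_values_insert:
  "finite I \<Longrightarrow> i \<notin> I \<Longrightarrow> sorted_values (insert i I) x = insort (x i) (sorted_values I x)"
  by (simp add: sorted_values_def)

lemma length_sorted_values [simp]: "finite I \<Longrightarrow> length (sorted_values I x) = card I"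
  unfolding sorted_values_def by (metis mset_sorted_list_of_multiset size_image_mset size_mset size_mset_set)

lemma set_sorted_values: "finite I \<Longrightarrow> set (sorted_values I x) = x ` I"
  by (simp add: sorted_values_def)

lemma sorted_values_cong:
  assumes "\<And>i. i \<in> I \<Longrightarrow> x i = y i"
  shows "sorted_values I x = sorted_values I y"
proof (cases "finite I")
  case True
  then show ?thesis unfolding sorted_values_def
    by (intro arg_cong[of _ _ sorted_list_of_multiset] image_mset_cong) (use assms in auto)
qed (simp add: sorted_values_def)

lemma sorted_values_remove_min:
  assumes "finite I" "i \<in> I" "\<And>m. m \<in> I - {i} \<Longrightarrow> x i \<le> x m"
  shows "sorted_values I x = x i # sorted_values (I - {i}) x"
proof -
  have "I = insert i (I - {i})" using assms by auto
  then have "sorted_values I x = insort (x i) (sorted_values (I - {i}) x)"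
    using sorted_values_insert[of "I - {i}" i x] assms by simp
  also have "\<dots> = x i # sorted_values (I - {i}) x"
    using assms set_sorted_values[of "I - {i}" x] by (intro insort_is_Cons) auto
  finally show ?thesis .
qed

lemma order_stat_eq_sorted_values: "order_stat n x j = sorted_values {1..n} x ! (j - 1)"
proof -
  have "image_mset x (mset_set {1..n}) = mset (map x [1..<n + 1])"
    by (metis Suc_eq_plus1 atLeastLessThanSuc_atLeastAtMost mset_map mset_upt)
  then show ?thesis by (simp only: order_stat_def sorted_values_def sorted_list_of_multiset_mset)
qed

text \<open>Writes the entries after an insertion through \<open>min\<close> and \<open>max\<close>
  of earlier ones, which makes order statistics visibly measurable.\<close>

lemma nth_insort:
  fixes x :: "'a :: linorder"
  assumes "sorted ys" "l \<le> length ys"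
  shows "insort x ys ! l =
    (if l < length ys then (if l = 0 then min x (ys ! 0) else max (ys ! (l - 1)) (min x (ys ! l)))
     else if l = 0 then x else max (ys ! (l - 1)) x)"
  using assms
proof (induction ys arbitrary: l)
  case (Cons y ys)
  show ?case
  proof (cases l)
    case 0
    then show ?thesis by (auto simp: min_def)
  next
    case (Suc m)
    show ?thesis
    proof (cases "x \<le> y")
      case True
      have "y \<le> ys ! k" if "k < length ys" for k using Cons.prems that by auto
      moreover have "(y # ys) ! m \<le> (y # ys) ! Suc m" if "m < length ys"
        using sorted_nth_mono[OF Cons.prems(1), of m "Suc m"] that by simp
      moreover have "y \<le> (y # ys) ! m"
        using sorted_nth_mono[OF Cons.prems(1), of 0 m] Cons.prems(2) Suc by simp
      ultimately show ?thesis using True Suc Cons.prems by (auto simp: min_def max_def)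
    next
      case False
      have IH: "insort x ys ! m = (if m < length ys then (if m = 0 then min x (ys ! 0) else max (ys ! (m - 1)) (min x (ys ! m)))
         else if m = 0 then x else max (ys ! (m - 1)) x)"
        using Cons.IH[of m] Cons.prems Suc by simp
      have "y \<le> ys ! k" if "k < length ys" for k using Cons.prems that by auto
      then show ?thesis using False Suc IH Cons.prems
        by (cases m) (auto simp: min_def max_def)
    qed
  qed
qed simp

lemma measurable_sorted_values_nth:
  assumes "finite I" "l < card I" "I \<subseteq> J"
  shows "(\<lambda>x. sorted_values I x ! l) \<in> borel_measurable (\<Pi>\<^sub>M i\<in>J. borel)"
  using assms
proof (induction I arbitrary: l rule: finite_induct)
  case (insert i I)
  have sorted: "sorted (sorted_values I x)" for x by (simp add: sorted_values_def)
  have "(\<lambda>x. sorted_values (insert i I) x ! l) =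
    (\<lambda>x. if l < card I then (if l = 0 then min (x i) (sorted_values I x ! 0)
          else max (sorted_values I x ! (l - 1)) (min (x i) (sorted_values I x ! l)))
        else if l = 0 then x i else max (sorted_values I x ! (l - 1)) (x i))"
    using insert by (auto simp: fun_eq_iff sorted_values_insert nth_insort[OF sorted])
  moreover have [measurable]: "(\<lambda>x. x i) \<in> borel_measurable (\<Pi>\<^sub>M i\<in>J. borel)"
    using insert.prems by (intro measurable_component_singleton) auto
  moreover have "(\<lambda>x. sorted_values I x ! k) \<in> borel_measurable (\<Pi>\<^sub>M i\<in>J. borel)" if "k < card I" for k
    using that insert by auto
  ultimately show ?case
    using insert.hyps insert.prems by (cases "l < card I"; cases "l = 0") auto
qed simp

section \<open>Integration over the ordered region\<close>

primrec iterated_integral ::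
    "real measure \<Rightarrow> (nat \<Rightarrow> real \<Rightarrow> ennreal) \<Rightarrow> nat \<Rightarrow> nat \<Rightarrow> real \<Rightarrow> ennreal" where
  "iterated_integral D g 0 j u = 1"
| "iterated_integral D g (Suc n) j u =
     (\<integral>\<^sup>+t. indicator {u..} t * g j t * iterated_integral D g n (Suc j) t \<partial>D)"

definition sorted_product :: "(nat \<Rightarrow> real \<Rightarrow> ennreal) \<Rightarrow> nat \<Rightarrow> nat set \<Rightarrow> (nat \<Rightarrow> real) \<Rightarrow> ennreal" where
  "sorted_product g j I x = (\<Prod>l<card I. g (j + l) (sorted_values I x ! l))"

locale atomless_prob = prob_space D for D :: "real measure" +
  fixes g :: "nat \<Rightarrow> real \<Rightarrow> ennreal"
  assumes sets [measurable_cong]: "sets D = sets borel"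
    and atomless: "emeasure D {t} = 0"
    and g [measurable]: "g j \<in> borel_measurable borel"
begin

sublocale product_prob_space "\<lambda>_ :: nat. D" UNIV
  by standard

lemma measurable_iterated_integral [measurable]: "iterated_integral D g n j \<in> borel_measurable borel"
proof (induction n arbitrary: j)
  case (Suc n)
  note Suc[measurable]
  \<comment> \<open>The conditional exhibits the indicator of the moving set as jointly measurable
    in u and t.\<close>
  have "(\<lambda>u. \<integral>\<^sup>+t. (if u \<le> t then 1 else 0) * g j t * iterated_integral D g n (Suc j) t \<partial>D) \<in> borel_measurable borel"
    by measurable
  moreover have "(if u \<le> t then 1 else 0) = (indicator {u..} t :: ennreal)" for u t :: real
    by simp
  ultimately show ?case by simp
next
  case 0
  have "iterated_integral D g 0 j = (\<lambda>_. 1)" by (rule ext) simp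
  then show ?case by simp
qed

lemma measurable_sorted_product [measurable]:
  assumes "finite I"
  shows "sorted_product g j I \<in> borel_measurable (\<Pi>\<^sub>M i\<in>I. D)"
proof -
  have eq: "sets (\<Pi>\<^sub>M i\<in>I. D) = sets (\<Pi>\<^sub>M i\<in>I. borel)"
    by (intro sets_PiM_cong refl sets)
  have "(\<lambda>x. sorted_product g j I x) \<in> borel_measurable (\<Pi>\<^sub>M i\<in>I. borel)"
    unfolding sorted_product_def
    by (intro borel_measurable_prod_ennreal measurable_compose[OF measurable_sorted_values_nth g])
       (use assms in auto)
  then show ?thesis using measurable_cong_sets[OF eq refl] by auto
qed

lemma space_D [simp]: "space D = UNIV"
  using sets_eq_imp_space_eq[OF sets] by simp

lemma component_measurable:
  "i \<in> I \<Longrightarrow> (\<lambda>x. x i) \<in> borel_measurable (\<Pi>\<^sub>M i\<in>I. D)"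
  using measurable_component_singleton[of i I "\<lambda>_. D"] measurable_cong_sets[OF refl sets] by blast

text \<open>Integrating over the coordinate i first leaves the mass of the single point x m, which
  is 0.\<close>

lemma AE_distinct:
  fixes I :: "nat set"
  assumes "finite I" "i \<in> I" "m \<in> I" "i \<noteq> m"
  shows "AE x in \<Pi>\<^sub>M i\<in>I. D. x i \<noteq> x m"
proof -
  have I: "I = insert i (I - {i})" using assms by auto
  have [measurable]: "(\<lambda>x. x i) \<in> borel_measurable (\<Pi>\<^sub>M i\<in>I. D)" "(\<lambda>x. x m) \<in> borel_measurable (\<Pi>\<^sub>M i\<in>I. D)"
    using assms by (auto intro: component_measurable)
  have meas: "(\<lambda>x. if x i = x m then 1 else 0 :: ennreal) \<in> borel_measurable (\<Pi>\<^sub>M i\<in>insert i (I - {i}). D)"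
    unfolding I[symmetric] by measurable
  have "(\<integral>\<^sup>+x. (if x i = x m then 1 else 0) \<partial>(\<Pi>\<^sub>M i\<in>insert i (I - {i}). D))
      = (\<integral>\<^sup>+x. \<integral>\<^sup>+t. (if t = x m then 1 else 0) \<partial>D \<partial>(\<Pi>\<^sub>M i\<in>I - {i}. D))"
    using product_nn_integral_insert[OF _ _ meas] assms by simp
  also have "\<dots> = (\<integral>\<^sup>+x. \<integral>\<^sup>+t. indicator {x m} t \<partial>D \<partial>(\<Pi>\<^sub>M i\<in>I - {i}. D))"
    by (intro nn_integral_cong) (auto simp: indicator_def)
  also have "\<dots> = 0" by (simp add: atomless sets)
  finally show ?thesis
    unfolding I[symmetric] by (subst (asm) nn_integral_0_iff_AE) (auto elim: AE_mp)
qed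

text \<open>The recursion singles out the index of the smallest coordinate; almost surely there is
  exactly one.\<close>

lemma nn_integral_sorted_product:
  assumes "finite I"
  shows "(\<integral>\<^sup>+x. (\<Prod>i\<in>I. indicator {u..} (x i)) * sorted_product g j I x \<partial>(\<Pi>\<^sub>M i\<in>I. D))
       = fact (card I) * iterated_integral D g (card I) j u"
  using assms
proof (induction "card I" arbitrary: I j u)
  case 0
  then show ?case by (simp add: sorted_product_def PiM_empty nn_integral_count_space_finite)
next
  case (Suc n)
  define F where "F u j I x = (\<Prod>i\<in>I. indicator {u..} (x i)) * sorted_product g j I x"
    for u j and I :: "nat set" and x :: "nat \<Rightarrow> real"
  have F_meas: "F u j J \<in> borel_measurable (\<Pi>\<^sub>M i\<in>J. D)" if "finite J" for u j J
  proof -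
    have "(\<lambda>x. indicator {u..} (x i) :: ennreal) \<in> borel_measurable (\<Pi>\<^sub>M i\<in>J. D)" if "i \<in> J" for i
      using that by (intro measurable_compose[OF component_measurable]) auto
    then show ?thesis
      unfolding F_def using that
      by (intro borel_measurable_times_ennreal borel_measurable_prod_ennreal measurable_sorted_product) auto
  qed
  \<comment> \<open>The contribution of i as index of the minimum: the other coordinates are bounded
    below by x i, and their factors start one rank higher.\<close>
  define H where "H i x = indicator {u..} (x i) * g j (x i) * F (x i) (Suc j) (I - {i}) x" for i x
  have ties: "AE x in \<Pi>\<^sub>M i\<in>I. D. \<forall>i\<in>I. \<forall>m\<in>I - {i}. x i \<noteq> x m"
    using Suc.prems by (intro AE_finite_allI AE_distinct) auto
  have H_eq: "H i x = (if \<forall>m\<in>I. x i \<le> x m then F u j I x else 0)" if i: "i \<in> I" for i x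
  proof (cases "\<forall>m\<in>I. x i \<le> x m")
    case True
    have "sorted_values I x = x i # sorted_values (I - {i}) x"
      using True Suc.prems i by (intro sorted_values_remove_min) auto
    moreover have "card I = Suc (card (I - {i}))"
      using Suc.prems i by (metis card_Suc_Diff1)
    ultimately have "sorted_product g j I x = g j (x i) * sorted_product g (Suc j) (I - {i}) x"
      unfolding sorted_product_def by (simp only: prod.lessThan_Suc_shift) simp
    moreover have "(\<Prod>m\<in>I. indicator {u..} (x m) :: ennreal) = indicator {u..} (x i) * (\<Prod>m\<in>I - {i}. indicator {x i..} (x m))"
    proof (cases "u \<le> x i")
      case u: True
      then show ?thesis using True
        by (subst (1 2) prod.neutral) (auto intro: order_trans)
    next
      case False
      then show ?thesis using Suc.prems i by (simp add: prod.remove)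
    qed
    ultimately show ?thesis using True by (simp add: H_def F_def mult_ac)
  next
    case False
    then obtain m where "m \<in> I" "\<not> x i \<le> x m" by auto
    then have "(\<Prod>m\<in>I - {i}. indicator {x i..} (x m) :: ennreal) = 0"
      using Suc.prems i by (intro prod_zero bexI[of _ m]) auto
    then have "H i x = 0" by (simp add: H_def F_def)
    then show ?thesis unfolding if_not_P[OF False] .
  qed
  have H_meas: "H i \<in> borel_measurable (\<Pi>\<^sub>M i\<in>I. D)" if i: "i \<in> I" for i
  proof -
    have "(\<lambda>x. if \<forall>m\<in>I. x i \<le> x m then F u j I x else 0) \<in> borel_measurable (\<Pi>\<^sub>M i\<in>I. D)"
    proof (intro measurable_If F_meas Suc.prems)
      show "{x \<in> space (\<Pi>\<^sub>M i\<in>I. D). \<forall>m\<in>I. x i \<le> x m} \<in> sets (\<Pi>\<^sub>M i\<in>I. D)"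
        by (intro sets.sets_Collect_finite_All borel_measurable_le component_measurable i Suc.prems)
    qed simp
    moreover have "H i = (\<lambda>x. if \<forall>m\<in>I. x i \<le> x m then F u j I x else 0)"
      by (rule ext) (rule H_eq[OF i])
    ultimately show ?thesis by (simp only:)
  qed
  \<comment> \<open>Without ties exactly one index carries the minimum, so exactly one summand can
    be nonzero.\<close>
  have "AE x in \<Pi>\<^sub>M i\<in>I. D. F u j I x = (\<Sum>i\<in>I. H i x)"
    using ties
  proof eventually_elim
    case (elim x)
    have "I \<noteq> {}" using Suc by auto
    then have "Min (x ` I) \<in> x ` I" using Suc.prems by (intro Min_in) auto
    then obtain i where i: "i \<in> I" "x i = Min (x ` I)" by auto
    then have min: "\<forall>m\<in>I. x i \<le> x m" using Suc.prems by simp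
    have "(\<Sum>k\<in>I. H k x) = (\<Sum>k\<in>I. if k = i then F u j I x else 0)"
    proof (intro sum.cong refl)
      fix k assume k: "k \<in> I"
      show "H k x = (if k = i then F u j I x else 0)"
      proof (cases "k = i")
        case False
        then have "x i < x k" using elim i k min by (metis DiffI insertE emptyE order_le_less)
        then have "\<not> (\<forall>m\<in>I. x k \<le> x m)" using i(1) by (meson not_le)
        then have "H k x = 0" unfolding H_eq[OF k] by (simp only: if_False)
        then show ?thesis using False by simp
      qed (use min H_eq[OF i(1)] in simp)
    qed
    then show ?case using i Suc.prems by simp
  qed
  then have "(\<integral>\<^sup>+x. F u j I x \<partial>(\<Pi>\<^sub>M i\<in>I. D)) = (\<integral>\<^sup>+x. (\<Sum>i\<in>I. H i x) \<partial>(\<Pi>\<^sub>M i\<in>I. D))"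
    by (rule nn_integral_cong_AE)
  also have "\<dots> = (\<Sum>i\<in>I. \<integral>\<^sup>+x. H i x \<partial>(\<Pi>\<^sub>M i\<in>I. D))"
    by (rule nn_integral_sum) (rule H_meas)
  also have "\<dots> = (\<Sum>i\<in>I. fact n * iterated_integral D g (card I) j u)"
  proof (intro sum.cong refl)
    fix i assume i: "i \<in> I"
    have I: "I = insert i (I - {i})" using i by auto
    have card: "n = card (I - {i})" using Suc.hyps(2) Suc.prems i by simp
    have "H i \<in> borel_measurable (\<Pi>\<^sub>M i\<in>insert i (I - {i}). D)"
      using H_meas[OF i] I by (simp only:)
    then have "(\<integral>\<^sup>+x. H i x \<partial>(\<Pi>\<^sub>M i\<in>I. D)) = (\<integral>\<^sup>+t. \<integral>\<^sup>+x. H i (x(i := t)) \<partial>(\<Pi>\<^sub>M i\<in>I - {i}. D) \<partial>D)"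
      using product_nn_integral_insert_rev[of "I - {i}" i "H i"] Suc.prems I by simp
    also have "\<dots> = (\<integral>\<^sup>+t. indicator {u..} t * g j t * (\<integral>\<^sup>+x. F t (Suc j) (I - {i}) x \<partial>(\<Pi>\<^sub>M i\<in>I - {i}. D)) \<partial>D)"
    proof (intro nn_integral_cong)
      fix t
      have "F t (Suc j) (I - {i}) (x(i := t)) = F t (Suc j) (I - {i}) x" for x
      proof -
        have "sorted_values (I - {i}) (x(i := t)) = sorted_values (I - {i}) x"
          by (rule sorted_values_cong) auto
        moreover have "(\<Prod>m\<in>I - {i}. indicator {t..} ((x(i := t)) m) :: ennreal) = (\<Prod>m\<in>I - {i}. indicator {t..} (x m))"
          by (intro prod.cong) auto
        ultimately show ?thesis by (simp only: F_def sorted_product_def)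
      qed
      then show "(\<integral>\<^sup>+x. H i (x(i := t)) \<partial>(\<Pi>\<^sub>M i\<in>I - {i}. D))
          = indicator {u..} t * g j t * (\<integral>\<^sup>+x. F t (Suc j) (I - {i}) x \<partial>(\<Pi>\<^sub>M i\<in>I - {i}. D))"
        using F_meas[of "I - {i}"] Suc.prems by (simp add: H_def nn_integral_cmult)
    qed
    also have "\<dots> = (\<integral>\<^sup>+t. fact n * (indicator {u..} t * g j t * iterated_integral D g n (Suc j) t) \<partial>D)"
      using Suc.hyps(1)[OF card] Suc.prems card[symmetric] by (simp add: F_def mult_ac)
    also have "\<dots> = fact n * iterated_integral D g (card I) j u"
      unfolding Suc.hyps(2)[symmetric] by (simp add: nn_integral_cmult)
    finally show "(\<integral>\<^sup>+x. H i x \<partial>(\<Pi>\<^sub>M i\<in>I. D)) = fact n * iterated_integral D g (card I) j u" .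
  qed
  \<comment> \<open>There are \<open>card I = Suc n\<close> equal summands, which completes the
    factorial.\<close>
  also have "\<dots> = fact (card I) * iterated_integral D g (card I) j u"
    unfolding Suc.hyps(2)[symmetric] using Suc.hyps(2)[symmetric]
    by (simp add: mult_ac del: iterated_integral.simps)
  finally show ?case by (simp add: F_def)
qed

end

section \<open>The density of every \<open>d\<close>-th order statistic\<close>

text \<open>The ordered integral with Lebesgue measure below b, so that the normalisation of the
  uniform law can be split off as an explicit power.\<close>

primrec simplex_integral ::
    "real \<Rightarrow> (nat \<Rightarrow> real \<Rightarrow> ennreal) \<Rightarrow> nat \<Rightarrow> nat \<Rightarrow> real \<Rightarrow> ennreal" where
  "simplex_integral b g 0 j u = 1"
| "simplex_integral b g (Suc n) j u =
     (\<integral>\<^sup>+t. indicator {u..b} t * (g j t * simplex_integral b g n (Suc j) t) \<partial>lborel)"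

lemma measurable_simplex_integral [measurable]:
  assumes [measurable]: "\<And>j. g j \<in> borel_measurable borel"
  shows "simplex_integral b g n j \<in> borel_measurable borel"
proof (induction n arbitrary: j)
  case 0
  have "simplex_integral b g 0 j = (\<lambda>_. 1)" by (rule ext) simp
  then show ?case by simp
next
  case (Suc n)
  note Suc[measurable]
  have "(\<lambda>u. \<integral>\<^sup>+t. (if u \<le> t \<and> t \<le> b then 1 else 0) * (g j t * simplex_integral b g n (Suc j) t) \<partial>lborel)
      \<in> borel_measurable borel"
    by measurable
  moreover have "(if u \<le> t \<and> t \<le> b then 1 else 0) = (indicator {u..b} t :: ennreal)" for u t :: real
    by simp
  ultimately show ?case by simp
qed

lemma atomless_prob_uniform:
  assumes "a < b" "\<And>j. g j \<in> borel_measurable borel"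
  shows "atomless_prob (uniform_measure lborel {a<..<b}) g"
proof (intro atomless_prob.intro atomless_prob_axioms.intro assms)
  show "prob_space (uniform_measure lborel {a<..<b})"
    using assms by (intro prob_space_uniform_measure) auto
  fix t :: real
  have "emeasure lborel ({a<..<b} \<inter> {t}) = 0"
    by (rule emeasure_eq_0[of "{t}" lborel]) auto
  then show "emeasure (uniform_measure lborel {a<..<b}) {t} = 0" by simp
qed simp

lemma iterated_integral_uniform:
  assumes ab: "a < b" and g [measurable]: "\<And>j. g j \<in> borel_measurable borel" and u: "a \<le> u"
  shows "iterated_integral (uniform_measure lborel {a<..<b}) g n j u
       = ennreal (1 / (b - a)) ^ n * simplex_integral b g n j u"
  using u
proof (induction n arbitrary: j u)
  case (Suc n)
  interpret atomless_prob "uniform_measure lborel {a<..<b}" g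
    by (rule atomless_prob_uniform[OF ab g])
  let ?I = "\<lambda>t. indicator {u..} t * g j t * iterated_integral (uniform_measure lborel {a<..<b}) g n (Suc j) t"
  \<comment> \<open>The uniform law lives on the open interval, the simplex on closed ones; the
    endpoints are null sets.\<close>
  have "AE t in lborel. ?I t * indicator {a<..<b} t =
      ennreal (1 / (b - a)) ^ n * (indicator {u..b} t * (g j t * simplex_integral b g n (Suc j) t))"
    using AE_lborel_singleton[of a] AE_lborel_singleton[of b]
  proof eventually_elim
    case (elim t)
    then show ?case using Suc.prems Suc.IH[of t "Suc j"] by (auto simp: indicator_def mult_ac)
  qed
  then have "(\<integral>\<^sup>+t. ?I t * indicator {a<..<b} t \<partial>lborel)
      = (\<integral>\<^sup>+t. ennreal (1 / (b - a)) ^ n * (indicator {u..b} t * (g j t * simplex_integral b g n (Suc j) t)) \<partial>lborel)"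
    by (rule nn_integral_cong_AE)
  also have "\<dots> = ennreal (1 / (b - a)) ^ n * simplex_integral b g (Suc n) j u"
    by (simp add: nn_integral_cmult)
  finally have eq: "(\<integral>\<^sup>+t. ?I t * indicator {a<..<b} t \<partial>lborel) = ennreal (1 / (b - a)) ^ n * simplex_integral b g (Suc n) j u" .
  have "?I \<in> borel_measurable lborel" by measurable
  then have "iterated_integral (uniform_measure lborel {a<..<b}) g (Suc n) j u
      = (\<integral>\<^sup>+t. ?I t * indicator {a<..<b} t \<partial>lborel) / ennreal (b - a)"
    using ab by (simp add: nn_integral_uniform_measure)
  also have "\<dots> = ennreal (1 / (b - a)) * (\<integral>\<^sup>+t. ?I t * indicator {a<..<b} t \<partial>lborel)"
    using ab by (simp add: divide_ennreal_def inverse_ennreal inverse_eq_divide mult.commute)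
  finally show ?case unfolding eq by (simp add: mult_ac)
qed simp

lemma nn_integral_power_Icc:
  fixes u t :: real
  assumes "u \<le> t"
  shows "(\<integral>\<^sup>+v. indicator {u..t} v * ennreal ((t - v) ^ k / fact k) \<partial>lborel) = ennreal ((t - u) ^ Suc k / fact (Suc k))"
proof -
  have "(\<integral>\<^sup>+v. ennreal ((t - v) ^ k / fact k) * indicator {u..t} v \<partial>lborel)
      = ennreal (- ((t - t) ^ Suc k / fact (Suc k)) - - ((t - u) ^ Suc k / fact (Suc k)))"
  proof (rule nn_integral_FTC_Icc[where F = "\<lambda>v. - ((t - v) ^ Suc k / fact (Suc k))"])
    fix v assume "v \<in> {u..t}"
    have "((\<lambda>v. - ((t - v) ^ Suc k / fact (Suc k))) has_real_derivative - ((real (Suc k) * (t - v) ^ k * (0 - 1)) / fact (Suc k))) (at v)"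
      by (auto intro!: derivative_eq_intros simp del: fact_Suc power_Suc)
    then show "((\<lambda>v. - ((t - v) ^ Suc k / fact (Suc k))) has_real_derivative (t - v) ^ k / fact k) (at v)"
      by (simp del: of_nat_Suc)
  qed (use assms in auto)
  then show ?thesis by (simp add: mult.commute del: fact_Suc)
qed

text \<open>The k variables without a factor are ordered between u and the next variable t; their
  simplex has volume (t - u) ^ k / k!. This is where the powers of gaps come from.\<close>

lemma simplex_integral_integrate_out:
  assumes g [measurable]: "\<And>j. g j \<in> borel_measurable borel"
    and one: "\<And>i. j \<le> i \<Longrightarrow> i < j + k \<Longrightarrow> g i = (\<lambda>_. 1)"
  shows "simplex_integral b g (Suc (k + n)) j u =
    (\<integral>\<^sup>+t. indicator {u..b} t * (ennreal ((t - u) ^ k / fact k) *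
       (g (j + k) t * simplex_integral b g n (Suc (j + k)) t)) \<partial>lborel)"
  using one
proof (induction k arbitrary: j u)
  case (Suc k)
  let ?h = "\<lambda>t. g (Suc j + k) t * simplex_integral b g n (Suc (Suc j + k)) t"
  have IH: "simplex_integral b g (Suc (k + n)) (Suc j) v =
    (\<integral>\<^sup>+t. indicator {v..b} t * (ennreal ((t - v) ^ k / fact k) * ?h t) \<partial>lborel)" for v
    by (rule Suc.IH) (use Suc.prems in auto)
  have "g j = (\<lambda>_. 1)" by (rule Suc.prems) auto
  then have "simplex_integral b g (Suc (Suc k + n)) j u =
    (\<integral>\<^sup>+v. indicator {u..b} v * (\<integral>\<^sup>+t. indicator {v..b} t * (ennreal ((t - v) ^ k / fact k) * ?h t) \<partial>lborel) \<partial>lborel)"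
    using IH by (subst simplex_integral.simps(2)) simp
  also have "\<dots> = (\<integral>\<^sup>+v. \<integral>\<^sup>+t. indicator {u..b} v * (indicator {v..b} t * (ennreal ((t - v) ^ k / fact k) * ?h t)) \<partial>lborel \<partial>lborel)"
    by (intro nn_integral_cong nn_integral_cmult[symmetric]) measurable
  \<comment> \<open>v is the lowest unmarked variable; as inner variable it ranges over [u, t] and
    raises the exponent by one.\<close>
  also have "\<dots> = (\<integral>\<^sup>+t. \<integral>\<^sup>+v. indicator {u..b} v * (indicator {v..b} t * (ennreal ((t - v) ^ k / fact k) * ?h t)) \<partial>lborel \<partial>lborel)"
  proof (rule lborel_pair.Fubini'[symmetric])
    have "(\<lambda>(v, t). (if u \<le> v \<and> v \<le> b then 1 else 0) * ((if v \<le> t \<and> t \<le> b then 1 else 0) * (ennreal ((t - v) ^ k / fact k) * ?h t)))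
        \<in> borel_measurable (lborel \<Otimes>\<^sub>M lborel)"
      by measurable
    moreover have "(if u \<le> t \<and> t \<le> b then 1 else 0) = (indicator {u..b} t :: ennreal)" for u t :: real
      by simp
    ultimately show "(\<lambda>(v, t). indicator {u..b} v * (indicator {v..b} t * (ennreal ((t - v) ^ k / fact k) * ?h t)))
        \<in> borel_measurable (lborel \<Otimes>\<^sub>M lborel)"
      by simp
  qed
  also have "\<dots> = (\<integral>\<^sup>+t. indicator {u..b} t * (ennreal ((t - u) ^ Suc k / fact (Suc k)) * ?h t) \<partial>lborel)"
  proof (intro nn_integral_cong)
    fix t
    have "(\<integral>\<^sup>+v. indicator {u..b} v * (indicator {v..b} t * (ennreal ((t - v) ^ k / fact k) * ?h t)) \<partial>lborel)
        = (\<integral>\<^sup>+v. (indicator {u..b} t * ?h t) * (indicator {u..t} v * ennreal ((t - v) ^ k / fact k)) \<partial>lborel)"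
      by (intro nn_integral_cong) (auto simp: indicator_def mult_ac)
    also have "\<dots> = (indicator {u..b} t * ?h t) * (\<integral>\<^sup>+v. indicator {u..t} v * ennreal ((t - v) ^ k / fact k) \<partial>lborel)"
      by (rule nn_integral_cmult) measurable
    also have "\<dots> = indicator {u..b} t * (ennreal ((t - u) ^ Suc k / fact (Suc k)) * ?h t)"
    proof (cases "u \<le> t")
      case True
      then show ?thesis by (simp add: nn_integral_power_Icc mult_ac del: fact_Suc power_Suc)
    qed simp
    finally show "(\<integral>\<^sup>+v. indicator {u..b} v * (indicator {v..b} t * (ennreal ((t - v) ^ k / fact k) * ?h t)) \<partial>lborel)
      = indicator {u..b} t * (ennreal ((t - u) ^ Suc k / fact (Suc k)) * ?h t)" .
  qed
  finally show ?case by simp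
qed simp

text \<open>The block above the last marked variable: the endpoint b takes the place of the next
  marked one.\<close>

lemma simplex_integral_one:
  assumes g: "\<And>j. g j \<in> borel_measurable borel" and u: "u \<le> b"
    and one: "\<And>i. j \<le> i \<Longrightarrow> i < j + k \<Longrightarrow> g i = (\<lambda>_. 1)"
  shows "simplex_integral b g k j u = ennreal ((b - u) ^ k / fact k)"
proof (cases k)
  case (Suc m)
  have "simplex_integral b g (Suc (m + 0)) j u =
    (\<integral>\<^sup>+t. indicator {u..b} t * (ennreal ((t - u) ^ m / fact m) * (g (j + m) t * simplex_integral b g 0 (Suc (j + m)) t)) \<partial>lborel)"
    by (rule simplex_integral_integrate_out[OF g]) (use one Suc in auto)
  also have "g (j + m) = (\<lambda>_. 1)" by (rule one) (use Suc in auto)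
  finally have "simplex_integral b g k j u = (\<integral>\<^sup>+t. ennreal ((t - u) ^ m / fact m) * indicator {u..b} t \<partial>lborel)"
    using Suc by (simp add: mult.commute)
  also have "\<dots> = ennreal ((b - u) ^ Suc m / fact (Suc m) - (u - u) ^ Suc m / fact (Suc m))"
  proof (rule nn_integral_FTC_Icc[where F = "\<lambda>v. (v - u) ^ Suc m / fact (Suc m)"])
    fix v
    have "((\<lambda>v. (v - u) ^ Suc m / fact (Suc m)) has_real_derivative (real (Suc m) * (v - u) ^ m * (1 - 0)) / fact (Suc m)) (at v)"
      by (auto intro!: derivative_eq_intros simp del: fact_Suc power_Suc)
    then show "((\<lambda>v. (v - u) ^ Suc m / fact (Suc m)) has_real_derivative (v - u) ^ m / fact m) (at v)"
      by (simp del: of_nat_Suc)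
  qed (use u in auto)
  finally show ?thesis using Suc by (simp del: fact_Suc)
qed simp

section \<open>Densities built from gaps\<close>

text \<open>Cutting \<open>gap\<close> off outside \<open>a \<le> u \<le> v \<le> b\<close> makes a product of gaps a density on all of
  \<open>\<real>\<^sup>N\<close>.\<close>

definition gap :: "nat \<Rightarrow> real \<Rightarrow> real \<Rightarrow> real \<Rightarrow> real \<Rightarrow> real" where
  "gap d a b u v = (if a \<le> u \<and> u \<le> v \<and> v \<le> b then (v - u) ^ (d - 1) else 0)"

lemma gap_nonneg [simp]: "0 \<le> gap d a b u v"
  by (simp add: gap_def)

lemma borel_measurable_gap [measurable (raw)]:
  assumes [measurable]: "f \<in> borel_measurable M" "h \<in> borel_measurable M"
  shows "(\<lambda>x. gap d a b (f x) (h x)) \<in> borel_measurable M"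
  unfolding gap_def by measurable

text \<open>The integral over the marked variables alone: r of them lie above u and carry the
  factors G (k + 1), ..., G (k + r).\<close>

primrec chain_integral ::
    "nat \<Rightarrow> real \<Rightarrow> real \<Rightarrow> (nat \<Rightarrow> real \<Rightarrow> ennreal) \<Rightarrow> nat \<Rightarrow> nat \<Rightarrow> real \<Rightarrow> ennreal" where
  "chain_integral d a b G 0 k u = ennreal (gap d a b u b)"
| "chain_integral d a b G (Suc r) k u =
     (\<integral>\<^sup>+t. ennreal (gap d a b u t) * (G (Suc k) t * chain_integral d a b G r (Suc k) t) \<partial>lborel)"

lemma measurable_chain_integral [measurable]:
  assumes [measurable]: "\<And>j. G j \<in> borel_measurable borel"
  shows "chain_integral d a b G r k \<in> borel_measurable borel"
proof (induction r arbitrary: k)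
  case 0
  have "chain_integral d a b G 0 k = (\<lambda>u. ennreal (gap d a b u b))" by (rule ext) simp
  then show ?case by simp
next
  case (Suc r)
  note Suc[measurable]
  have "(\<lambda>u. \<integral>\<^sup>+t. ennreal (gap d a b u t) * (G (Suc k) t * chain_integral d a b G r (Suc k) t) \<partial>lborel)
      \<in> borel_measurable borel"
    by measurable
  then show ?case by simp
qed

text \<open>Marking every d-th of d (r + 1) - 1 ordered variables leaves r + 1 blocks of d - 1
  unmarked ones, each worth a gap power over (d - 1)!. Ranks start at 0, so rank j is marked when d
  divides j + 1.\<close>

lemma simplex_integral_eq_chain_integral:
  assumes d: "1 \<le> d" and G: "\<And>j. G j \<in> borel_measurable borel" and u: "a \<le> u" "u \<le> b"
  defines "g \<equiv> \<lambda>j. if d dvd Suc j then G (Suc j div d) else (\<lambda>_. 1)"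
  shows "simplex_integral b g (d * Suc r - 1) (d * k) u =
    ennreal (1 / fact (d - 1)) ^ Suc r * chain_integral d a b G r k u"
proof -
  have g: "g j \<in> borel_measurable borel" for j using G by (auto simp: g_def)
  have one: "g i = (\<lambda>_. 1)" if "d * k \<le> i" "i < d * k + (d - 1)" for i k
  proof -
    have "\<not> d dvd Suc i"
    proof
      assume "d dvd Suc i"
      then obtain m where m: "Suc i = d * m" by auto
      have "d * k < Suc i" "Suc i < d * Suc k" using that d by auto
      then have "d * k < d * m" "d * m < d * Suc k" unfolding m .
      then have "k < m" "m < Suc k" unfolding mult_less_cancel1 by auto
      then show False by simp
    qed
    then show ?thesis by (simp add: g_def)
  qed
  show ?thesis
    using u
  proof (induction r arbitrary: k u)
    case 0
    then show ?case
      using simplex_integral_one[OF g, of u b "d * k" "d - 1"] one[of k]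
      by (simp add: gap_def ennreal_mult[symmetric])
  next
    case (Suc r)
    \<comment> \<open>One block of d - 1 unmarked variables, one marked variable, then the
      rest.\<close>
    have len: "d * Suc (Suc r) - 1 = Suc ((d - 1) + (d * Suc r - 1))"
      using d by (cases d) auto
    have at: "Suc (d * k + (d - 1)) = d * Suc k" using d by simp
    then have gG: "g (d * k + (d - 1)) = G (Suc k)" using d by (simp add: g_def)
    have "simplex_integral b g (d * Suc (Suc r) - 1) (d * k) u =
      (\<integral>\<^sup>+t. indicator {u..b} t * (ennreal ((t - u) ^ (d - 1) / fact (d - 1)) *
         (G (Suc k) t * simplex_integral b g (d * Suc r - 1) (d * Suc k) t)) \<partial>lborel)"
      unfolding len
      by (subst simplex_integral_integrate_out[OF g]) (use one in \<open>auto simp only: gG at\<close>)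
    also have "\<dots> = (\<integral>\<^sup>+t. ennreal (1 / fact (d - 1)) ^ Suc (Suc r) *
         (ennreal (gap d a b u t) * (G (Suc k) t * chain_integral d a b G r (Suc k) t)) \<partial>lborel)"
    proof (intro nn_integral_cong)
      fix t
      show "indicator {u..b} t * (ennreal ((t - u) ^ (d - 1) / fact (d - 1)) *
         (G (Suc k) t * simplex_integral b g (d * Suc r - 1) (d * Suc k) t)) =
         ennreal (1 / fact (d - 1)) ^ Suc (Suc r) *
         (ennreal (gap d a b u t) * (G (Suc k) t * chain_integral d a b G r (Suc k) t))"
      proof (cases "t \<in> {u..b}")
        case True
        then have "ennreal ((t - u) ^ (d - 1) / fact (d - 1)) = ennreal (1 / fact (d - 1)) * ennreal (gap d a b u t)"
          using Suc.prems by (simp add: gap_def ennreal_mult[symmetric])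
        then show ?thesis using True Suc.IH[of t "Suc k"] Suc.prems by (simp add: mult_ac)
      qed (auto simp: gap_def)
    qed
    also have "\<dots> = ennreal (1 / fact (d - 1)) ^ Suc (Suc r) * chain_integral d a b G (Suc r) k u"
    proof -
      note G[measurable]
      show ?thesis by (subst nn_integral_cmult) auto
    qed
    finally show ?case .
  qed
qed

text \<open>Storing u at position k lets the first gap be written like all the others.\<close>

lemma chain_integral_eq_PiM:
  assumes G [measurable]: "\<And>j. G j \<in> borel_measurable borel"
  shows "chain_integral d a b G r k u =
    (\<integral>\<^sup>+x. (\<Prod>i\<in>{k<..k+r}. ennreal (gap d a b ((x(k := u)) (i - 1)) (x i)) * G i (x i)) *
        ennreal (gap d a b ((x(k := u)) (k + r)) b) \<partial>(\<Pi>\<^sub>M i\<in>{k<..k+r}. lborel))"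
proof (induction r arbitrary: k u)
  case 0
  then show ?case by (simp add: PiM_empty nn_integral_count_space_finite)
next
  case (Suc r)
  interpret product_sigma_finite "\<lambda>_ :: nat. lborel :: real measure" by standard
  define F where "F r k u x = (\<Prod>i\<in>{k<..k+r}. ennreal (gap d a b ((x(k := u)) (i - 1)) (x i)) * G i (x i)) *
        ennreal (gap d a b ((x(k := u)) (k + r)) b)" for r k u and x :: "nat \<Rightarrow> real"
  have F_meas: "F r k u \<in> borel_measurable (\<Pi>\<^sub>M i\<in>{k<..k+r}. lborel)" for r k u
  proof -
    have comp [measurable]: "(\<lambda>x. x i) \<in> borel_measurable (\<Pi>\<^sub>M i\<in>{k<..k+r}. lborel)" if "i \<in> {k<..k+r}" for i
      using measurable_component_singleton[OF that, of "\<lambda>_. lborel"] by simp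
    have comp': "(\<lambda>x. (x(k := u)) i) \<in> borel_measurable (\<Pi>\<^sub>M i\<in>{k<..k+r}. lborel)" if "i \<in> {k..k+r}" for i
      using that comp[of i] by (cases "i = k") auto
    show ?thesis
      unfolding F_def
      by (intro borel_measurable_times_ennreal borel_measurable_prod_ennreal measurable_compose[OF comp G]
          measurable_compose[OF _ measurable_ennreal] borel_measurable_gap comp comp') auto
  qed
  have set: "{k<..k + Suc r} = insert (Suc k) {Suc k<..Suc k + r}" by auto
  have "(\<integral>\<^sup>+x. F (Suc r) k u x \<partial>(\<Pi>\<^sub>M i\<in>{k<..k + Suc r}. lborel))
      = (\<integral>\<^sup>+t. \<integral>\<^sup>+x. F (Suc r) k u (x(Suc k := t)) \<partial>(\<Pi>\<^sub>M i\<in>{Suc k<..Suc k + r}. lborel) \<partial>lborel)"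
    using product_nn_integral_insert_rev[of "{Suc k<..Suc k + r}" "Suc k" "F (Suc r) k u"] F_meas[of "Suc r" k u]
    unfolding set by simp
  also have "\<dots> = (\<integral>\<^sup>+t. \<integral>\<^sup>+x. ennreal (gap d a b u t) * G (Suc k) t * F r (Suc k) t x \<partial>(\<Pi>\<^sub>M i\<in>{Suc k<..Suc k + r}. lborel) \<partial>lborel)"
  proof (intro nn_integral_cong)
    fix t and x :: "nat \<Rightarrow> real"
    let ?y = "x(Suc k := t)"
    have "(\<Prod>i\<in>{Suc k<..Suc k + r}. ennreal (gap d a b ((?y(k := u)) (i - 1)) (?y i)) * G i (?y i))
        = (\<Prod>i\<in>{Suc k<..Suc k + r}. ennreal (gap d a b (?y (i - 1)) (x i)) * G i (x i))"
      by (intro prod.cong) auto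
    moreover have "(?y(k := u)) (k + Suc r) = ?y (Suc k + r)" by auto
    ultimately show "F (Suc r) k u ?y = ennreal (gap d a b u t) * G (Suc k) t * F r (Suc k) t x"
      unfolding F_def set by (simp add: mult_ac)
  qed
  also have "\<dots> = (\<integral>\<^sup>+t. ennreal (gap d a b u t) * G (Suc k) t * (\<integral>\<^sup>+x. F r (Suc k) t x \<partial>(\<Pi>\<^sub>M i\<in>{Suc k<..Suc k + r}. lborel)) \<partial>lborel)"
    by (intro nn_integral_cong nn_integral_cmult F_meas)
  also have "\<dots> = chain_integral d a b G (Suc r) k u"
    using Suc.IH[of "Suc k"] by (simp add: F_def mult.assoc)
  finally show ?case by (simp only: F_def)
qed

text \<open>A crude bound, needed to pass from [0, \<infinity>] to the real integral of the explicit
  formula.\<close>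

lemma chain_integral_finite:
  assumes ab: "a \<le> b" and G: "\<And>j t. a \<le> t \<Longrightarrow> t \<le> b \<Longrightarrow> G j t \<le> 1"
  shows "chain_integral d a b G r k u < \<infinity>"
proof -
  have gap: "gap d a b u v \<le> (b - a) ^ (d - 1)" for u v
    by (auto simp: gap_def ab intro!: power_mono)
  have "chain_integral d a b G r k u \<le> ennreal (((b - a) ^ (d - 1)) ^ Suc r * (b - a) ^ r)"
  proof (induction r arbitrary: k u)
    case 0
    then show ?case using gap by (auto intro!: ennreal_leI)
  next
    case (Suc r)
    have "chain_integral d a b G (Suc r) k u \<le>
      (\<integral>\<^sup>+t. ennreal ((b - a) ^ (d - 1)) * ennreal (((b - a) ^ (d - 1)) ^ Suc r * (b - a) ^ r) * indicator {a..b} t \<partial>lborel)"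
      unfolding chain_integral.simps
    proof (intro nn_integral_mono)
      fix t
      show "ennreal (gap d a b u t) * (G (Suc k) t * chain_integral d a b G r (Suc k) t)
        \<le> ennreal ((b - a) ^ (d - 1)) * ennreal (((b - a) ^ (d - 1)) ^ Suc r * (b - a) ^ r) * indicator {a..b} t"
      proof (cases "t \<in> {a..b}")
        case True
        then have "G (Suc k) t * chain_integral d a b G r (Suc k) t
            \<le> 1 * ennreal (((b - a) ^ (d - 1)) ^ Suc r * (b - a) ^ r)"
          using Suc.IH[of "Suc k" t] G[of t "Suc k"] by (intro mult_mono) auto
        then show ?thesis using True gap[of u t] by (auto intro!: mult_mono ennreal_leI)
      qed (auto simp: gap_def)
    qed
    also have "\<dots> = ennreal (((b - a) ^ (d - 1)) ^ Suc (Suc r) * (b - a) ^ Suc r)"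
      using ab by (subst nn_integral_cmult_indicator) (auto simp: ennreal_mult[symmetric] mult_ac)
    finally show ?case .
  qed
  then show ?thesis by (rule le_less_trans) simp
qed

section \<open>The real iterated integral of the explicit formula\<close>

lemma nested_integral_cmult:
  "nested_integral n a b (\<lambda>\<theta>s. c * F \<theta>s) = c * nested_integral n a b F"
  by (induction n arbitrary: a F) simp_all

text \<open>The list puts the boundary values u and b at positions 0 and r + 1. Letting u and the
  offset k vary makes the family closed under peeling off the first variable.\<close>

definition simplex_weight ::
    "nat \<Rightarrow> (nat \<Rightarrow> real \<Rightarrow> real) \<Rightarrow> nat \<Rightarrow> nat \<Rightarrow> real \<Rightarrow> real \<Rightarrow> real list \<Rightarrow> real" where
  "simplex_weight d H r k u b \<theta>s =
     (\<Prod>i=1..r+1. ((u # \<theta>s @ [b]) ! i - (u # \<theta>s @ [b]) ! (i - 1)) ^ (d - 1)) *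
     (\<Prod>i=1..r. H (k + i) ((u # \<theta>s @ [b]) ! i))"

lemma simplex_weight_Cons:
  "simplex_weight d H (Suc r) k u b (x # \<theta>s) =
     ((x - u) ^ (d - 1) * H (Suc k) x) * simplex_weight d H r (Suc k) x b \<theta>s"
proof -
  have shift: "(\<Prod>i=1..Suc m. f i) = f 1 * (\<Prod>i=1..m. f (Suc i))" for m and f :: "nat \<Rightarrow> real"
    by (simp add: prod.atLeast_Suc_atMost prod.atLeast_Suc_atMost_Suc_shift del: prod.cl_ivl_Suc)
  have "(\<Prod>i=1..r+1. ((u # x # \<theta>s @ [b]) ! Suc i - (u # x # \<theta>s @ [b]) ! (Suc i - 1)) ^ (d - 1)) =
        (\<Prod>i=1..r+1. ((x # \<theta>s @ [b]) ! i - (x # \<theta>s @ [b]) ! (i - 1)) ^ (d - 1))"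
    by (intro prod.cong) (auto simp: nth_Cons')
  moreover have "(\<Prod>i=1..r. H (k + Suc i) ((u # x # \<theta>s @ [b]) ! Suc i)) = (\<Prod>i=1..r. H (Suc k + i) ((x # \<theta>s @ [b]) ! i))"
    by (intro prod.cong) auto
  ultimately show ?thesis
    unfolding simplex_weight_def Suc_eq_plus1[symmetric] shift append_Cons
    by (simp only: shift) simp
qed

text \<open>All factors are nonnegative and every inner integral is finite, so
  \<open>enn2real\<close> can be moved through one integration at a time.\<close>

lemma nested_integral_eq_chain_integral:
  assumes H [measurable]: "\<And>j. H j \<in> borel_measurable borel"
    and H01: "\<And>j t. a \<le> t \<Longrightarrow> t \<le> b \<Longrightarrow> 0 \<le> H j t \<and> H j t \<le> 1" and u: "a \<le> u" "u \<le> b"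
  shows "nested_integral r u b (simplex_weight d H r k u b)
       = enn2real (chain_integral d a b (\<lambda>j t. ennreal (H j t)) r k u)"
  using u
proof (induction r arbitrary: k u)
  case 0
  then show ?case by (simp add: simplex_weight_def gap_def)
next
  case (Suc r)
  let ?C = "chain_integral d a b (\<lambda>j t. ennreal (H j t))"
  have fin: "?C r k t < \<infinity>" for r k t
    using H01 Suc.prems by (intro chain_integral_finite) auto
  have "indicator {u..b} x * nested_integral r x b (\<lambda>\<theta>s. simplex_weight d H (Suc r) k u b (x # \<theta>s))
      = enn2real (ennreal (gap d a b u x) * (ennreal (H (Suc k) x) * ?C r (Suc k) x))" for x
  proof (cases "x \<in> {u..b}")
    case True
    then have "nested_integral r x b (\<lambda>\<theta>s. simplex_weight d H (Suc r) k u b (x # \<theta>s))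
        = ((x - u) ^ (d - 1) * H (Suc k) x) * enn2real (?C r (Suc k) x)"
      unfolding simplex_weight_Cons nested_integral_cmult using Suc.IH[of x "Suc k"] Suc.prems by simp
    then show ?thesis
      using True Suc.prems H01[of x "Suc k"] by (simp add: gap_def enn2real_mult)
  qed (auto simp: gap_def)
  then have "nested_integral (Suc r) u b (simplex_weight d H (Suc r) k u b)
      = (\<integral>x. enn2real (ennreal (gap d a b u x) * (ennreal (H (Suc k) x) * ?C r (Suc k) x)) \<partial>lborel)"
    by (simp add: set_lebesgue_integral_def)
  also have "\<dots> = enn2real (\<integral>\<^sup>+x. ennreal (enn2real (ennreal (gap d a b u x) * (ennreal (H (Suc k) x) * ?C r (Suc k) x))) \<partial>lborel)"
    by (rule integral_eq_nn_integral) auto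
  also have "(\<integral>\<^sup>+x. ennreal (enn2real (ennreal (gap d a b u x) * (ennreal (H (Suc k) x) * ?C r (Suc k) x))) \<partial>lborel)
      = ?C (Suc r) k u"
    unfolding chain_integral.simps
    by (intro nn_integral_cong ennreal_enn2real) (use fin in \<open>auto simp: ennreal_mult_less_top\<close>)
  finally show ?case .
qed

section \<open>The mixing measure and its balance\<close>

definition with_boundary :: "nat \<Rightarrow> real \<Rightarrow> real \<Rightarrow> (nat \<Rightarrow> real) \<Rightarrow> nat \<Rightarrow> real" where
  "with_boundary N a b x i = (if i = 0 then a else if i \<le> N then x i else b)"

definition gap_weight :: "nat \<Rightarrow> nat \<Rightarrow> real \<Rightarrow> real \<Rightarrow> (nat \<Rightarrow> real) \<Rightarrow> real" where
  "gap_weight d N a b x =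
     (\<Prod>i=1..N+1. gap d a b (with_boundary N a b x (i - 1)) (with_boundary N a b x i))"

text \<open>The clamping makes the values bounded everywhere; it changes nothing where
  \<open>gap_weight\<close> does not vanish.\<close>

definition clamped :: "nat \<Rightarrow> real \<Rightarrow> real \<Rightarrow> nat \<Rightarrow> (nat \<Rightarrow> real) \<Rightarrow> real" where
  "clamped N a b i x = max a (min b (with_boundary N a b x i))"

text \<open>For the right c this is the joint law of the order statistics of ranks d, 2 d, ..., N d
  of d (N + 1) - 1 uniform points on (a, b).\<close>

definition gap_measure :: "nat \<Rightarrow> nat \<Rightarrow> real \<Rightarrow> real \<Rightarrow> real \<Rightarrow> (nat \<Rightarrow> real) measure" where
  "gap_measure d N c a b =
     density (\<Pi>\<^sub>M i\<in>{1..N}. lborel) (\<lambda>x. ennreal (c * gap_weight d N a b x))"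

lemma measurable_with_boundary [measurable]:
  "(\<lambda>x. with_boundary N a b x i) \<in> borel_measurable (\<Pi>\<^sub>M i\<in>{1..N}. lborel)"
proof (cases "i \<in> {1..N}")
  case True
  then have "(\<lambda>x. x i) \<in> borel_measurable (\<Pi>\<^sub>M i\<in>{1..N}. lborel)"
    using measurable_component_singleton[OF True, of "\<lambda>_. lborel"] by simp
  then show ?thesis using True by (simp add: with_boundary_def)
next
  case False
  then have "(\<lambda>x. with_boundary N a b x i) = (\<lambda>_. if i = 0 then a else b)"
    by (auto simp: with_boundary_def)
  then show ?thesis by simp
qed

lemma measurable_gap_weight [measurable]:
  "gap_weight d N a b \<in> borel_measurable (\<Pi>\<^sub>M i\<in>{1..N}. lborel)"
proof -
  have "(\<lambda>x. gap_weight d N a b x) \<in> borel_measurable (\<Pi>\<^sub>M i\<in>{1..N}. lborel)"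
    unfolding gap_weight_def by measurable
  then show ?thesis by simp
qed

lemma measurable_clamped [measurable]:
  "clamped N a b i \<in> borel_measurable (\<Pi>\<^sub>M i\<in>{1..N}. lborel)"
proof -
  have "(\<lambda>x. clamped N a b i x) \<in> borel_measurable (\<Pi>\<^sub>M i\<in>{1..N}. lborel)"
    unfolding clamped_def by measurable
  then show ?thesis by simp
qed

lemma gap_weight_nonneg [simp]: "0 \<le> gap_weight d N a b x"
  by (simp add: gap_weight_def prod_nonneg)

lemma clamped_eq:
  assumes "gap_weight d N a b x \<noteq> 0" "i \<in> {1..N}"
  shows "clamped N a b i x = x i"
proof -
  have "gap d a b (with_boundary N a b x (i - 1)) (with_boundary N a b x i) \<noteq> 0"
    using assms by (auto simp: gap_weight_def)
  then show ?thesis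
    using assms(2) by (auto simp: gap_def clamped_def with_boundary_def split: if_splits)
qed

lemma with_boundary_upd:
  "i \<in> {1..N} \<Longrightarrow> with_boundary N a b (x(i := t)) = (with_boundary N a b x)(i := t)"
  by (auto simp: with_boundary_def fun_eq_iff)

text \<open>Only the two gaps next to site i involve its coordinate; they form the weight of the
  single-site identity.\<close>

lemma gap_weight_upd:
  assumes i: "i \<in> {1..N}"
  shows "gap_weight d N a b (x(i := t)) =
    gap d a b (with_boundary N a b x (i - 1)) t * gap d a b t (with_boundary N a b x (i + 1)) *
    (\<Prod>l\<in>{1..N+1} - {i} - {i + 1}. gap d a b (with_boundary N a b x (l - 1)) (with_boundary N a b x l))"
proof -
  let ?X = "with_boundary N a b x"
  have vals: "(?X(i := t)) (i - 1) = ?X (i - 1)" "(?X(i := t)) (i + 1 - 1) = t"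
      "(?X(i := t)) (i + 1) = ?X (i + 1)" "(?X(i := t)) i = t"
    using i by auto
  have "gap_weight d N a b (x(i := t)) = (\<Prod>l=1..N+1. gap d a b ((?X(i := t)) (l - 1)) ((?X(i := t)) l))"
    by (simp add: gap_weight_def with_boundary_upd[OF i])
  also have "\<dots> = gap d a b ((?X(i := t)) (i - 1)) ((?X(i := t)) i) *
      (gap d a b ((?X(i := t)) (i + 1 - 1)) ((?X(i := t)) (i + 1)) *
      (\<Prod>l\<in>{1..N+1} - {i} - {i + 1}. gap d a b ((?X(i := t)) (l - 1)) ((?X(i := t)) l)))"
    using i by (subst prod.remove[of _ i], simp, simp, subst prod.remove[of _ "i + 1"]) auto
  also have "(\<Prod>l\<in>{1..N+1} - {i} - {i + 1}. gap d a b ((?X(i := t)) (l - 1)) ((?X(i := t)) l))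
      = (\<Prod>l\<in>{1..N+1} - {i} - {i + 1}. gap d a b (?X (l - 1)) (?X l))"
    by (intro prod.cong) auto
  finally show ?thesis
    by (simp only: vals mult.assoc)
qed

lemma stationary_mixture_gap_measure:
  assumes s: "0 < s" "2 * s = real d" and N: "1 \<le> N" and a: "0 \<le> a" "a \<le> b" and c: "0 \<le> c"
    and K: "prob_space (gap_measure d N c a b)"
  shows "stationary_mixture (gap_measure d N c a b) s b a b N (clamped N a b)"
proof (intro stationary_mixture.intro stationary_mixture_axioms.intro K s N)
  interpret K: prob_space "gap_measure d N c a b" by (rule K)
  interpret product_sigma_finite "\<lambda>_ :: nat. lborel :: real measure" by standard
  let ?X = "with_boundary N a b"
  show meas: "clamped N a b i \<in> borel_measurable (gap_measure d N c a b)" for i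
    unfolding gap_measure_def by measurable
  show bounds: "0 \<le> clamped N a b i x" "clamped N a b i x \<le> b" for i x
    using a by (auto simp: clamped_def)
  show "clamped N a b 0 x = a" "clamped N a b (N + 1) x = b" for x
    using a by (auto simp: clamped_def with_boundary_def)
  fix i \<xi> assume i: "i \<in> {1..N}"
  define G where "G x = product_law_except s N i (\<lambda>j. clamped N a b j x) \<xi> *
        (reservoir_defect s (clamped N a b (i - 1) x) (clamped N a b i x) (\<xi> i) +
         reservoir_defect s (clamped N a b (i + 1) x) (clamped N a b i x) (\<xi> i))" for x
  have G_meas: "G \<in> borel_measurable (\<Pi>\<^sub>M i\<in>{1..N}. lborel)"
  proof -
    have "(\<lambda>x. G x) \<in> borel_measurable (\<Pi>\<^sub>M i\<in>{1..N}. lborel)"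
      unfolding G_def product_law_except_def by measurable
    then show ?thesis by simp
  qed
  have "integrable (gap_measure d N c a b) G"
  proof (rule K.integrable_const_bound[of _ "1 * (2 * ln (1 + b) + 2 * ln (1 + b))"], rule AE_I2)
    fix x
    have "\<bar>reservoir_defect s (clamped N a b (i - 1) x) (clamped N a b i x) (\<xi> i) +
         reservoir_defect s (clamped N a b (i + 1) x) (clamped N a b i x) (\<xi> i)\<bar>
        \<le> 2 * ln (1 + b) + 2 * ln (1 + b)"
      by (intro order_trans[OF abs_triangle_ineq] add_mono abs_reservoir_defect_le s bounds)
    then show "norm (G x) \<le> 1 * (2 * ln (1 + b) + 2 * ln (1 + b))"
      unfolding G_def real_norm_def abs_mult
      by (intro mult_mono) (auto simp: product_law_except_nonneg product_law_except_le_1 s bounds)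
  qed (use G_meas in \<open>simp add: gap_measure_def\<close>)
  then have int: "integrable (\<Pi>\<^sub>M i\<in>{1..N}. lborel) (\<lambda>x. c * gap_weight d N a b x * G x)"
    unfolding gap_measure_def using c G_meas by (subst (asm) integrable_density) (auto simp del: One_nat_def)
  have ins: "insert i ({1..N} - {i}) = {1..N}" using i by auto
  have "(\<integral>x. G x \<partial>gap_measure d N c a b) = (\<integral>x. c * gap_weight d N a b x * G x \<partial>(\<Pi>\<^sub>M i\<in>{1..N}. lborel))"
    unfolding gap_measure_def using c G_meas by (subst integral_density) (auto simp del: One_nat_def)
  \<comment> \<open>The coordinate i becomes the inner variable: given the others it has the
    single-site weight between its neighbours, and the laws of the other sites do not involve
    it.\<close>
  also have "\<dots> = (\<integral>x. \<integral>t. c * gap_weight d N a b (x(i := t)) * G (x(i := t)) \<partial>lborel \<partial>(\<Pi>\<^sub>M i\<in>{1..N} - {i}. lborel))"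
    using product_integral_insert[of "{1..N} - {i}" i "\<lambda>x. c * gap_weight d N a b x * G x"] int
    unfolding ins by simp
  also have "\<dots> = (\<integral>x. (0 :: real) \<partial>(\<Pi>\<^sub>M i\<in>{1..N} - {i}. lborel :: real measure))"
  proof (rule Bochner_Integration.integral_cong[OF refl])
    fix x :: "nat \<Rightarrow> real"
    define u where "u = ?X x (i - 1)"
    define v where "v = ?X x (i + 1)"
    define C where "C = c * (\<Prod>l\<in>{1..N+1} - {i} - {i + 1}. gap d a b (?X x (l - 1)) (?X x l)) *
      product_law_except s N i (\<lambda>j. clamped N a b j x) \<xi>"
    have G_upd: "G (x(i := t)) = product_law_except s N i (\<lambda>j. clamped N a b j x) \<xi> *
        (reservoir_defect s (max a (min b u)) (max a (min b t)) (\<xi> i) +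
         reservoir_defect s (max a (min b v)) (max a (min b t)) (\<xi> i))" for t
    proof -
      have "product_law_except s N i (\<lambda>j. clamped N a b j (x(i := t))) \<xi> = product_law_except s N i (\<lambda>j. clamped N a b j x) \<xi>"
        unfolding product_law_except_def by (intro prod.cong) (auto simp: clamped_def with_boundary_upd[OF i])
      then show ?thesis
        using i by (auto simp: G_def clamped_def with_boundary_upd u_def v_def)
    qed
    have eq: "c * gap_weight d N a b (x(i := t)) * G (x(i := t)) = C * (gap d a b u t * gap d a b t v *
        (reservoir_defect s (max a (min b u)) (max a (min b t)) (\<xi> i) +
         reservoir_defect s (max a (min b v)) (max a (min b t)) (\<xi> i)))" for t
      unfolding gap_weight_upd[OF i] G_upd C_def u_def v_def by (simp add: mult_ac)
    show "(\<integral>t. c * gap_weight d N a b (x(i := t)) * G (x(i := t)) \<partial>lborel) = 0"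
    proof (cases "a \<le> u \<and> u \<le> v \<and> v \<le> b")
      \<comment> \<open>Inside the support clamping is the identity and the weight lives on [u, v],
        so the single-site identity applies.\<close>
      case True
      have "gap d a b u t * gap d a b t v *
        (reservoir_defect s (max a (min b u)) (max a (min b t)) (\<xi> i) +
         reservoir_defect s (max a (min b v)) (max a (min b t)) (\<xi> i))
        = indicator {u..v} t * ((t - u) ^ (d - 1) * (v - t) ^ (d - 1) *
          (reservoir_defect s u t (\<xi> i) + reservoir_defect s v t (\<xi> i)))" for t
        using True by (auto simp: gap_def indicator_def)
      then show ?thesis
        unfolding eq using reservoir_defect_integral_zero[OF s, of u v "\<xi> i"] True a by simp
    next
      case False
      then have "gap d a b u t * gap d a b t v = 0" for t by (auto simp: gap_def)
      then show ?thesis unfolding eq by (simp only: mult_zero_left mult_zero_right Bochner_Integration.integral_zero)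
    qed
  qed
  finally show "(\<integral>x. product_law_except s N i (\<lambda>j. clamped N a b j x) \<xi> *
        (reservoir_defect s (clamped N a b (i - 1) x) (clamped N a b i x) (\<xi> i) +
         reservoir_defect s (clamped N a b (i + 1) x) (clamped N a b i x) (\<xi> i)) \<partial>gap_measure d N c a b) = 0"
    by (simp add: G_def)
qed

lemma nn_integral_gap_measure:
  assumes c: "0 \<le> c" and G: "\<And>j. G j \<in> borel_measurable borel"
  shows "(\<integral>\<^sup>+x. (\<Prod>i=1..N. G i (clamped N a b i x)) \<partial>gap_measure d N c a b) = ennreal c * chain_integral d a b G N 0 a"
proof -
  note G[measurable]
  have set: "{0<..N} = {1..N}" by auto
  have "(\<integral>\<^sup>+x. (\<Prod>i=1..N. G i (clamped N a b i x)) \<partial>gap_measure d N c a b)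
      = (\<integral>\<^sup>+x. ennreal (c * gap_weight d N a b x) * (\<Prod>i=1..N. G i (clamped N a b i x)) \<partial>(\<Pi>\<^sub>M i\<in>{1..N}. lborel))"
    unfolding gap_measure_def by (rule nn_integral_density) measurable
  also have "\<dots> = (\<integral>\<^sup>+x. ennreal c * ((\<Prod>i\<in>{0<..0+N}. ennreal (gap d a b ((x(0 := a)) (i - 1)) (x i)) * G i (x i)) *
        ennreal (gap d a b ((x(0 := a)) (0 + N)) b)) \<partial>(\<Pi>\<^sub>M i\<in>{0<..0+N}. lborel))"
    unfolding add_0 set
  proof (intro nn_integral_cong)
    fix x :: "nat \<Rightarrow> real"
    have unclamp: "ennreal (c * gap_weight d N a b x) * (\<Prod>i=1..N. G i (clamped N a b i x))
        = ennreal (c * gap_weight d N a b x) * (\<Prod>i=1..N. G i (x i))"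
      using clamped_eq[of d N a b x] by (cases "gap_weight d N a b x = 0") (auto intro!: prod.cong)
    have weight: "gap_weight d N a b x = (\<Prod>i=1..N. gap d a b ((x(0 := a)) (i - 1)) (x i)) * gap d a b ((x(0 := a)) N) b"
    proof -
      have "(\<Prod>i=1..N. gap d a b (with_boundary N a b x (i - 1)) (with_boundary N a b x i)) =
          (\<Prod>i=1..N. gap d a b ((x(0 := a)) (i - 1)) (x i))"
        by (intro prod.cong) (auto simp: with_boundary_def)
      moreover have "gap d a b (with_boundary N a b x N) (with_boundary N a b x (Suc N)) = gap d a b ((x(0 := a)) N) b"
        by (simp add: with_boundary_def)
      ultimately show ?thesis by (simp add: gap_weight_def)
    qed
    show "ennreal (c * gap_weight d N a b x) * (\<Prod>i=1..N. G i (clamped N a b i x)) =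
       ennreal c * ((\<Prod>i=1..N. ennreal (gap d a b ((x(0 := a)) (i - 1)) (x i)) * G i (x i)) * ennreal (gap d a b ((x(0 := a)) N) b))"
      unfolding unclamp unfolding weight using c
      by (simp add: ennreal_mult prod_nonneg prod.distrib prod_ennreal mult_ac)
  qed
  also have "\<dots> = ennreal c * chain_integral d a b G N 0 a"
    unfolding chain_integral_eq_PiM[OF G]
  proof (rule nn_integral_cmult)
    have comp [measurable]: "(\<lambda>x. x i) \<in> borel_measurable (\<Pi>\<^sub>M i\<in>{0<..0+N}. lborel)" if "i \<in> {0<..0+N}" for i
      using measurable_component_singleton[OF that, of "\<lambda>_. lborel"] by simp
    have comp': "(\<lambda>x. (x(0 := a)) i) \<in> borel_measurable (\<Pi>\<^sub>M i\<in>{0<..0+N}. lborel)" if "i \<in> {0..0+N}" for i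
      using that comp[of i] by (cases "i = 0") auto
    show "(\<lambda>x. (\<Prod>i\<in>{0<..0+N}. ennreal (gap d a b ((x(0 := a)) (i - 1)) (x i)) * G i (x i)) *
        ennreal (gap d a b ((x(0 := a)) (0 + N)) b)) \<in> borel_measurable (\<Pi>\<^sub>M i\<in>{0<..0+N}. lborel)"
      by (intro borel_measurable_times_ennreal borel_measurable_prod_ennreal measurable_compose[OF comp G]
          measurable_compose[OF _ measurable_ennreal] borel_measurable_gap comp comp') auto
  qed
  finally show ?thesis .
qed

section \<open>From a uniform sample to its marked order statistics\<close>

lemma prod_multiples:
  fixes f :: "nat \<Rightarrow> 'a :: comm_monoid_mult"
  assumes d: "1 \<le> d"
  shows "(\<Prod>l<d * (N + 1) - 1. if d dvd Suc l then f (Suc l div d) else 1) = (\<Prod>i=1..N. f i)"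
proof -
  have "(\<Prod>l<d * (N + 1) - 1. if d dvd Suc l then f (Suc l div d) else 1)
      = (\<Prod>l\<in>{l \<in> {..<d * (N + 1) - 1}. d dvd Suc l}. f (Suc l div d))"
    by (rule prod.inter_filter[symmetric]) simp
  also have "\<dots> = (\<Prod>i=1..N. f i)"
  proof (rule prod.reindex_bij_witness[of _ "\<lambda>i. d * i - 1" "\<lambda>l. Suc l div d"])
    fix l assume l: "l \<in> {l \<in> {..<d * (N + 1) - 1}. d dvd Suc l}"
    then obtain m where m: "Suc l = d * m" by auto
    have "0 < d * m" "d * m < d * (N + 1)" unfolding m[symmetric] using l by auto
    then have "0 < m" "m < N + 1" unfolding mult_less_cancel1 by auto
    then show "Suc l div d \<in> {1..N}" "d * (Suc l div d) - 1 = l" "f (Suc l div d) = f (Suc l div d)"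
      using m d by auto
  next
    fix i assume i: "i \<in> {1..N}"
    then have "Suc (d * i - 1) = d * i" using d by simp
    moreover have "d * i - 1 < d * (N + 1) - 1"
    proof -
      have "d * i < d * (N + 1)" "0 < d * i" unfolding mult_less_cancel1 using i d by auto
      then show ?thesis by linarith
    qed
    ultimately show "Suc (d * i - 1) div d = i" "d * i - 1 \<in> {l \<in> {..<d * (N + 1) - 1}. d dvd Suc l}"
      using d by auto
  qed
  finally show ?thesis .
qed

text \<open>The constant collects n! orderings, the density 1 / (b - a) of each point, and a factor
  1 / (d - 1)! for each of the N + 1 blocks of unmarked points.\<close>

lemma nn_integral_order_stat:
  assumes M: "prob_space M" and d: "1 \<le> d" and n: "n = d * (N + 1) - 1" "1 \<le> n" and ab: "a < b"
    and indep: "prob_space.indep_vars M (\<lambda>_. borel) \<Theta> {1..n}"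
    and distr: "\<And>i. i \<in> {1..n} \<Longrightarrow> distr M borel (\<Theta> i) = uniform_measure lborel {a<..<b}"
    and G: "\<And>j. G j \<in> borel_measurable borel"
  shows "(\<integral>\<^sup>+\<omega>. (\<Prod>i=1..N. G i (order_stat n (\<lambda>j. \<Theta> j \<omega>) (d * i))) \<partial>M) =
    ennreal (fact n * ((1 / (b - a)) ^ n * (1 / fact (d - 1)) ^ (N + 1))) * chain_integral d a b G N 0 a"
proof -
  interpret prob_space M by (rule M)
  define g where "g = (\<lambda>j. if d dvd Suc j then G (Suc j div d) else (\<lambda>_. 1))"
  have g: "g j \<in> borel_measurable borel" for j using G by (auto simp: g_def)
  let ?D = "uniform_measure lborel {a<..<b}"
  interpret D: atomless_prob ?D g by (rule atomless_prob_uniform[OF ab g])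
  have rv: "\<Theta> i \<in> borel_measurable M" if "i \<in> {1..n}" for i
    using indep that unfolding indep_vars_def by auto
  have "distr M (\<Pi>\<^sub>M i\<in>{1..n}. borel) (\<lambda>\<omega>. \<lambda>i\<in>{1..n}. \<Theta> i \<omega>) = (\<Pi>\<^sub>M i\<in>{1..n}. distr M borel (\<Theta> i))"
    using indep_vars_iff_distr_eq_PiM'[where I = "{1..n}" and M' = "\<lambda>_. borel" and X = \<Theta>] rv indep n by simp
  also have "\<dots> = (\<Pi>\<^sub>M i\<in>{1..n}. ?D)"
    by (intro PiM_cong refl distr)
  finally have law: "distr M (\<Pi>\<^sub>M i\<in>{1..n}. borel) (\<lambda>\<omega>. \<lambda>i\<in>{1..n}. \<Theta> i \<omega>) = (\<Pi>\<^sub>M i\<in>{1..n}. ?D)" .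
  have "sets (\<Pi>\<^sub>M i\<in>{1..n}. ?D) = sets (\<Pi>\<^sub>M i\<in>{1..n}. borel)"
    by (intro sets_PiM_cong) auto
  then have sp_meas: "sorted_product g 0 {1..n} \<in> borel_measurable (\<Pi>\<^sub>M i\<in>{1..n}. borel)"
    using D.measurable_sorted_product[of "{1..n}" 0] measurable_cong_sets by blast
  have prod_eq: "(\<Prod>i=1..N. G i (order_stat n x (d * i))) = sorted_product g 0 {1..n} x" for x
  proof -
    have "sorted_product g 0 {1..n} x = (\<Prod>l<d * (N + 1) - 1. if d dvd Suc l then G (Suc l div d) (sorted_values {1..n} x ! (d * (Suc l div d) - 1)) else 1)"
      unfolding sorted_product_def n(1)[symmetric] by (auto simp: g_def intro!: prod.cong)
    also have "\<dots> = (\<Prod>i=1..N. G i (sorted_values {1..n} x ! (d * i - 1)))"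
      by (rule prod_multiples[OF d])
    finally show ?thesis by (simp add: order_stat_eq_sorted_values)
  qed
  have "(\<integral>\<^sup>+\<omega>. (\<Prod>i=1..N. G i (order_stat n (\<lambda>j. \<Theta> j \<omega>) (d * i))) \<partial>M)
      = (\<integral>\<^sup>+\<omega>. sorted_product g 0 {1..n} (\<lambda>i\<in>{1..n}. \<Theta> i \<omega>) \<partial>M)"
  proof (intro nn_integral_cong)
    fix \<omega>
    have "sorted_values {1..n} (\<lambda>j. \<Theta> j \<omega>) = sorted_values {1..n} (\<lambda>i\<in>{1..n}. \<Theta> i \<omega>)"
      by (rule sorted_values_cong) simp
    then show "(\<Prod>i=1..N. G i (order_stat n (\<lambda>j. \<Theta> j \<omega>) (d * i))) = sorted_product g 0 {1..n} (\<lambda>i\<in>{1..n}. \<Theta> i \<omega>)"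
      unfolding prod_eq sorted_product_def by simp
  qed
  also have "\<dots> = (\<integral>\<^sup>+x. sorted_product g 0 {1..n} x \<partial>distr M (\<Pi>\<^sub>M i\<in>{1..n}. borel) (\<lambda>\<omega>. \<lambda>i\<in>{1..n}. \<Theta> i \<omega>))"
  proof (rule nn_integral_distr[symmetric])
    show "(\<lambda>\<omega>. \<lambda>i\<in>{1..n}. \<Theta> i \<omega>) \<in> M \<rightarrow>\<^sub>M (\<Pi>\<^sub>M i\<in>{1..n}. borel)"
      by (intro measurable_restrict rv)
    show "sorted_product g 0 {1..n} \<in> borel_measurable (distr M (\<Pi>\<^sub>M i\<in>{1..n}. borel) (\<lambda>\<omega>. \<lambda>i\<in>{1..n}. \<Theta> i \<omega>))"
      using sp_meas by simp
  qed
  \<comment> \<open>The inserted indicators are almost surely 1; they start the ordered integral at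
    u = a.\<close>
  also have "\<dots> = (\<integral>\<^sup>+x. (\<Prod>i\<in>{1..n}. indicator {a..} (x i)) * sorted_product g 0 {1..n} x \<partial>(\<Pi>\<^sub>M i\<in>{1..n}. ?D))"
    unfolding law
  proof (rule nn_integral_cong_AE)
    have "AE x in \<Pi>\<^sub>M i\<in>{1..n}. ?D. \<forall>i\<in>{1..n}. a \<le> x i"
    proof (rule AE_finite_allI)
      fix i assume "i \<in> {1..n}"
      moreover have "AE t in ?D. a \<le> t" by (intro AE_uniform_measureI) (auto intro!: AE_I2)
      ultimately show "AE x in \<Pi>\<^sub>M i\<in>{1..n}. ?D. a \<le> x i"
        using ab by (intro AE_PiM_component prob_space_uniform_measure) auto
    qed simp
    then show "AE x in \<Pi>\<^sub>M i\<in>{1..n}. ?D. sorted_product g 0 {1..n} x = (\<Prod>i\<in>{1..n}. indicator {a..} (x i)) * sorted_product g 0 {1..n} x"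
      by eventually_elim simp
  qed
  also have "\<dots> = fact n * iterated_integral ?D g n 0 a"
    using D.nn_integral_sorted_product[of "{1..n}" a 0] by simp
  also have "\<dots> = fact n * (ennreal (1 / (b - a)) ^ n * (ennreal (1 / fact (d - 1)) ^ (N + 1) * chain_integral d a b G N 0 a))"
    using iterated_integral_uniform[where g = g and u = a and n = n and j = 0, OF ab g]
      simplex_integral_eq_chain_integral[where G = G and a = a and u = a and b = b and r = N and k = 0, OF d G] ab n(1)
    by (simp add: g_def del: power_Suc)
  also have "\<dots> = ennreal (fact n * ((1 / (b - a)) ^ n * (1 / fact (d - 1)) ^ (N + 1))) * chain_integral d a b G N 0 a"
  proof -
    have powers: "ennreal (1 / (b - a)) ^ n = ennreal ((1 / (b - a)) ^ n)"
      "ennreal (1 / fact (d - 1)) ^ (N + 1) = ennreal ((1 / fact (d - 1)) ^ (N + 1))"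
      using ab by (intro ennreal_power; simp)+
    have fact: "(fact n :: ennreal) = ennreal (fact n)"
      by (metis ennreal_of_nat_eq_real_of_nat of_nat_fact)
    have assoc: "ennreal (x * (y * z)) * w = ennreal x * (ennreal y * (ennreal z * w))"
      if "0 \<le> x" "0 \<le> y" "0 \<le> z" for x y z w
      using that by (simp add: ennreal_mult mult.assoc)
    show ?thesis unfolding powers fact by (subst assoc) (use ab in auto)
  qed
  finally show ?thesis .
qed

lemma order_stat_mem:
  assumes "1 \<le> k" "k \<le> n"
  shows "order_stat n x k \<in> x ` {1..n}"
  unfolding order_stat_eq_sorted_values
  using nth_mem[of "k - 1" "sorted_values {1..n} x"] assms by (auto simp: set_sorted_values)

lemma order_stat_cong:
  assumes "\<And>i. i \<in> {1..n} \<Longrightarrow> x i = y i"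
  shows "order_stat n x k = order_stat n y k"
  unfolding order_stat_eq_sorted_values using sorted_values_cong[of "{1..n}" x y] assms by simp

lemma measurable_order_stat:
  assumes \<Theta>: "\<And>i. i \<in> {1..n} \<Longrightarrow> \<Theta> i \<in> borel_measurable M" and k: "1 \<le> k" "k \<le> n"
  shows "(\<lambda>\<omega>. order_stat n (\<lambda>j. \<Theta> j \<omega>) k) \<in> borel_measurable M"
proof -
  have "(\<lambda>\<omega>. \<lambda>i\<in>{1..n}. \<Theta> i \<omega>) \<in> M \<rightarrow>\<^sub>M (\<Pi>\<^sub>M i\<in>{1..n}. borel)"
    by (intro measurable_restrict \<Theta>)
  moreover have "(\<lambda>x. sorted_values {1..n} x ! (k - 1)) \<in> borel_measurable (\<Pi>\<^sub>M i\<in>{1..n}. borel)"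
    using k by (intro measurable_sorted_values_nth) auto
  ultimately have "(\<lambda>\<omega>. sorted_values {1..n} (\<lambda>i\<in>{1..n}. \<Theta> i \<omega>) ! (k - 1)) \<in> borel_measurable M"
    by (rule measurable_compose)
  moreover have "sorted_values {1..n} (\<lambda>i\<in>{1..n}. \<Theta> i \<omega>) = sorted_values {1..n} (\<lambda>j. \<Theta> j \<omega>)" for \<omega>
    by (rule sorted_values_cong) simp
  ultimately show ?thesis by (simp add: order_stat_eq_sorted_values)
qed

lemma distr_affine_uniform:
  assumes M: "prob_space M" and U: "U \<in> borel_measurable M"
    and distr: "distr M borel U = uniform_measure lborel {0<..<1 :: real}" and ab: "a < b"
  shows "distr M borel (\<lambda>\<omega>. a + (b - a) * U \<omega>) = uniform_measure lborel {a<..<b}"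
proof -
  interpret prob_space M by (rule M)
  have lborel: "distr M lborel X = distr M borel X" for X :: "_ \<Rightarrow> real"
    by (rule distr_cong) auto
  have "distributed M lborel U (\<lambda>x. indicator {0<..<1} x)"
    unfolding distributed_def lborel distr using U by (simp add: uniform_measure_def divide_ennreal_def)
  then have "distributed M lborel (\<lambda>\<omega>. a + (b - a) * U \<omega>) (\<lambda>x. indicator {0<..<1} ((x - a) / (b - a)) / ennreal \<bar>b - a\<bar>)"
    by (rule distributed_affine) (use ab in simp)
  then have "distr M borel (\<lambda>\<omega>. a + (b - a) * U \<omega>) = density lborel (\<lambda>x. indicator {0<..<1} ((x - a) / (b - a)) / ennreal \<bar>b - a\<bar>)"
    by (simp add: distributed_def lborel)
  also have "(\<lambda>x. indicator {0<..<1} ((x - a) / (b - a)) / ennreal \<bar>b - a\<bar>) = (\<lambda>x. indicator {a<..<b} x / emeasure lborel {a<..<b})"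
    using ab by (auto simp: fun_eq_iff indicator_def field_simps)
  finally show ?thesis by (simp add: uniform_measure_def)
qed

section \<open>The invariant law for equal and for unequal reservoirs\<close>

theorem theorem3p1:
  fixes s \<rho>l \<rho>r :: real and d N n :: nat
    and P :: "real \<Rightarrow> (nat \<Rightarrow> nat) \<Rightarrow> (nat \<Rightarrow> nat) pmf"
    and M :: "'a measure" and U \<Theta> :: "nat \<Rightarrow> 'a \<Rightarrow> real"
  assumes "s > 0" and "2 * s = real d" and "N \<ge> 1"
    and "0 \<le> \<rho>l" and "\<rho>l \<le> \<rho>r"
    and "n = d * (N + 1) - 1"
    and "harmonic_process s N \<rho>l \<rho>r P"
    and "prob_space M"
    and "prob_space.indep_vars M (\<lambda>_. borel) U {1..n}"
    and "\<And>i. i \<in> {1..n} \<Longrightarrow> distr M borel (U i) = uniform_measure lborel {0<..<1}"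
    and "\<And>i \<omega>. i \<in> {1..n} \<Longrightarrow> \<omega> \<in> space M \<Longrightarrow> \<Theta> i \<omega> = \<rho>l + (\<rho>r - \<rho>l) * U i \<omega>"
  shows "(\<exists>!\<mu>. invariant_law (configs N) P \<mu>) \<and>
    (\<forall>\<mu>. invariant_law (configs N) P \<mu> \<longrightarrow> (\<forall>\<eta>\<in>configs N.
       pmf \<mu> \<eta> = prob_space.expectation M
         (\<lambda>\<omega>. \<Prod>i=1..N. neg_binomial s (order_stat n (\<lambda>j. \<Theta> j \<omega>) (d * i)) (\<eta> i)) \<and>
       (\<rho>l < \<rho>r \<longrightarrow>
         pmf \<mu> \<eta> =
           Gamma (2 * s * (real N + 1)) / Gamma (2 * s) ^ (N + 1) *
           (1 / (\<rho>r - \<rho>l) ^ (d * (N + 1) - 1)) *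
           nested_integral N \<rho>l \<rho>r (\<lambda>\<theta>s. let \<theta> = (\<lambda>i. (\<rho>l # \<theta>s @ [\<rho>r]) ! i) in
             (\<Prod>i=1..N+1. (\<theta> i - \<theta> (i - 1)) ^ (d - 1)) *
             (\<Prod>i=1..N. 1 / fact (\<eta> i) * (Gamma (2 * s + real (\<eta> i)) / Gamma (2 * s)) *
                (\<theta> i / (1 + \<theta> i)) ^ \<eta> i * (1 / (1 + \<theta> i)) powr (2 * s))))))"
proof -
  have s: "0 < s" "2 * s = real d" and N: "1 \<le> N" and \<rho>: "0 \<le> \<rho>l" "\<rho>l \<le> \<rho>r" and n: "n = d * (N + 1) - 1"
    using assms by auto
  have d: "1 \<le> d" using s by (cases d) auto
  have "2 * 1 \<le> (N + 1) * d" using N d by (intro mult_le_mono) auto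
  then have n1: "1 \<le> n" unfolding n by (simp add: mult.commute)
  have index: "1 \<le> d * i" "d * i \<le> n" if "i \<in> {1..N}" for i
  proof -
    have "d * i < d * (N + 1)" "0 < d * i" unfolding mult_less_cancel1 using that d by auto
    then show "1 \<le> d * i" "d * i \<le> n" unfolding n by linarith+
  qed
  interpret M: prob_space M by (rule assms)
  let ?E = "\<lambda>\<eta>. M.expectation (\<lambda>\<omega>. \<Prod>i=1..N. neg_binomial s (order_stat n (\<lambda>j. \<Theta> j \<omega>) (d * i)) (\<eta> i))"
  define w where "w \<eta> = Gamma (2 * s * (real N + 1)) / Gamma (2 * s) ^ (N + 1) *
           (1 / (\<rho>r - \<rho>l) ^ (d * (N + 1) - 1)) *
           nested_integral N \<rho>l \<rho>r (\<lambda>\<theta>s. let \<theta> = (\<lambda>i. (\<rho>l # \<theta>s @ [\<rho>r]) ! i) in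
             (\<Prod>i=1..N+1. (\<theta> i - \<theta> (i - 1)) ^ (d - 1)) *
             (\<Prod>i=1..N. 1 / fact (\<eta> i) * (Gamma (2 * s + real (\<eta> i)) / Gamma (2 * s)) *
                (\<theta> i / (1 + \<theta> i)) ^ \<eta> i * (1 / (1 + \<theta> i)) powr (2 * s)))" for \<eta>
  have "\<exists>\<mu>\<^sub>0. (\<forall>\<mu>. invariant_law (configs N) P \<mu> \<longleftrightarrow> \<mu> = \<mu>\<^sub>0) \<and>
      (\<forall>\<eta>\<in>configs N. pmf \<mu>\<^sub>0 \<eta> = ?E \<eta> \<and> (\<rho>l < \<rho>r \<longrightarrow> pmf \<mu>\<^sub>0 \<eta> = w \<eta>))"
  proof (cases "\<rho>l < \<rho>r")
    \<comment> \<open>With equal reservoirs the gap density degenerates, and the profile is taken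
      constant. Both defects then vanish pointwise, and all order statistics equal \<rho>l.\<close>
    case False
    then have eq: "\<rho>r = \<rho>l" using \<rho> by simp
    interpret stationary_mixture M s \<rho>l \<rho>l \<rho>r N "\<lambda>_ _. \<rho>l"
      by standard (use s N \<rho> eq in \<open>auto simp: reservoir_defect_def\<close>)
    have "?E \<eta> = mixed_law \<eta>" for \<eta>
      unfolding mixed_law_def product_law_def
    proof (intro Bochner_Integration.integral_cong prod.cong refl)
      fix \<omega> i assume \<omega>: "\<omega> \<in> space M" and i: "i \<in> {1..N}"
      have "order_stat n (\<lambda>j. \<Theta> j \<omega>) (d * i) \<in> (\<lambda>j. \<Theta> j \<omega>) ` {1..n}"
        by (intro order_stat_mem index i)
      then have "order_stat n (\<lambda>j. \<Theta> j \<omega>) (d * i) = \<rho>l"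
        using assms(11)[OF _ \<omega>] eq by auto
      then show "neg_binomial s (order_stat n (\<lambda>j. \<Theta> j \<omega>) (d * i)) (\<eta> i) = neg_binomial s \<rho>l (\<eta> i)"
        by simp
    qed
    then show ?thesis
      using invariant_law_mixed[OF assms(7)] False by (intro exI[of _ mixed_pmf]) (auto simp: pmf_mixed)
  next
    case True
    \<comment> \<open>\<Theta> is prescribed only on \<open>space M\<close> and for the indices 1,
      ..., n. T is an affine image of U everywhere, so independence and law carry over from
      U.\<close>
    define T where "T i \<omega> = \<rho>l + (\<rho>r - \<rho>l) * U i \<omega>" for i \<omega>
    have U: "U i \<in> borel_measurable M" if "i \<in> {1..n}" for i
      using assms(9) that unfolding M.indep_vars_def by auto
    have T_meas: "T i \<in> borel_measurable M" if "i \<in> {1..n}" for i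
      using U[OF that] unfolding T_def by measurable
    have T_indep: "M.indep_vars (\<lambda>_. borel) T {1..n}"
      unfolding T_def
      by (rule M.indep_vars_compose2[OF assms(9), where Y = "\<lambda>_ u. \<rho>l + (\<rho>r - \<rho>l) * u"]) simp
    have T_distr: "distr M borel (T i) = uniform_measure lborel {\<rho>l<..<\<rho>r}" if "i \<in> {1..n}" for i
      unfolding T_def by (rule distr_affine_uniform[OF assms(8) U[OF that] assms(10)[OF that] True])
    have order_T: "order_stat n (\<lambda>j. \<Theta> j \<omega>) k = order_stat n (\<lambda>j. T j \<omega>) k" if "\<omega> \<in> space M" for \<omega> k
      by (rule order_stat_cong) (use assms(11) that in \<open>auto simp: T_def\<close>)
    define c :: real where "c = fact n * ((1 / (\<rho>r - \<rho>l)) ^ n * (1 / fact (d - 1)) ^ (N + 1))"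
    have c: "0 \<le> c" using True by (simp add: c_def)
    have E_chain: "(\<integral>\<^sup>+\<omega>. (\<Prod>i=1..N. G i (order_stat n (\<lambda>j. T j \<omega>) (d * i))) \<partial>M) = ennreal c * chain_integral d \<rho>l \<rho>r G N 0 \<rho>l"
      if "\<And>j. G j \<in> borel_measurable borel" for G
      unfolding c_def by (rule nn_integral_order_stat[OF assms(8) d n n1 True T_indep T_distr that])
    have K: "prob_space (gap_measure d N c \<rho>l \<rho>r)"
    proof
      have "emeasure (gap_measure d N c \<rho>l \<rho>r) (space (gap_measure d N c \<rho>l \<rho>r))
          = ennreal c * chain_integral d \<rho>l \<rho>r (\<lambda>_ _. 1) N 0 \<rho>l"
        using nn_integral_gap_measure[where G = "\<lambda>_ _. 1" and N = N and a = \<rho>l and b = \<rho>r and d = d, OF c] by simp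
      \<comment> \<open>For G = 1 the order statistics identity has left side 1, so c normalises the
        gap density without evaluating any integral.\<close>
      also have "\<dots> = 1" using E_chain[of "\<lambda>_ _. 1"] by (simp add: M.emeasure_space_1)
      finally show "emeasure (gap_measure d N c \<rho>l \<rho>r) (space (gap_measure d N c \<rho>l \<rho>r)) = 1" .
    qed
    interpret K: stationary_mixture "gap_measure d N c \<rho>l \<rho>r" s \<rho>r \<rho>l \<rho>r N "clamped N \<rho>l \<rho>r"
      by (rule stationary_mixture_gap_measure[OF s N \<rho> c K])
    have law: "K.mixed_law \<eta> = ?E \<eta>" "K.mixed_law \<eta> = w \<eta>" for \<eta>
    proof -
      define H where "H i t = neg_binomial s t (\<eta> i)" for i t
      have H_meas [measurable]: "H i \<in> borel_measurable borel" for i unfolding H_def by measurable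
      have H: "0 \<le> H i t" "H i t \<le> 1" if "\<rho>l \<le> t" for i t
        using that s(1) \<rho> by (auto simp: H_def neg_binomial_nonneg neg_binomial_le_1)
      let ?C = "chain_integral d \<rho>l \<rho>r (\<lambda>i t. ennreal (H i t)) N 0 \<rho>l"
      have "ennreal (K.mixed_law \<eta>) = (\<integral>\<^sup>+x. (\<Prod>i=1..N. ennreal (H i (clamped N \<rho>l \<rho>r i x))) \<partial>gap_measure d N c \<rho>l \<rho>r)"
        unfolding K.ennreal_mixed_law product_law_def H_def
        by (intro nn_integral_cong prod_ennreal[symmetric] neg_binomial_nonneg s K.nonneg)
      also have "\<dots> = ennreal c * ?C"
        by (rule nn_integral_gap_measure[OF c]) measurable
      finally have mixed: "ennreal (K.mixed_law \<eta>) = ennreal c * ?C" .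
      show "K.mixed_law \<eta> = ?E \<eta>"
      proof -
        \<comment> \<open>U i may leave (0, 1) on a null set, so densities are at least \<rho>l only
          almost surely.\<close>
        have AE_T: "AE \<omega> in M. \<forall>i\<in>{1..n}. \<rho>l \<le> T i \<omega>"
        proof (rule AE_finite_allI)
          fix i assume i: "i \<in> {1..n}"
          have "AE t in distr M borel (T i). \<rho>l \<le> t"
            unfolding T_distr[OF i] by (intro AE_uniform_measureI) (auto intro!: AE_I2)
          then show "AE \<omega> in M. \<rho>l \<le> T i \<omega>"
            by (subst (asm) AE_distr_iff[OF T_meas[OF i]]) auto
        qed simp
        have nonneg: "AE \<omega> in M. \<forall>i\<in>{1..N}. 0 \<le> H i (order_stat n (\<lambda>j. T j \<omega>) (d * i))"
          using AE_T
        proof eventually_elim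
          case (elim \<omega>)
          show ?case
          proof
            fix i assume i: "i \<in> {1..N}"
            have "order_stat n (\<lambda>j. T j \<omega>) (d * i) \<in> (\<lambda>j. T j \<omega>) ` {1..n}"
              by (intro order_stat_mem index i)
            then have "\<rho>l \<le> order_stat n (\<lambda>j. T j \<omega>) (d * i)" using elim by auto
            then show "0 \<le> H i (order_stat n (\<lambda>j. T j \<omega>) (d * i))" by (rule H)
          qed
        qed
        have meas: "(\<lambda>\<omega>. \<Prod>i=1..N. H i (order_stat n (\<lambda>j. T j \<omega>) (d * i))) \<in> borel_measurable M"
          by (intro borel_measurable_prod measurable_compose[OF measurable_order_stat H_meas] T_meas index)
        have "?E \<eta> = M.expectation (\<lambda>\<omega>. \<Prod>i=1..N. H i (order_stat n (\<lambda>j. T j \<omega>) (d * i)))"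
          unfolding H_def by (intro Bochner_Integration.integral_cong refl) (simp only: order_T)
        also have "\<dots> = enn2real (\<integral>\<^sup>+\<omega>. ennreal (\<Prod>i=1..N. H i (order_stat n (\<lambda>j. T j \<omega>) (d * i))) \<partial>M)"
          by (rule integral_eq_nn_integral[OF meas]) (use nonneg in \<open>eventually_elim, auto intro!: prod_nonneg\<close>)
        also have "(\<integral>\<^sup>+\<omega>. ennreal (\<Prod>i=1..N. H i (order_stat n (\<lambda>j. T j \<omega>) (d * i))) \<partial>M)
            = (\<integral>\<^sup>+\<omega>. (\<Prod>i=1..N. ennreal (H i (order_stat n (\<lambda>j. T j \<omega>) (d * i)))) \<partial>M)"
        proof (rule nn_integral_cong_AE)
          show "AE \<omega> in M. ennreal (\<Prod>i=1..N. H i (order_stat n (\<lambda>j. T j \<omega>) (d * i)))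
              = (\<Prod>i=1..N. ennreal (H i (order_stat n (\<lambda>j. T j \<omega>) (d * i))))"
            using nonneg by eventually_elim (rule prod_ennreal[symmetric], auto)
        qed
        also have "\<dots> = ennreal c * ?C"
          by (rule E_chain) measurable
        finally show ?thesis unfolding mixed[symmetric] using K.mixed_law_nonneg by simp
      qed
      show "K.mixed_law \<eta> = w \<eta>"
      proof -
        have weight: "simplex_weight d H N 0 \<rho>l \<rho>r = (\<lambda>\<theta>s. let \<theta> = (\<lambda>i. (\<rho>l # \<theta>s @ [\<rho>r]) ! i) in
             (\<Prod>i=1..N+1. (\<theta> i - \<theta> (i - 1)) ^ (d - 1)) *
             (\<Prod>i=1..N. 1 / fact (\<eta> i) * (Gamma (2 * s + real (\<eta> i)) / Gamma (2 * s)) *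
                (\<theta> i / (1 + \<theta> i)) ^ \<eta> i * (1 / (1 + \<theta> i)) powr (2 * s)))"
          unfolding simplex_weight_def H_def neg_binomial_def Let_def add_0 ..
        \<comment> \<open>From 2 s = d: n! is Gamma at n + 1 = 2 s (N + 1), and (d - 1)! is Gamma at
          2 s.\<close>
        have c_eq: "c = Gamma (2 * s * (real N + 1)) / Gamma (2 * s) ^ (N + 1) * (1 / (\<rho>r - \<rho>l) ^ (d * (N + 1) - 1))"
        proof -
          have "real n + 1 = real (d * (N + 1))" using n n1 by (simp flip: of_nat_Suc)
          then have "2 * s * (real N + 1) = 1 + real n" using s by (simp add: algebra_simps)
          moreover have "2 * s = 1 + real (d - 1)" using s d by simp
          ultimately show ?thesis unfolding n[symmetric] c_def
            by (simp only: Gamma_fact power_divide power_one) (simp add: field_simps)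
        qed
        have "K.mixed_law \<eta> = enn2real (ennreal c * ?C)"
          using mixed K.mixed_law_nonneg by (metis enn2real_ennreal)
        also have "\<dots> = c * nested_integral N \<rho>l \<rho>r (simplex_weight d H N 0 \<rho>l \<rho>r)"
          using nested_integral_eq_chain_integral[where H = H and a = \<rho>l and b = \<rho>r and u = \<rho>l and k = 0 and r = N and d = d]
            H H_meas \<rho> c by (simp add: enn2real_mult)
        also have "\<dots> = w \<eta>" unfolding w_def c_eq weight ..
        finally show ?thesis .
      qed
    qed
    show ?thesis
      by (intro exI[of _ K.mixed_pmf] conjI allI ballI impI K.invariant_law_mixed assms(7))
         (simp_all only: K.pmf_mixed if_True law(1), simp only: law flip: law(1))
  qed
  then show ?thesis unfolding w_def by auto
qed

end
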